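(* Let $q$ be a power of a prime $p$, $\ell\ge1$, and let $N>1$ be an integer with $N-1\mid q^{2\ell}-1$ and $p\mid N$. Let $\mathcal{A}=\{a_0=0<a_1<a_2<\cdots<a_z\}$ be the set of minimal representatives of the minimal cyclotomic sets $\mathfrak{I}_{a_i}$, $0\le i\le z$, of $\{0,1,\dots,N-1\}$ with respect to $q^2$. Let $0\le t\le z$, let $\Delta=\bigcup_{i=0}^{t-1}\mathfrak{I}_{a_i}\cup\{a_t\}$ and $\Delta''=\bigcup_{i=0}^{t}\mathfrak{I}_{a_i}$, and suppose that $\mathrm{RS}(N,\Delta'')_{q^2}\subset(\mathrm{RS}(N,\Delta'')_{q^2})^{\perp_h}$. Then there is an EAQECC with parameters $[[n,\kappa,\ge\delta;c]]_q$, where $n=N+1$, $\kappa=N+1-2\left(\sum_{i=0}^t n_{a_i}\right)+c$, $\delta=a_t+2$ and $c\le1$.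
   Context: Cyclotomic sets. Let $\mathbb{Z}_N=\{0\}\cup\mathbb{Z}/\langle N-1\rangle$, where the classes of $\mathbb{Z}/\langle N-1\rangle$ are represented by $\{1,\dots,N-1\}$ (so $0$ and $N-1$ are distinct and $q^2\cdot0=0$); $\mathbb{Z}_N$ is identified with $\{0,1,\dots,N-1\}$. For $z\in\mathbb{Z}_N$, $\mathfrak{I}_z=\{q^{2i}\cdot z: i\ge 0\}$ is the minimal cyclotomic set of $z$ with respect to $q^2$, and $n_z=|\mathfrak{I}_z|$. A minimal representative of a minimal cyclotomic set is its least element. Codes. $Y_N=\{y\in\mathbb{F}_{q^{2\ell}}: y^N=y\}$ ($N$ elements). For $\Gamma\subset\{0,\dots,N-1\}$, $\mathrm{RS}(N,\Gamma)\subset\mathbb{F}_{q^{2\ell}}^N$ is the $\mathbb{F}_{q^{2\ell}}$-linear code spanned by the vectors $(y^i)_{y\in Y_N}$, $i\in\Gamma$ (with $0^0=1$), and $\mathrm{RS}(N,\Gamma)_{q^2}=\mathrm{RS}(N,\Gamma)\cap\mathbb{F}_{q^2}^N$. For a code $C\subset\mathbb{F}_{q^2}^m$, $C^{\perp_h}$ is its dual with respect to the Hermitian product $a\cdot_h b=\sum_i a_ib_i^q$. EAQECC (entanglement-assisted quantum error-correcting code), standard definition. Let $H=\mathbb{C}^q$ with orthonormal basis $\{|x\rangle: x\in\mathbb{F}_q\}$ and $|\Phi\rangle=q^{-1/2}\sum_{x\in\mathbb{F}_q}|x\rangle|x\rangle\in H\otimes H$. An EAQECC encoding $\kappa$ qudits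 into $n$ qudits using $c$ maximally entangled pairs ($\kappa,c\ge0$, $\kappa+c\le n$) is a subspace $Q\subset H^{\otimes n}\otimes H^{\otimes c}$ of the form $\{(U\otimes I)(|\psi\rangle\otimes|0\rangle^{\otimes(n-\kappa-c)}\otimes|\Phi\rangle^{\otimes c}):|\psi\rangle\in H^{\otimes\kappa}\}$, where the first factor $H^{\otimes n}$ consists of the sender's qudits (including the sender's halves of the $c$ pairs), the last factor $H^{\otimes c}$ consists of the receiver's (noiseless) halves, and $U$ is a unitary on $H^{\otimes n}$. It has minimum distance at least $\delta$ if, with $P$ the orthogonal projector onto $Q$, $P(E\otimes I)P\in\mathbb{C}P$ for every operator $E$ on $H^{\otimes n}$ acting nontrivially on fewer than $\delta$ of the $n$ qudits. Parameters $[[n,\kappa,\ge\delta;c]]_q$ mean such a code with minimum distance at least $\delta$. *)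

theory Defs
  imports
    Complex_Main
    "HOL-Library.Function_Algebras"
    "HOL-Library.NList"
    "HOL-Computational_Algebra.Primes"
begin

text \<open>
  The set \<open>\<int>\<^sub>N = {0} \<union> \<int>/\<langle>N - 1\<rangle>\<close> is identified with \<open>{0,\<dots>,N-1}\<close>; the residue classes
  are represented by \<open>{1,\<dots>,N-1}\<close>, so the zero class is \<open>N - 1\<close>, which differs from the extra
  element \<open>0\<close>. The following is the action of \<open>k\<close> on \<open>z\<close>.
\<close>

definition zn_mult :: "nat \<Rightarrow> nat \<Rightarrow> nat \<Rightarrow> nat" where
  "zn_mult N k z =
     (if z = 0 then 0
      else if (k * z) mod (N - 1) = 0 then N - 1
      else (k * z) mod (N - 1))"

definition cyc_set :: "nat \<Rightarrow> nat \<Rightarrow> nat \<Rightarrow> nat set" where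
  "cyc_set q N z = {zn_mult N (q ^ (2 * i)) z | i. True}"

definition min_reps :: "nat \<Rightarrow> nat \<Rightarrow> nat set" where
  "min_reps q N = {Min (cyc_set q N z) | z. z \<in> {0..<N}}"

text \<open>
  The type \<open>'f\<close> plays the role of the big field (of \<open>q ^ (2 * l)\<close> elements); its subfield with
  \<open>r\<close> elements, when there is one, consists of the roots of \<open>X ^ r - X\<close>.
\<close>

definition GF :: "nat \<Rightarrow> 'f :: finite_field set" where
  "GF r = {x. x ^ r = x}"

definition Y :: "nat \<Rightarrow> 'f :: finite_field set" where
  "Y N = {y. y ^ N = y}"

text \<open>
  Vectors with coordinates indexed by a set \<open>I\<close> are functions that vanish outside \<open>I\<close>.
\<close>

definition vectors_over :: "'i set \<Rightarrow> 'f set \<Rightarrow> ('i \<Rightarrow> 'f :: finite_field) set" where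
  "vectors_over I K = {v. (\<forall>i\<in>I. v i \<in> K) \<and> (\<forall>i. i \<notin> I \<longrightarrow> v i = 0)}"

definition eval_vec :: "nat \<Rightarrow> nat \<Rightarrow> 'f \<Rightarrow> 'f :: finite_field" where
  "eval_vec N i = (\<lambda>y. if y \<in> Y N then y ^ i else 0)"

lemma vector_space_fun: "vector_space (\<lambda>(c :: 'f :: field) (v :: 'i \<Rightarrow> 'f) y. c * v y)"
  by standard (simp_all add: fun_eq_iff algebra_simps)

definition RS :: "nat \<Rightarrow> nat set \<Rightarrow> ('f \<Rightarrow> 'f :: finite_field) set" where
  "RS N \<Gamma> = module.span (\<lambda>c v y. c * v y) (eval_vec N ` \<Gamma>)"

definition subfield_RS :: "nat \<Rightarrow> nat \<Rightarrow> nat set \<Rightarrow> ('f \<Rightarrow> 'f :: finite_field) set" where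
  "subfield_RS q N \<Gamma> = RS N \<Gamma> \<inter> vectors_over (Y N) (GF (q ^ 2))"

definition herm_prod ::
    "nat \<Rightarrow> 'i set \<Rightarrow> ('i \<Rightarrow> 'f) \<Rightarrow> ('i \<Rightarrow> 'f) \<Rightarrow> 'f :: finite_field" where
  "herm_prod q I a b = (\<Sum>i\<in>I. a i * b i ^ q)"

definition herm_dual ::
    "nat \<Rightarrow> 'i set \<Rightarrow> ('i \<Rightarrow> 'f) set \<Rightarrow> ('i \<Rightarrow> 'f :: finite_field) set" where
  "herm_dual q I C =
     {b \<in> vectors_over I (GF (q ^ 2)). \<forall>a\<in>C. herm_prod q I a b = 0}"

text \<open>
  For a finite alphabet \<open>A\<close>, \<open>H = \<complex>\<^sup>A\<close> has the orthonormal basis \<open>|x\<rangle>\<close>, \<open>x \<in> A\<close>. The \<open>m\<close>-th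
  tensor power of \<open>H\<close> has the orthonormal basis \<open>|w\<rangle>\<close>, where \<open>w\<close> runs through the words of
  length \<open>m\<close> over \<open>A\<close>. Its vectors are given by their coordinates, its operators by their
  matrices in this basis (row index first). Both vanish outside the index range.
\<close>

type_synonym 'a qvec = "'a list \<Rightarrow> complex"
type_synonym 'a qop = "'a list \<Rightarrow> 'a list \<Rightarrow> complex"

definition qspace :: "'a set \<Rightarrow> nat \<Rightarrow> 'a qvec set" where
  "qspace A m = {\<psi>. \<forall>w. w \<notin> nlists m A \<longrightarrow> \<psi> w = 0}"

definition qops :: "'a set \<Rightarrow> nat \<Rightarrow> 'a qop set" where
  "qops A m = {M. \<forall>v w. v \<notin> nlists m A \<or> w \<notin> nlists m A \<longrightarrow> M v w = 0}"

definition ket :: "'a list \<Rightarrow> 'a qvec" where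
  "ket w = (\<lambda>v. if v = w then 1 else 0)"

text \<open>In the two tensor products, the left factor lives on \<open>m\<close> qudits.\<close>

definition tensor_vec :: "nat \<Rightarrow> 'a qvec \<Rightarrow> 'a qvec \<Rightarrow> 'a qvec" where
  "tensor_vec m \<psi> \<phi> = (\<lambda>w. \<psi> (take m w) * \<phi> (drop m w))"

definition tensor_op :: "nat \<Rightarrow> 'a qop \<Rightarrow> 'a qop \<Rightarrow> 'a qop" where
  "tensor_op m M M' = (\<lambda>v w. M (take m v) (take m w) * M' (drop m v) (drop m w))"

definition op_apply :: "'a set \<Rightarrow> nat \<Rightarrow> 'a qop \<Rightarrow> 'a qvec \<Rightarrow> 'a qvec" where
  "op_apply A m M \<psi> = (\<lambda>w. \<Sum>v\<in>nlists m A. M w v * \<psi> v)"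

definition op_mult :: "'a set \<Rightarrow> nat \<Rightarrow> 'a qop \<Rightarrow> 'a qop \<Rightarrow> 'a qop" where
  "op_mult A m M M' = (\<lambda>v w. \<Sum>u\<in>nlists m A. M v u * M' u w)"

definition op_id :: "'a set \<Rightarrow> nat \<Rightarrow> 'a qop" where
  "op_id A m = (\<lambda>v w. if v \<in> nlists m A \<and> v = w then 1 else 0)"

definition op_adjoint :: "'a qop \<Rightarrow> 'a qop" where
  "op_adjoint M = (\<lambda>v w. cnj (M w v))"

definition unitary_op :: "'a set \<Rightarrow> nat \<Rightarrow> 'a qop \<Rightarrow> bool" where
  "unitary_op A m U \<longleftrightarrow>
     U \<in> qops A m \<and>
     op_mult A m (op_adjoint U) U = op_id A m \<and>
     op_mult A m U (op_adjoint U) = op_id A m"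

definition orth_projector :: "'a set \<Rightarrow> nat \<Rightarrow> 'a qvec set \<Rightarrow> 'a qop \<Rightarrow> bool" where
  "orth_projector A m Q P \<longleftrightarrow>
     P \<in> qops A m \<and>
     op_mult A m P P = P \<and>
     op_adjoint P = P \<and>
     op_apply A m P ` qspace A m = Q"

text \<open>
  \<open>E\<close> acts nontrivially only on the qudits with positions in \<open>S\<close>: up to the order of the tensor
  factors, it is \<open>e \<otimes> I\<close> for an operator \<open>e\<close> on the qudits in \<open>S\<close> and the identity on the others.
\<close>

definition acts_only_on :: "'a set \<Rightarrow> nat \<Rightarrow> nat set \<Rightarrow> 'a qop \<Rightarrow> bool" where
  "acts_only_on A n S E \<longleftrightarrow>
     E \<in> qops A n \<and>
     (\<exists>e. \<forall>v\<in>nlists n A. \<forall>w\<in>nlists n A.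
        E v w = (if \<forall>i<n. i \<notin> S \<longrightarrow> v ! i = w ! i then e (nths v S) (nths w S) else 0))"

definition max_ent :: "'a set \<Rightarrow> 'a qvec" where
  "max_ent A = (\<lambda>w. complex_of_real (1 / sqrt (real (card A))) * (\<Sum>x\<in>A. ket [x, x] w))"

text \<open>
  The tensor power of \<open>c\<close> copies of \<^const>\<open>max_ent\<close>, with the \<open>2 * c\<close> qudits reordered: the \<open>i\<close>-th
  pair occupies the positions \<open>i\<close> and \<open>c + i\<close>, so that the sender's halves come first.
\<close>

definition max_ent_pairs :: "'a set \<Rightarrow> nat \<Rightarrow> 'a qvec" where
  "max_ent_pairs A c =
     (\<lambda>w. if length w = 2 * c then \<Prod>i<c. max_ent A [w ! i, w ! (c + i)] else 0)"

text \<open>The first \<open>n\<close> of the \<open>n + c\<close> qudits are the sender's, the last \<open>c\<close> the receiver's.\<close>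

definition eaqecc_input ::
    "'a :: zero set \<Rightarrow> nat \<Rightarrow> nat \<Rightarrow> nat \<Rightarrow> 'a qvec \<Rightarrow> 'a qvec" where
  "eaqecc_input A n \<kappa> c \<psi> =
     tensor_vec \<kappa> \<psi>
       (tensor_vec (n - \<kappa> - c) (ket (replicate (n - \<kappa> - c) 0)) (max_ent_pairs A c))"

definition is_eaqecc ::
    "'a :: zero set \<Rightarrow> nat \<Rightarrow> nat \<Rightarrow> nat \<Rightarrow> 'a qvec set \<Rightarrow> bool" where
  "is_eaqecc A n \<kappa> c Q \<longleftrightarrow>
     \<kappa> + c \<le> n \<and>
     (\<exists>U. unitary_op A n U \<and>
        Q = {op_apply A (n + c) (tensor_op n U (op_id A c)) (eaqecc_input A n \<kappa> c \<psi>)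
             | \<psi>. \<psi> \<in> qspace A \<kappa>})"

definition min_dist_ge :: "'a set \<Rightarrow> nat \<Rightarrow> nat \<Rightarrow> nat \<Rightarrow> 'a qvec set \<Rightarrow> bool" where
  "min_dist_ge A n c \<delta> Q \<longleftrightarrow>
     (\<exists>P. orth_projector A (n + c) Q P \<and>
        (\<forall>E S. S \<subseteq> {..<n} \<and> card S < \<delta> \<and> acts_only_on A n S E \<longrightarrow>
           (\<exists>\<mu>. op_mult A (n + c) P (op_mult A (n + c) (tensor_op n E (op_id A c)) P)
                = (\<lambda>v w. \<mu> * P v w))))"

text \<open>Parameters \<open>[[n, \<kappa>, \<ge>\<delta>; c]]\<close>, for qudits with basis indexed by \<open>A\<close>.\<close>

definition eaqecc_params ::
    "'a :: zero set \<Rightarrow> nat \<Rightarrow> nat \<Rightarrow> nat \<Rightarrow> nat \<Rightarrow> bool" where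
  "eaqecc_params A n \<kappa> \<delta> c \<longleftrightarrow>
     (\<exists>Q. is_eaqecc A n \<kappa> c Q \<and> min_dist_ge A n c \<delta> Q)"

end

theory Submission
  imports Defs "HOL-Computational_Algebra.Polynomial" "HOL-Library.FuncSet"
begin

text \<open>
  Evaluating at the points of \<open>Y\<^sub>N\<close> the polynomials with exponents in \<open>\<Delta>''\<close> that take values in
  the field of \<open>q\<^sup>2\<close> elements, and adding the sum of their coefficients over the orbit of \<open>a\<^sub>t\<close> as
  a value at infinity, gives a code \<open>C\<close> of length \<open>N + 1\<close> and dimension \<open>\<Sum> n\<^bsub>a\<^sub>i\<^esub>\<close>. Since
  \<open>{0, \<dots>, a\<^sub>t} \<subseteq> \<Delta>''\<close>, interpolation followed by the trace shows that \<open>C\<close> projects onto any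
  \<open>a\<^sub>t + 1\<close> coordinates. By hypothesis only the value at infinity contributes to the Hermitian
  form on \<open>C\<close>, so that a single further coordinate, given to the receiver, makes the code
  self-orthogonal for the symplectic form: this is the case \<open>c = 1\<close>.

  The Weyl operators of the extended code, with suitable phases, form an abelian group; let \<open>P\<close> be
  its average, a projector of rank \<open>q\<^bsup>N + 2\<^esup> / card C\<close>. For an operator \<open>E\<close> supported on positions
  onto which the code projects surjectively, averaging the conjugates of \<open>E\<close> over the group gives a
  scalar, whence \<open>P E P\<close> is a multiple of \<open>P\<close>. For the first \<open>N + 1\<close> positions this is the bound
  on the minimum distance; for the receiver's position it says that the code space is maximally
  entangled with the receiver's qudit, which yields the encoding unitary.
\<close>

section \<open>Splitting symmetric bicharacters; additive characters\<close>

text \<open>The value at infinity imitates the extra point of an extended Reed-Solomon code. Every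
  exponent in the orbit of \<open>a t\<close> is at least \<open>a t\<close>, so on a polynomial of
  degree at most \<open>a t\<close> the sum of the coefficients over the orbit is the coefficient of
  X^(a t) alone. Its trace can therefore be prescribed together with \<open>a t\<close> affine
  values, and lengthening the code by this coordinate does not lower the distance. The bound c \<le>
  1 is met with c = 1 in every case; nothing has to be decided about whether the values at infinity
  happen to be isotropic. The phases are the delicate point. Weyl operators of a self-orthogonal
  code commute, but a product differs from the operator of the sum by \<chi> of the bilinear form b
  g . a h. Where 2 is invertible, \<chi> of half the quadratic form b g . a g corrects this; to
  include characteristic 2, the phases are instead extended one generator at a time, using that the
  complex unit circle has p-th roots.\<close>

definition add_subgroup :: "'g :: ab_group_add set \<Rightarrow> bool" where
  "add_subgroup G \<longleftrightarrow> 0 \<in> G \<and> (\<forall>x\<in>G. \<forall>y\<in>G. x - y \<in> G)"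

lemma add_subgroup_0: "add_subgroup G \<Longrightarrow> 0 \<in> G"
  and add_subgroup_diff: "add_subgroup G \<Longrightarrow> x \<in> G \<Longrightarrow> y \<in> G \<Longrightarrow> x - y \<in> G"
  by (auto simp: add_subgroup_def)

lemma add_subgroup_uminus: "add_subgroup G \<Longrightarrow> x \<in> G \<Longrightarrow> - x \<in> G"
  using add_subgroup_diff[of G 0 x] add_subgroup_0[of G] by simp

lemma add_subgroup_add: "add_subgroup G \<Longrightarrow> x \<in> G \<Longrightarrow> y \<in> G \<Longrightarrow> x + y \<in> G"
  using add_subgroup_diff[of G x "- y"] add_subgroup_uminus[of G y] by simp

lemma add_subgroup_of_nat_mult:
  fixes x :: "'g :: comm_ring_1"
  assumes "add_subgroup G" "x \<in> G"
  shows "of_nat j * x \<in> G"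
  by (induction j) (use assms in \<open>auto simp: add_subgroup_0 algebra_simps intro: add_subgroup_add\<close>)

lemma unit_complex_root:
  fixes d :: complex
  assumes "norm d = 1" "n > 0"
  obtains c where "norm c = 1" "c ^ n = d"
proof
  show "norm (cis (Arg d / n)) = 1" by simp
  show "cis (Arg d / n) ^ n = d"
    using assms cis_Arg[of d] by (simp add: DeMoivre sgn_div_norm split: if_splits) (metis norm_zero zero_neq_one)
qed

text \<open>A function \<open>\<theta>\<close> as below exhibits the bicharacter \<open>\<beta>\<close> as a coboundary on \<open>G\<close>.\<close>

definition splits_on :: "('g \<Rightarrow> 'g \<Rightarrow> complex) \<Rightarrow> 'g :: ab_group_add set \<Rightarrow> ('g \<Rightarrow> complex) \<Rightarrow> bool" where
  "splits_on \<beta> G \<theta> \<longleftrightarrow>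
     (\<forall>x\<in>G. norm (\<theta> x) = 1) \<and> (\<forall>x\<in>G. \<forall>y\<in>G. \<theta> (x + y) = \<theta> x * \<theta> y * \<beta> x y)"

text \<open>The ring structure serves to write the j-th multiple of s as
  \<open>of_nat j * s\<close>. In the application 'g is the type of coefficient functions nat => 'f
  with pointwise operations, where \<open>of_nat p = 0\<close>.\<close>

locale bichar =
  fixes \<beta> :: "'g :: comm_ring_1 \<Rightarrow> 'g \<Rightarrow> complex"
  assumes add_left: "\<beta> (x + y) z = \<beta> x z * \<beta> y z"
    and add_right: "\<beta> x (y + z) = \<beta> x y * \<beta> x z"
    and norm_beta: "norm (\<beta> x y) = 1"
begin

lemma nonzero: "\<beta> x y \<noteq> 0"
  using norm_beta[of x y] by force

lemma zero_left: "\<beta> 0 y = 1"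
  using add_left[of 0 0 y] nonzero[of 0 y] by simp

lemma zero_right: "\<beta> x 0 = 1"
  using add_right[of x 0 0] nonzero[of x 0] by simp

lemma of_nat_left: "\<beta> (of_nat j * x) y = \<beta> x y ^ j"
  by (induction j) (simp_all add: zero_left add_left algebra_simps)

lemma of_nat_right: "\<beta> x (of_nat j * y) = \<beta> x y ^ j"
  by (induction j) (simp_all add: zero_right add_right algebra_simps)

text \<open>As s is not in G and p is prime, an element of G + Zs is g + j s with g in G and j
  unique modulo p. The coboundary condition suggests \<theta> g * \<tau> j * \<beta> g s ^ j, where
  \<tau> must satisfy \<tau> (i + j) = \<tau> i * \<tau> j * \<beta> s s ^ (i * j); the only
  obstruction is that \<tau> be periodic modulo p, and the free choice of \<tau> 1 removes
  it.\<close>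

lemma splits_extend:
  assumes p: "prime p" "of_nat p = (0 :: 'g)"
    and G: "add_subgroup G" and s: "s \<notin> G"
    and sym: "\<And>x. x \<in> G \<Longrightarrow> \<beta> s x = \<beta> x s"
    and \<theta>: "splits_on \<beta> G \<theta>"
  obtains G' \<theta>' where "add_subgroup G'" "G \<subseteq> G'" "s \<in> G'"
    "G' = {g + of_nat j * s | g j. g \<in> G}" "splits_on \<beta> G' \<theta>'" "\<forall>x\<in>G. \<theta>' x = \<theta> x"
proof -
  have p0: "p > 0" using p(1) by (simp add: prime_gt_0_nat)
  have "norm (inverse (\<beta> s s ^ (p choose 2))) = 1"
    by (simp add: norm_inverse norm_power norm_beta)
  then obtain c where c: "norm c = 1" "c ^ p = inverse (\<beta> s s ^ (p choose 2))"
    using unit_complex_root p0 by blast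
  \<comment> \<open>The binomial coefficient turns i * j into a coboundary without a division by 2,
    and c is chosen so that \<tau> p = 1.\<close>
  define \<tau> where "\<tau> j = c ^ j * \<beta> s s ^ (j choose 2)" for j
  have \<tau>_add: "\<tau> (i + j) = \<tau> i * \<tau> j * \<beta> s s ^ (i * j)" for i j
  proof -
    have "(i + j) choose 2 = (i choose 2) + (j choose 2) + i * j"
      by (induction i) (auto simp: numeral_2_eq_2)
    thus ?thesis by (simp add: \<tau>_def power_add)
  qed
  have \<beta>p: "\<beta> x s ^ p = 1" for x
    using of_nat_right[of x p s] p(2) by (simp add: zero_right)
  have \<tau>p: "\<tau> p = 1" using c nonzero by (simp add: \<tau>_def)
  have \<tau>_mult: "\<tau> (p * k) = 1" for k
  proof (induction k)
    case 0 show ?case by (simp add: \<tau>_def numeral_2_eq_2)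
  next
    case (Suc k)
    have "\<tau> (p + p * k) = 1"
      unfolding \<tau>_add using Suc \<tau>p by (simp add: power_mult \<beta>p)
    thus ?case by simp
  qed
  have \<tau>_mod: "\<tau> (j mod p) = \<tau> j" for j
  proof -
    have "\<tau> (p * (j div p) + j mod p) = \<tau> (j mod p)"
      unfolding \<tau>_add using \<tau>_mult by (simp add: power_mult \<beta>p)
    thus ?thesis by simp
  qed
  have of_nat_mod: "of_nat (j mod p) = (of_nat j :: 'g)" for j
  proof -
    have "(of_nat j :: 'g) = of_nat (p * (j div p) + j mod p)" by simp
    also have "\<dots> = of_nat (j mod p)" unfolding of_nat_add of_nat_mult using p(2) by simp
    finally show ?thesis ..
  qed
  \<comment> \<open>k is invertible modulo p, so s would be a multiple of k s and lie in G.\<close>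
  have multiple: False if k: "0 < k" "k < p" "of_nat k * s \<in> G" for k
  proof -
    have "coprime k p" using k p(1)
      by (metis coprime_commute nat_dvd_not_less prime_imp_coprime_nat)
    then obtain u v where uv: "u * k = v * p + 1"
      by (metis bezout_nat coprime_iff_gcd_eq_1 k(1) less_irrefl mult.commute)
    have "of_nat u * (of_nat k * s) = of_nat (u * k) * s" by (simp add: algebra_simps)
    also have "\<dots> = s" unfolding uv using p(2) by simp
    finally show False using s add_subgroup_of_nat_mult[OF G k(3), of u] by simp
  qed
  have unique': "i \<le> j \<Longrightarrow> i = j"
    if "i < p" "j < p" "x - of_nat i * s \<in> G" "x - of_nat j * s \<in> G" for i j x
  proof (rule ccontr)
    assume ij: "i \<le> j" "i \<noteq> j"
    have "of_nat (j - i) * s = (x - of_nat i * s) - (x - of_nat j * s)"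
      using ij by (simp add: of_nat_diff algebra_simps)
    also have "\<dots> \<in> G" using add_subgroup_diff[OF G] that by blast
    finally show False using multiple[of "j - i"] ij that by linarith
  qed
  have unique: "i = j"
    if "i < p" "j < p" "x - of_nat i * s \<in> G" "x - of_nat j * s \<in> G" for i j x
    using unique'[OF that] unique'[of j i x] that nat_le_linear by metis
  define ix where "ix x = (THE j. j < p \<and> x - of_nat j * s \<in> G)" for x
  have ix: "ix (g + of_nat j * s) = j mod p" if "g \<in> G" for g j
    unfolding ix_def
  proof (rule the_equality)
    show "j mod p < p \<and> g + of_nat j * s - of_nat (j mod p) * s \<in> G"
      using p0 that by (simp add: of_nat_mod)
    thus "i = j mod p" if "i < p \<and> g + of_nat j * s - of_nat i * s \<in> G" for i
      using unique that by blast
  qed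
  define \<theta>' where
    "\<theta>' x = (let j = ix x; g = x - of_nat j * s in \<theta> g * \<tau> j * \<beta> g (of_nat j * s))" for x
  have \<theta>': "\<theta>' (g + of_nat j * s) = \<theta> g * \<tau> j * \<beta> g s ^ j" if "g \<in> G" for g j
  proof -
    have "\<theta>' (g + of_nat j * s) = \<theta> g * \<tau> j * \<beta> g (of_nat j * s)"
      using that by (simp add: \<theta>'_def ix Let_def of_nat_mod \<tau>_mod)
    thus ?thesis by (simp add: of_nat_right)
  qed
  define G' where "G' = {g + of_nat j * s | g j. g \<in> G}"
  have "add_subgroup G'"
    unfolding add_subgroup_def
  proof (intro conjI ballI)
    show "0 \<in> G'" unfolding G'_def using add_subgroup_0[OF G]
      by (auto intro!: exI[of _ "0 :: 'g"] exI[of _ "0 :: nat"])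
    fix x y assume "x \<in> G'" "y \<in> G'"
    then obtain g i h j where xy: "x = g + of_nat i * s" "y = h + of_nat j * s" "g \<in> G" "h \<in> G"
      by (auto simp: G'_def)
    \<comment> \<open>Only natural multiples of s are available, so -j is represented by j p -
      j.\<close>
    have "of_nat (j * p) = (0 :: 'g)" using p(2) by simp
    moreover have "j \<le> j * p" using p0 by simp
    ultimately have "of_nat (j * p - j) = - (of_nat j :: 'g)"
      by (simp only: of_nat_diff) simp
    hence "x - y = (g - h) + of_nat (i + (j * p - j)) * s"
      unfolding xy of_nat_add by (simp add: algebra_simps)
    thus "x - y \<in> G'" using add_subgroup_diff[OF G] xy unfolding G'_def by blast
  qed
  moreover have "x \<in> G'" if "x \<in> G" for x
    using that by (auto simp: G'_def intro!: exI[of _ x] exI[of _ "0 :: nat"])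
  hence "G \<subseteq> G'" ..
  moreover have "s \<in> G'" unfolding G'_def
    using add_subgroup_0[OF G] by (auto intro!: exI[of _ "0 :: 'g"] exI[of _ "1 :: nat"])
  moreover have "splits_on \<beta> G' \<theta>'"
    unfolding splits_on_def
  proof (intro conjI ballI)
    fix x assume "x \<in> G'"
    then obtain g i where x: "x = g + of_nat i * s" "g \<in> G" by (auto simp: G'_def)
    thus "norm (\<theta>' x) = 1" using \<theta> c
      by (simp add: \<theta>' norm_mult norm_power norm_beta \<tau>_def splits_on_def)
  next
    fix x y assume "x \<in> G'" "y \<in> G'"
    then obtain g i h j where xy: "x = g + of_nat i * s" "y = h + of_nat j * s"
      and gh: "g \<in> G" "h \<in> G"
      by (auto simp: G'_def)
    have "x + y = (g + h) + of_nat (i + j) * s" by (simp add: xy algebra_simps)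
    hence "\<theta>' (x + y) = \<theta> (g + h) * \<tau> (i + j) * \<beta> (g + h) s ^ (i + j)"
      using \<theta>' add_subgroup_add[OF G gh] by metis
    also have "\<theta> (g + h) = \<theta> g * \<theta> h * \<beta> g h" using \<theta> gh by (simp add: splits_on_def)
    also have "\<theta> g * \<theta> h * \<beta> g h * \<tau> (i + j) * \<beta> (g + h) s ^ (i + j)
        = (\<theta> g * \<tau> i * \<beta> g s ^ i) * (\<theta> h * \<tau> j * \<beta> h s ^ j)
          * (\<beta> g h * \<beta> g s ^ j * \<beta> h s ^ i * \<beta> s s ^ (i * j))"
      by (simp add: \<tau>_add add_left power_add power_mult_distrib mult_ac)
    also have "\<beta> g h * \<beta> g s ^ j * \<beta> h s ^ i * \<beta> s s ^ (i * j) = \<beta> x y"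
      unfolding xy add_left add_right of_nat_left of_nat_right
      using sym[OF gh(2)] by (simp add: mult_ac power_mult_distrib flip: power_mult)
    finally show "\<theta>' (x + y) = \<theta>' x * \<theta>' y * \<beta> x y"
      using \<theta>' gh xy by simp
  qed
  moreover have "\<theta>' x = \<theta> x" if "x \<in> G" for x
    using \<theta>'[OF that, of 0] by (simp add: \<tau>_def numeral_2_eq_2)
  ultimately show ?thesis using that[of G' \<theta>'] G'_def by simp
qed

text \<open>Agreement with \<theta> on G matters for the existence of a nontrivial character; for
  plain existence of a splitting one starts from G = {0}.\<close>

lemma splits_extend_subgroup:
  assumes p: "prime p" "of_nat p = (0 :: 'g)"
    and S: "add_subgroup S" "finite S"
    and sym: "\<And>x y. x \<in> S \<Longrightarrow> y \<in> S \<Longrightarrow> \<beta> x y = \<beta> y x"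
  shows "add_subgroup G \<Longrightarrow> G \<subseteq> S \<Longrightarrow> splits_on \<beta> G \<theta> \<Longrightarrow>
     \<exists>\<theta>'. splits_on \<beta> S \<theta>' \<and> (\<forall>x\<in>G. \<theta>' x = \<theta> x)"
proof (induction "card (S - G)" arbitrary: G \<theta> rule: less_induct)
  case less
  show ?case
  proof (cases "G = S")
    case True
    thus ?thesis using less.prems by blast
  next
    case False
    then obtain s where s: "s \<in> S" "s \<notin> G" using less.prems by blast
    obtain G' \<theta>' where G': "add_subgroup G'" "G \<subseteq> G'" "s \<in> G'"
        "G' = {g + of_nat j * s | g j. g \<in> G}"
        and \<theta>': "splits_on \<beta> G' \<theta>'" "\<forall>x\<in>G. \<theta>' x = \<theta> x"
      by (rule splits_extend[OF p less.prems(1) s(2) _ less.prems(3)])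
        (use sym s(1) less.prems(2) in blast)
    have "G' \<subseteq> S"
      unfolding G'(4) using less.prems(2) add_subgroup_add[OF S(1)]
        add_subgroup_of_nat_mult[OF S(1) s(1)] by blast
    moreover have "card (S - G') < card (S - G)"
      by (rule psubset_card_mono) (use S(2) G' s in auto)
    ultimately obtain \<theta>'' where "splits_on \<beta> S \<theta>''" "\<forall>x\<in>G'. \<theta>'' x = \<theta>' x"
      using less.hyps[of G' \<theta>'] G'(1) \<theta>'(1) by blast
    thus ?thesis using \<theta>'(2) G'(2) by (intro exI[of _ \<theta>'']) auto
  qed
qed

end

lemma splitting_exists:
  fixes \<beta> :: "'g :: comm_ring_1 \<Rightarrow> 'g \<Rightarrow> complex"
  assumes "bichar \<beta>" "prime p" "of_nat p = (0 :: 'g)"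
    and "add_subgroup S" "finite S"
    and "\<And>x y. x \<in> S \<Longrightarrow> y \<in> S \<Longrightarrow> \<beta> x y = \<beta> y x"
  shows "\<exists>\<theta>. splits_on \<beta> S \<theta>"
proof -
  interpret bichar \<beta> by fact
  have "splits_on \<beta> {0} (\<lambda>_. 1)" by (simp add: splits_on_def zero_left)
  moreover have "add_subgroup {0 :: 'g}" by (simp add: add_subgroup_def)
  ultimately show ?thesis
    using splits_extend_subgroup[OF assms(2-6), of "{0}"] add_subgroup_0[OF assms(4)] by blast
qed

text \<open>A splitting of the trivial bicharacter is a character with values in the unit circle.
  The obvious character of the prime field, 1 \<mapsto> exp(2 pi i / p), is extended to the whole
  field in this way. That \<chi> 1 \<noteq> 1 suffices for nondegeneracy on any subfield, since y *
  x can be made 1.\<close>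

lemma additive_character_exists:
  obtains \<chi> :: "'f :: finite_field \<Rightarrow> complex"
  where "\<And>x y. \<chi> (x + y) = \<chi> x * \<chi> y" "\<And>x. norm (\<chi> x) = 1" "\<chi> 1 \<noteq> 1"
proof -
  let ?p = "CHAR('f)"
  interpret bichar "\<lambda>_ _ :: 'f. 1" by standard auto
  define G where "G = range (of_nat :: nat \<Rightarrow> 'f)"
  define \<omega> where "\<omega> = cis (2 * pi / ?p)"
  define \<theta> where "\<theta> x = \<omega> ^ (SOME j. x = (of_nat j :: 'f))" for x
  have p: "prime ?p" by simp
  hence p1: "?p > 1" using prime_gt_1_nat by blast
  have norm_\<omega>: "norm \<omega> = 1" by (simp add: \<omega>_def)
  have \<omega>p: "\<omega> ^ ?p = 1" using p1 by (simp add: \<omega>_def DeMoivre)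
  have \<omega>_cong: "\<omega> ^ i = \<omega> ^ j" if "(of_nat i :: 'f) = of_nat j" for i j
  proof -
    have *: "\<omega> ^ i = \<omega> ^ j" if "i \<le> j" "(of_nat i :: 'f) = of_nat j" for i j
    proof -
      have "of_nat (j - i) = (0 :: 'f)" using that by (simp add: of_nat_diff)
      then obtain k where "j - i = ?p * k" by (auto simp: of_nat_eq_0_iff_char_dvd elim: dvdE)
      hence "j = i + ?p * k" using that by simp
      thus ?thesis by (simp add: power_add power_mult \<omega>p)
    qed
    show ?thesis using * nat_le_linear that by metis
  qed
  have \<theta>: "\<theta> (of_nat j) = \<omega> ^ j" for j
    unfolding \<theta>_def by (rule \<omega>_cong) (rule someI2[of _ j], auto)
  have "add_subgroup G"
    unfolding add_subgroup_def
  proof (intro conjI ballI)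
    show "0 \<in> G" unfolding G_def by (rule image_eqI[of _ _ 0]) auto
    fix x y assume "x \<in> G" "y \<in> G"
    then obtain i j where ij: "x = of_nat i" "y = of_nat j" by (auto simp: G_def)
    have "of_nat (j * ?p) = (0 :: 'f)" by simp
    moreover have "j \<le> j * ?p" using p1 by simp
    ultimately have "x - y = of_nat (i + (j * ?p - j))"
      using ij by (simp only: of_nat_add of_nat_diff) simp
    thus "x - y \<in> G" unfolding G_def by (rule range_eqI)
  qed
  moreover have "splits_on (\<lambda>_ _. 1) G \<theta>"
    unfolding splits_on_def
  proof (intro conjI ballI)
    fix x assume "x \<in> G"
    thus "norm (\<theta> x) = 1" using norm_\<omega> by (auto simp: G_def \<theta> norm_power)
  next
    fix x y assume "x \<in> G" "y \<in> G"
    then obtain i j where ij: "x = of_nat i" "y = of_nat j" by (auto simp: G_def)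
    show "\<theta> (x + y) = \<theta> x * \<theta> y * 1"
      unfolding ij of_nat_add[symmetric] \<theta> by (simp add: power_add)
  qed
  ultimately obtain \<chi> where \<chi>: "splits_on (\<lambda>_ _. 1) UNIV \<chi>" "\<forall>x\<in>G. \<chi> x = \<theta> x"
    using splits_extend_subgroup[OF p, of UNIV G \<theta>] by (auto simp: add_subgroup_def)
  have "1 \<in> G" unfolding G_def by (rule range_eqI[of _ _ 1]) simp
  hence "\<chi> 1 = \<omega>" using \<chi>(2) \<theta>[of 1] by simp
  moreover have "\<omega> \<noteq> 1"
  proof
    assume "\<omega> = 1"
    hence "cos (2 * pi / ?p) = 1" by (simp add: \<omega>_def complex_eq_iff)
    then obtain n :: int where n: "2 * pi / ?p = n * 2 * pi" using cos_one_2pi_int by auto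
    hence "1 = n * real ?p" using p1 by (simp add: field_simps)
    hence "1 = n * int ?p" by (metis of_int_1 of_int_eq_iff of_int_mult of_int_of_nat_eq)
    thus False using p1 by (metis int_dvd_int_iff dvd_triv_right nat_dvd_1_iff_1 of_nat_1 less_irrefl)
  qed
  ultimately show ?thesis
    using that[of \<chi>] \<chi>(1) by (simp add: splits_on_def)
qed

section \<open>Stabilizer projectors\<close>

text \<open>As simplification rules, these two loop together with \<open>nlists_iff_nth\<close> below.\<close>

declare nlistsE_length [simp del] nlistsE_set [simp del]

section \<open>Words and the algebra of matrices indexed by them\<close>

lemma nlists_alt: "nlists m A = {xs. set xs \<subseteq> A \<and> length xs = m}"
  unfolding nlists_def by (rule Collect_cong) (rule conj_commute)

lemma finite_nlists: "finite A \<Longrightarrow> finite (nlists m A)"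
  unfolding nlists_alt by (rule finite_lists_length_eq)

lemma card_nlists: "finite A \<Longrightarrow> card (nlists m A) = card A ^ m"
  unfolding nlists_alt by (rule card_lists_length_eq)

lemma op_mult_assoc:
  "op_mult A m (op_mult A m L M) N = op_mult A m L (op_mult A m M N)"
proof (intro ext)
  fix v w
  have "op_mult A m (op_mult A m L M) N v w
      = (\<Sum>u\<in>nlists m A. \<Sum>t\<in>nlists m A. L v t * M t u * N u w)"
    by (simp add: op_mult_def sum_distrib_right)
  also have "\<dots> = (\<Sum>t\<in>nlists m A. \<Sum>u\<in>nlists m A. L v t * M t u * N u w)"
    by (rule sum.swap)
  also have "\<dots> = op_mult A m L (op_mult A m M N) v w"
    by (simp add: op_mult_def sum_distrib_left mult.assoc)
  finally show "op_mult A m (op_mult A m L M) N v w = op_mult A m L (op_mult A m M N) v w" .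
qed

lemma op_mult_sum_left:
  "op_mult A m (\<lambda>v w. \<Sum>g\<in>G. F g v w) M = (\<lambda>v w. \<Sum>g\<in>G. op_mult A m (F g) M v w)"
  by (intro ext) (simp add: op_mult_def sum_distrib_right sum.swap[of _ _ G])

lemma op_mult_sum_right:
  "op_mult A m M (\<lambda>v w. \<Sum>g\<in>G. F g v w) = (\<lambda>v w. \<Sum>g\<in>G. op_mult A m M (F g) v w)"
  by (intro ext) (simp add: op_mult_def sum_distrib_left sum.swap[of _ _ G])

lemma op_mult_scale_left:
  "op_mult A m (\<lambda>v w. c * L v w) M = (\<lambda>v w. c * op_mult A m L M v w)"
  by (intro ext) (simp add: op_mult_def sum_distrib_left mult.assoc)

lemma op_mult_scale_right:
  "op_mult A m M (\<lambda>v w. c * L v w) = (\<lambda>v w. c * op_mult A m M L v w)"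
  by (intro ext) (simp add: op_mult_def sum_distrib_left mult_ac)

lemma op_mult_id_left:
  assumes "finite A" "M \<in> qops A m"
  shows "op_mult A m (op_id A m) M = M"
proof (intro ext)
  fix v w
  have "op_mult A m (op_id A m) M v w
      = (\<Sum>u\<in>nlists m A. if v = u then (if v \<in> nlists m A then M v w else 0) else 0)"
    unfolding op_mult_def op_id_def by (intro sum.cong) auto
  also have "\<dots> = M v w"
    using assms by (subst sum.delta') (auto simp: finite_nlists qops_def)
  finally show "op_mult A m (op_id A m) M v w = M v w" .
qed

section \<open>Translations of words, the shift part of Weyl operators\<close>

definition wadd :: "(nat \<Rightarrow> 'a :: ab_group_add) \<Rightarrow> 'a list \<Rightarrow> 'a list" where
  "wadd c w = map (\<lambda>i. w ! i + c i) [0..<length w]"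

lemma length_wadd [simp]: "length (wadd c w) = length w"
  by (simp add: wadd_def)

lemma nth_wadd [simp]: "i < length w \<Longrightarrow> wadd c w ! i = w ! i + c i"
  by (simp add: wadd_def)

lemma wadd_wadd: "wadd c (wadd d w) = wadd (\<lambda>i. c i + d i) w"
  by (rule nth_equalityI) (auto simp: algebra_simps)

lemma wadd_cong: "(\<And>i. i < length w \<Longrightarrow> c i = d i) \<Longrightarrow> wadd c w = wadd d w"
  by (rule nth_equalityI) auto

lemma wadd_zero: "(\<And>i. i < length w \<Longrightarrow> c i = 0) \<Longrightarrow> wadd c w = w"
  by (rule nth_equalityI) auto

lemma wadd_eq_iff: "v = wadd c w \<longleftrightarrow> w = wadd (\<lambda>i. - c i) v"
  by (auto simp: wadd_wadd wadd_zero)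

lemma nlists_iff_nth: "w \<in> nlists m A \<longleftrightarrow> length w = m \<and> (\<forall>i<m. w ! i \<in> A)"
proof -
  have "set w \<subseteq> A \<longleftrightarrow> (\<forall>i<length w. w ! i \<in> A)"
    unfolding subset_iff in_set_conv_nth by blast
  thus ?thesis unfolding nlists_def mem_Collect_eq by blast
qed

lemma wadd_in_nlists:
  assumes "add_subgroup A" "w \<in> nlists m A" "\<And>i. i < m \<Longrightarrow> c i \<in> A"
  shows "wadd c w \<in> nlists m A"
  unfolding nlists_iff_nth
proof (intro conjI allI impI)
  show "length (wadd c w) = m" using assms(2) by (simp add: nlists_iff_nth)
  fix i assume "i < m"
  thus "wadd c w ! i \<in> A"
    using assms add_subgroup_add[OF assms(1), of "w ! i" "c i"] by (simp add: nlists_iff_nth)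
qed

lemma bij_betw_wadd:
  assumes "add_subgroup A" "\<And>i. i < m \<Longrightarrow> c i \<in> A"
  shows "bij_betw (wadd c) (nlists m A) (nlists m A)"
  by (rule bij_betw_byWitness[where f' = "wadd (\<lambda>i. - c i)"])
    (use assms wadd_in_nlists[OF assms(1)] add_subgroup_uminus[OF assms(1)]
      in \<open>simp_all add: wadd_wadd wadd_zero image_subset_iff\<close>)

lemma bij_betw_translate:
  assumes "add_subgroup G" "g \<in> G"
  shows "bij_betw (\<lambda>h. h + g) G G"
  by (rule bij_betw_byWitness[where f' = "\<lambda>h. h - g"])
    (use assms(2) add_subgroup_add[OF assms(1)] add_subgroup_diff[OF assms(1)]
      in \<open>simp_all add: image_subset_iff\<close>)

text \<open>The additive code is the image of g \<mapsto> (a g, b g), shift part and phase part. Its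
  self-orthogonality enters through \<open>splits\<close>: \<theta> (g + h) = \<theta> (h + g)
  forces the cocycle to be symmetric on G. \<open>ab_inj\<close> makes card G the size of the code,
  and \<open>\<chi>_nondeg\<close> makes nontrivial character sums over A vanish.\<close>

locale stabilizer =
  fixes A :: "'f :: comm_ring_1 set" and \<chi> :: "'f \<Rightarrow> complex" and m :: nat
    and G :: "'g :: ab_group_add set" and a b :: "'g \<Rightarrow> nat \<Rightarrow> 'f" and \<theta> :: "'g \<Rightarrow> complex"
  assumes A: "add_subgroup A" "finite A"
    and \<chi>_add: "\<chi> (x + y) = \<chi> x * \<chi> y" and \<chi>_norm: "norm (\<chi> x) = 1"
    and \<chi>_nondeg: "x \<in> A \<Longrightarrow> x \<noteq> 0 \<Longrightarrow> \<exists>y\<in>A. \<chi> (y * x) \<noteq> 1"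
    and G: "add_subgroup G" "finite G"
    and a_in: "g \<in> G \<Longrightarrow> i < m \<Longrightarrow> a g i \<in> A" and b_in: "g \<in> G \<Longrightarrow> i < m \<Longrightarrow> b g i \<in> A"
    and a_add: "a (g + h) i = a g i + a h i" and b_add: "b (g + h) i = b g i + b h i"
    and splits: "splits_on (\<lambda>g h. \<chi> (\<Sum>i<m. b g i * a h i)) G \<theta>"
    and ab_inj: "g \<in> G \<Longrightarrow> (\<And>i. i < m \<Longrightarrow> a g i = 0) \<Longrightarrow> (\<And>i. i < m \<Longrightarrow> b g i = 0) \<Longrightarrow> g = 0"
begin

abbreviation "X \<equiv> nlists m A"
abbreviation "mul \<equiv> op_mult A m"

lemma \<chi>_0: "\<chi> 0 = 1"
  using \<chi>_add[of 0 0] \<chi>_norm[of 0] by auto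

lemma \<chi>_nonzero: "\<chi> x \<noteq> 0"
  using \<chi>_norm[of x] by auto

lemma \<chi>_uminus: "\<chi> (- x) = cnj (\<chi> x)"
proof -
  have "\<chi> x * \<chi> (- x) = 1" using \<chi>_add[of x "- x"] by (simp add: \<chi>_0)
  moreover have "\<chi> x * cnj (\<chi> x) = 1" by (simp add: \<chi>_norm flip: complex_norm_square)
  ultimately show ?thesis using \<chi>_nonzero[of x] by (metis mult_left_cancel)
qed

lemma \<chi>_diff: "\<chi> (x - y) = \<chi> x * cnj (\<chi> y)"
  using \<chi>_add[of x "- y"] by (simp add: \<chi>_uminus)

lemma a_0: "a 0 i = 0" and b_0: "b 0 i = 0"
  using a_add[of 0 0 i] b_add[of 0 0 i] by auto

lemma a_uminus: "a (- g) i = - a g i" and b_uminus: "b (- g) i = - b g i"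
  using a_add[of g "- g" i] b_add[of g "- g" i] by (auto simp: a_0 b_0 eq_neg_iff_add_eq_0 add.commute)

lemma finite_X: "finite X"
  by (rule finite_nlists) (rule A)

lemma \<theta>_add: "g \<in> G \<Longrightarrow> h \<in> G \<Longrightarrow> \<theta> (g + h) = \<theta> g * \<theta> h * \<chi> (\<Sum>i<m. b g i * a h i)"
  using splits by (simp add: splits_on_def)

lemma \<theta>_norm: "g \<in> G \<Longrightarrow> norm (\<theta> g) = 1"
  using splits by (simp add: splits_on_def)

lemma \<theta>_0: "\<theta> 0 = 1"
  using \<theta>_add[of 0 0] \<theta>_norm[of 0] add_subgroup_0[OF G(1)] by (auto simp: a_0 \<chi>_0)

lemma \<theta>_uminus:
  assumes "g \<in> G"
  shows "\<theta> g * \<theta> (- g) * \<chi> (- (\<Sum>i<m. b g i * a g i)) = 1"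
  using \<theta>_add[of g "- g"] assms add_subgroup_uminus[OF G(1)]
  by (simp add: \<theta>_0 a_uminus sum_negf)

definition ph :: "'g \<Rightarrow> 'f list \<Rightarrow> complex" where
  "ph g w = \<chi> (\<Sum>i<m. b g i * w ! i)"

lemma ph_wadd: "w \<in> X \<Longrightarrow> ph g (wadd c w) = ph g w * \<chi> (\<Sum>i<m. b g i * c i)"
  by (simp add: ph_def algebra_simps sum.distrib \<chi>_add nlists_iff_nth)

lemma ph_add: "ph (g + h) w = ph g w * ph h w"
  by (simp add: ph_def b_add algebra_simps sum.distrib \<chi>_add)

lemma ph_uminus: "ph (- g) w = cnj (ph g w)"
  by (simp add: ph_def b_uminus sum_negf \<chi>_uminus)

text \<open>The Weyl operator of \<open>(a g, b g)\<close>, with the phases that make \<open>g \<mapsto> weyl g\<close> a homomorphism.\<close>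

definition weyl :: "'g \<Rightarrow> 'f qop" where
  "weyl g = (\<lambda>v w. if w \<in> X \<and> v = wadd (a g) w then \<theta> g * ph g w else 0)"

lemma wadd_a_in: "g \<in> G \<Longrightarrow> w \<in> X \<Longrightarrow> wadd (a g) w \<in> X"
  by (rule wadd_in_nlists[OF A(1)]) (auto intro!: a_in)

lemma wadd_minus_a_in: "g \<in> G \<Longrightarrow> w \<in> X \<Longrightarrow> wadd (\<lambda>i. - a g i) w \<in> X"
  by (rule wadd_in_nlists[OF A(1)]) (auto intro!: add_subgroup_uminus[OF A(1)] a_in)

lemma weyl_qops: "g \<in> G \<Longrightarrow> weyl g \<in> qops A m"
  by (auto simp: qops_def weyl_def wadd_a_in)

lemma mul_weyl_right:
  assumes "h \<in> G" "w \<in> X"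
  shows "mul M (weyl h) v w = M v (wadd (a h) w) * (\<theta> h * ph h w)"
proof -
  have "mul M (weyl h) v w
      = (\<Sum>u\<in>X. if u = wadd (a h) w then M v (wadd (a h) w) * (\<theta> h * ph h w) else 0)"
    unfolding op_mult_def weyl_def using assms by (intro sum.cong) auto
  thus ?thesis using assms by (simp add: finite_X wadd_a_in)
qed

lemma mul_weyl_left:
  assumes "g \<in> G" "v \<in> X"
  shows "mul (weyl g) M v w
    = \<theta> g * ph g (wadd (\<lambda>i. - a g i) v) * M (wadd (\<lambda>i. - a g i) v) w"
proof -
  have "mul (weyl g) M v w = (\<Sum>u\<in>X. if u = wadd (\<lambda>i. - a g i) v
      then \<theta> g * ph g (wadd (\<lambda>i. - a g i) v) * M (wadd (\<lambda>i. - a g i) v) w else 0)"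
    unfolding op_mult_def weyl_def using assms
    by (intro sum.cong) (auto simp: wadd_eq_iff[of v])
  thus ?thesis using assms by (simp add: finite_X wadd_minus_a_in)
qed

text \<open>Evaluating the phase of g after the shift by a h costs the factor \<chi> (b g . a h),
  which is exactly the one supplied by \<open>\<theta>_add\<close>.\<close>

lemma weyl_mult:
  assumes "g \<in> G" "h \<in> G"
  shows "mul (weyl g) (weyl h) = weyl (g + h)"
proof (intro ext)
  fix v w
  show "mul (weyl g) (weyl h) v w = weyl (g + h) v w"
  proof (cases "w \<in> X")
    case False
    thus ?thesis by (simp add: op_mult_def weyl_def)
  next
    case True
    have "wadd (a g) (wadd (a h) w) = wadd (a (g + h)) w"
      by (auto simp: wadd_wadd a_add intro: wadd_cong)
    thus ?thesis
      using True assms unfolding mul_weyl_right[OF assms(2) True]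
      by (simp add: weyl_def wadd_a_in ph_wadd ph_add \<theta>_add mult_ac)
  qed
qed

lemma weyl_0: "weyl 0 = op_id A m"
  by (intro ext) (auto simp: weyl_def op_id_def \<theta>_0 ph_def b_0 \<chi>_0 a_0 wadd_zero)

lemma weyl_adjoint:
  assumes "g \<in> G"
  shows "op_adjoint (weyl g) = weyl (- g)"
proof (intro ext)
  fix v w
  show "op_adjoint (weyl g) v w = weyl (- g) v w"
  proof (cases "w \<in> X \<and> v = wadd (\<lambda>i. - a g i) w")
    case True
    hence v: "v \<in> X" "w = wadd (a g) v"
      using wadd_minus_a_in[OF assms, of w] wadd_eq_iff[of w "a g" v] by simp_all
    have "\<theta> (- g) * \<chi> (- (\<Sum>i<m. b g i * a g i)) = cnj (\<theta> g)"
    proof -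
      have "\<theta> g * (\<theta> (- g) * \<chi> (- (\<Sum>i<m. b g i * a g i))) = \<theta> g * cnj (\<theta> g)"
        using \<theta>_uminus[OF assms] \<theta>_norm[OF assms]
        by (simp add: mult.assoc flip: complex_norm_square)
      moreover have "\<theta> g \<noteq> 0" using \<theta>_norm[OF assms] by auto
      ultimately show ?thesis by (metis mult_left_cancel)
    qed
    moreover have "ph (- g) w = cnj (ph g v) * \<chi> (- (\<Sum>i<m. b g i * a g i))"
      using v(1) unfolding v(2) ph_wadd[OF v(1)] by (simp add: ph_uminus b_uminus sum_negf)
    ultimately have "\<theta> (- g) * ph (- g) w = cnj (\<theta> g * ph g v)"
      by (simp add: mult_ac)
    moreover have "wadd (a (- g)) w = v"
      unfolding conjunct2[OF True] by (intro wadd_cong) (simp add: a_uminus)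
    hence "weyl (- g) v w = \<theta> (- g) * ph (- g) w"
      using True unfolding weyl_def by simp
    moreover have "op_adjoint (weyl g) v w = cnj (\<theta> g * ph g v)"
      unfolding op_adjoint_def weyl_def using v(1) v(2)[symmetric] by simp
    ultimately show ?thesis by simp
  next
    case False
    have "\<not> (v \<in> X \<and> w = wadd (a g) v)"
      using False wadd_a_in[OF assms, of v] wadd_eq_iff[of w "a g" v] by metis
    hence "weyl g w v = 0" unfolding weyl_def by (rule if_not_P)
    moreover have "a (- g) = (\<lambda>i. - a g i)" by (rule ext) (rule a_uminus)
    hence "\<not> (w \<in> X \<and> v = wadd (a (- g)) w)" using False by simp
    hence "weyl (- g) v w = 0" unfolding weyl_def by (rule if_not_P)
    ultimately show ?thesis by (simp add: op_adjoint_def)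
  qed
qed

definition proj :: "'f qop" where
  "proj = (\<lambda>v w. (1 / of_nat (card G)) * (\<Sum>g\<in>G. weyl g v w))"

lemma card_G: "card G > 0"
  using G add_subgroup_0[OF G(1)] by (auto simp: card_gt_0_iff)

lemma proj_qops: "proj \<in> qops A m"
  using weyl_qops by (auto simp: proj_def qops_def)

lemma sum_translate: "g \<in> G \<Longrightarrow> (\<Sum>h\<in>G. f (h + g)) = (\<Sum>h\<in>G. f h)"
  using sum.reindex_bij_betw[OF bij_betw_translate[OF G(1)]] by blast

lemma weyl_proj: "g \<in> G \<Longrightarrow> mul (weyl g) proj = proj"
  unfolding proj_def op_mult_scale_right op_mult_sum_right
  by (simp add: weyl_mult add.commute[of g] sum_translate[of g "\<lambda>h. weyl h _ _"])

lemma proj_weyl: "g \<in> G \<Longrightarrow> mul proj (weyl g) = proj"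
  unfolding proj_def op_mult_scale_left op_mult_sum_left
  by (simp add: weyl_mult sum_translate[of g "\<lambda>h. weyl h _ _"])

lemma proj_idem: "mul proj proj = proj"
proof -
  have "mul proj proj = mul (\<lambda>v w. (1 / of_nat (card G)) * (\<Sum>g\<in>G. weyl g v w)) proj"
    by (rule arg_cong[OF proj_def, of "\<lambda>p. mul p proj"])
  also have "\<dots> = (\<lambda>v w. (1 / of_nat (card G)) * (\<Sum>g\<in>G. mul (weyl g) proj v w))"
    by (simp only: op_mult_scale_left op_mult_sum_left)
  also have "\<dots> = proj" using card_G by (simp add: weyl_proj)
  finally show ?thesis .
qed

lemma proj_adjoint: "op_adjoint proj = proj"
proof (intro ext)
  fix v w
  have "(\<Sum>g\<in>G. cnj (weyl g w v)) = (\<Sum>g\<in>G. weyl (- g) v w)"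
    using weyl_adjoint by (intro sum.cong) (auto simp: op_adjoint_def fun_eq_iff)
  also have "\<dots> = (\<Sum>g\<in>G. weyl g v w)"
    by (rule sum.reindex_bij_witness[of _ uminus uminus]) (use add_subgroup_uminus[OF G(1)] in auto)
  finally show "op_adjoint proj v w = proj v w"
    by (simp add: op_adjoint_def proj_def)
qed

text \<open>If some shift a g i is nonzero, no diagonal entry survives. Otherwise the operator is a
  diagonal phase with some b g i \<noteq> 0, and translating the words at position i multiplies the
  trace by a number other than 1.\<close>

lemma trace_weyl:
  assumes "g \<in> G" "g \<noteq> 0"
  shows "(\<Sum>w\<in>X. weyl g w w) = 0"
proof (cases "\<exists>i<m. a g i \<noteq> 0")
  case True
  then obtain i where i: "i < m" "a g i \<noteq> 0" by blast
  have "w \<noteq> wadd (a g) w" if "w \<in> X" for w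
  proof
    assume "w = wadd (a g) w"
    hence "w ! i = wadd (a g) w ! i" by simp
    thus False using that i by (simp add: nlists_iff_nth)
  qed
  thus ?thesis by (intro sum.neutral) (auto simp: weyl_def)
next
  case False
  hence a: "a g i = 0" if "i < m" for i using that by blast
  then obtain i where i: "i < m" "b g i \<noteq> 0" using ab_inj[OF assms(1)] assms(2) by blast
  then obtain y where y: "y \<in> A" "\<chi> (y * b g i) \<noteq> 1"
    using \<chi>_nondeg b_in[OF assms(1)] by blast
  define c where "c j = (if j = i then y else 0)" for j
  have "(\<Sum>w\<in>X. ph g w) = (\<Sum>w\<in>X. ph g (wadd c w))"
    by (rule sum.reindex_bij_betw[symmetric], rule bij_betw_wadd[OF A(1)])
      (use y add_subgroup_0[OF A(1)] in \<open>auto simp: c_def\<close>)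
  also have "\<dots> = (\<Sum>w\<in>X. ph g w * \<chi> (y * b g i))"
    using i by (intro sum.cong) (auto simp: ph_wadd c_def if_distrib mult.commute cong: if_cong)
  also have "\<dots> = (\<Sum>w\<in>X. ph g w) * \<chi> (y * b g i)" by (simp add: sum_distrib_right)
  finally have "(\<Sum>w\<in>X. ph g w) = 0" using y by simp
  moreover have "wadd (a g) w = w" if "w \<in> X" for w
    using that a by (intro wadd_zero) (auto simp: nlists_iff_nth)
  ultimately show ?thesis by (simp add: weyl_def flip: sum_distrib_left)
qed

lemma trace_proj: "(\<Sum>w\<in>X. proj w w) = of_nat (card X) / of_nat (card G)"
proof -
  have "(\<Sum>w\<in>X. \<Sum>g\<in>G. weyl g w w) = (\<Sum>g\<in>G. \<Sum>w\<in>X. weyl g w w)"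
    by (rule sum.swap)
  also have "\<dots> = (\<Sum>g\<in>G. if g = 0 then of_nat (card X) else 0)"
    by (intro sum.cong) (auto simp: trace_weyl weyl_0 op_id_def)
  also have "\<dots> = of_nat (card X)"
    using G add_subgroup_0[OF G(1)] by simp
  finally show ?thesis by (simp add: proj_def flip: sum_distrib_left sum_divide_distrib)
qed

text \<open>The \<theta>-phases cancel by \<open>\<theta>_uminus\<close>. What remains is a
  simultaneous shift of both indices and a character of v - w, which is trivial on the
  diagonal.\<close>

lemma weyl_conj:
  assumes "g \<in> G" "v \<in> X" "w \<in> X"
  shows "mul (weyl g) (mul F (weyl (- g))) v w =
    \<chi> (\<Sum>i<m. b g i * (v ! i - w ! i)) * F (wadd (\<lambda>i. - a g i) v) (wadd (\<lambda>i. - a g i) w)"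
proof -
  have g': "- g \<in> G" using assms(1) G(1) by (rule add_subgroup_uminus[rotated])
  have *: "wadd (a (- g)) w = wadd (\<lambda>i. - a g i) w"
    by (intro wadd_cong) (simp add: a_uminus)
  have "ph g v * ph (- g) w = \<chi> (\<Sum>i<m. b g i * (v ! i - w ! i))"
    by (simp add: ph_def b_uminus sum_negf \<chi>_uminus algebra_simps sum_subtractf \<chi>_diff)
  moreover have "ph g (wadd (\<lambda>i. - a g i) v) = ph g v * \<chi> (- (\<Sum>i<m. b g i * a g i))"
    using assms by (simp add: ph_wadd sum_negf)
  ultimately have "\<theta> g * ph g (wadd (\<lambda>i. - a g i) v) * (\<theta> (- g) * ph (- g) w)
      = \<chi> (\<Sum>i<m. b g i * (v ! i - w ! i)) * (\<theta> g * \<theta> (- g) * \<chi> (- (\<Sum>i<m. b g i * a g i)))"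
    by (simp add: mult_ac)
  thus ?thesis
    unfolding mul_weyl_left[OF assms(1,2)] mul_weyl_right[OF g' assms(3)] * \<theta>_uminus[OF assms(1)]
    by (simp add: mult_ac)
qed

text \<open>
  Averaging the conjugates of an operator that is local on \<open>T\<close> over the stabilizer gives a scalar
  as soon as the stabilizer restricts onto the full Weyl group of the positions in \<open>T\<close>.
\<close>

lemma proj_local_proj:
  assumes diag: "\<And>v w i. v \<in> X \<Longrightarrow> w \<in> X \<Longrightarrow> F v w \<noteq> 0 \<Longrightarrow> i < m \<Longrightarrow> i \<notin> T \<Longrightarrow> v ! i = w ! i"
    and inv: "\<And>v w c. v \<in> X \<Longrightarrow> w \<in> X \<Longrightarrow> (\<And>i. i < m \<Longrightarrow> c i \<in> A) \<Longrightarrow> (\<And>i. i \<in> T \<Longrightarrow> c i = 0)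
           \<Longrightarrow> F (wadd c v) (wadd c w) = F v w"
    and T: "T \<subseteq> {..<m}"
    and surj: "\<And>x y. (\<And>i. i \<in> T \<Longrightarrow> x i \<in> A \<and> y i \<in> A)
           \<Longrightarrow> \<exists>g\<in>G. \<forall>i\<in>T. a g i = x i \<and> b g i = y i"
  shows "mul proj (mul F proj) = (\<lambda>v w. ((\<Sum>u\<in>X. F u u) / of_nat (card X)) * proj v w)"
proof -
  define K where "K g v w = \<chi> (\<Sum>i<m. b g i * (v ! i - w ! i))
      * F (wadd (\<lambda>i. - a g i) v) (wadd (\<lambda>i. - a g i) w)" for g v w
  define R where "R = (\<lambda>v w. \<Sum>g\<in>G. mul (weyl g) (mul F (weyl (- g))) v w)"
  have R: "R v w = (\<Sum>g\<in>G. K g v w)" if "v \<in> X" "w \<in> X" for v w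
    unfolding R_def K_def using that by (simp add: weyl_conj)
  \<comment> \<open>The projector absorbs Weyl operators on either side, so P F P does not change
    when F is replaced by a conjugate. It remains to show that the sum R of the conjugates is a
    scalar matrix.\<close>
  have "mul proj (mul R proj)
      = (\<lambda>v w. \<Sum>g\<in>G. mul (mul proj (weyl g)) (mul F (mul (weyl (- g)) proj)) v w)"
    unfolding R_def op_mult_sum_left op_mult_sum_right op_mult_assoc ..
  hence PRP: "mul proj (mul R proj) = (\<lambda>v w. of_nat (card G) * mul proj (mul F proj) v w)"
    by (simp add: weyl_proj proj_weyl add_subgroup_uminus[OF G(1)])
  have local_inv: "F (wadd (\<lambda>i. - a g i) (wadd c v)) (wadd (\<lambda>i. - a g i) (wadd c w))
      = F (wadd (\<lambda>i. - a g i) v) (wadd (\<lambda>i. - a g i) w)"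
    if "g \<in> G" "v \<in> X" "w \<in> X" "\<And>i. i < m \<Longrightarrow> c i \<in> A" "\<And>i. i \<in> T \<Longrightarrow> c i = 0" for g v w c
    using inv[OF wadd_minus_a_in[OF that(1,2)] wadd_minus_a_in[OF that(1,3)] that(4,5)]
    by (simp add: wadd_wadd add.commute)
  have off_diag: "R v w = 0" if vw: "v \<in> X" "w \<in> X" "v \<noteq> w" for v w
  proof (cases "\<exists>i<m. i \<notin> T \<and> v ! i \<noteq> w ! i")
    case True
    then obtain i where i: "i < m" "i \<notin> T" "v ! i \<noteq> w ! i" by blast
    have "F (wadd (\<lambda>i. - a g i) v) (wadd (\<lambda>i. - a g i) w) = 0" if "g \<in> G" for g
      using diag[OF wadd_minus_a_in[OF that vw(1)] wadd_minus_a_in[OF that vw(2)] _ i(1,2)] i vw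
      by (auto simp: nlists_iff_nth)
    thus ?thesis using vw by (simp add: R K_def)
  next
    case False
    obtain i where i: "i < m" "v ! i \<noteq> w ! i"
      using vw by (metis nlists_iff_nth nth_equalityI)
    have "v ! i - w ! i \<in> A" using vw i add_subgroup_diff[OF A(1)] by (simp add: nlists_iff_nth)
    then obtain y where y: "y \<in> A" "\<chi> (y * (v ! i - w ! i)) \<noteq> 1"
      using \<chi>_nondeg i by (metis eq_iff_diff_eq_0)
    \<comment> \<open>Here v and w differ only inside T. An element g0 with no shift on T and with
      phase part y at i alone multiplies R v w by a number other than 1; its shifts outside T are
      harmless by \<open>local_inv\<close>.\<close>
    obtain g0 where g0: "g0 \<in> G" "\<And>j. j \<in> T \<Longrightarrow> a g0 j = 0 \<and> b g0 j = (if j = i then y else 0)"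
      using surj[of "\<lambda>_. 0" "\<lambda>j. if j = i then y else 0"] y add_subgroup_0[OF A(1)] by force
    have "(\<Sum>j<m. b g0 j * (v ! j - w ! j)) = (\<Sum>j<m. if j = i then y * (v ! i - w ! i) else 0)"
    proof (intro sum.cong refl)
      fix j assume "j \<in> {..<m}"
      thus "b g0 j * (v ! j - w ! j) = (if j = i then y * (v ! i - w ! i) else 0)"
        using g0(2)[of j] False i by (cases "j \<in> T") auto
    qed
    hence \<chi>: "\<chi> (\<Sum>j<m. b g0 j * (v ! j - w ! j)) = \<chi> (y * (v ! i - w ! i))"
      using i by simp
    have "K (g + g0) v w = K g v w * \<chi> (y * (v ! i - w ! i))" if "g \<in> G" for g
    proof -
      have "F (wadd (\<lambda>i. - a (g + g0) i) v) (wadd (\<lambda>i. - a (g + g0) i) w)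
          = F (wadd (\<lambda>i. - a g i) (wadd (\<lambda>i. - a g0 i) v))
              (wadd (\<lambda>i. - a g i) (wadd (\<lambda>i. - a g0 i) w))"
        by (simp add: wadd_wadd a_add add.commute)
      also have "\<dots> = F (wadd (\<lambda>i. - a g i) v) (wadd (\<lambda>i. - a g i) w)"
        by (rule local_inv) (use that vw g0 a_in add_subgroup_uminus[OF A(1)] in auto)
      finally show ?thesis
        unfolding K_def by (simp add: b_add distrib_right sum.distrib \<chi>_add \<chi>)
    qed
    hence "(\<Sum>g\<in>G. K g v w) = (\<Sum>g\<in>G. K g v w) * \<chi> (y * (v ! i - w ! i))"
      using sum_translate[OF g0(1), of "\<lambda>g. K g v w"] by (simp add: sum_distrib_right)
    thus ?thesis using y vw by (simp add: R)
  qed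
  have const: "R v v = R w w" if vw: "v \<in> X" "w \<in> X" for v w
  proof -
    \<comment> \<open>g0 carries v to w on T. The remaining difference c vanishes on T and is
      removed by \<open>local_inv\<close>.\<close>
    obtain g0 where g0: "g0 \<in> G" "\<And>j. j \<in> T \<Longrightarrow> a g0 j = w ! j - v ! j"
      using surj[of "\<lambda>j. w ! j - v ! j" "\<lambda>_. 0"] vw T add_subgroup_0[OF A(1)]
        add_subgroup_diff[OF A(1)] by (force simp: nlists_iff_nth subset_iff)
    define c where "c j = w ! j - v ! j - a g0 j" for j
    have w: "wadd (\<lambda>i. - a g0 i) w = wadd c v"
      by (rule nth_equalityI) (use vw in \<open>auto simp: c_def nlists_iff_nth\<close>)
    have "K (g + g0) w w = K g v v" if "g \<in> G" for g
    proof -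
      have "F (wadd (\<lambda>i. - a (g + g0) i) w) (wadd (\<lambda>i. - a (g + g0) i) w)
          = F (wadd (\<lambda>i. - a g i) (wadd c v)) (wadd (\<lambda>i. - a g i) (wadd c v))"
        unfolding w[symmetric] by (simp add: wadd_wadd a_add add.commute)
      also have "\<dots> = F (wadd (\<lambda>i. - a g i) v) (wadd (\<lambda>i. - a g i) v)"
        by (rule local_inv)
          (use that vw g0 a_in add_subgroup_diff[OF A(1)] in \<open>auto simp: c_def nlists_iff_nth\<close>)
      finally show ?thesis by (simp add: K_def)
    qed
    thus ?thesis
      using sum_translate[OF g0(1), of "\<lambda>g. K g w w"] vw by (simp add: R)
  qed
  \<comment> \<open>Conjugation preserves the trace, which then identifies the scalar.\<close>
  have trace: "(\<Sum>w\<in>X. R w w) = of_nat (card G) * (\<Sum>w\<in>X. F w w)"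
  proof -
    have "(\<Sum>w\<in>X. R w w) = (\<Sum>g\<in>G. \<Sum>w\<in>X. K g w w)"
      by (simp add: R sum.swap[of _ X G])
    also have "\<dots> = (\<Sum>g\<in>G. \<Sum>w\<in>X. F w w)"
    proof (rule sum.cong[OF refl])
      fix g assume "g \<in> G"
      hence "bij_betw (wadd (\<lambda>i. - a g i)) X X"
        using a_in add_subgroup_uminus[OF A(1)] by (intro bij_betw_wadd[OF A(1)]) auto
      thus "(\<Sum>w\<in>X. K g w w) = (\<Sum>w\<in>X. F w w)"
        unfolding K_def by (simp add: \<chi>_0 sum.reindex_bij_betw[of _ X X "\<lambda>w. F w w"])
    qed
    finally show ?thesis by simp
  qed
  define r where "r = (\<Sum>w\<in>X. F w w) / of_nat (card X) * of_nat (card G)"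
  have Rr: "R = (\<lambda>v w. r * op_id A m v w)"
  proof (intro ext)
    fix v w
    show "R v w = r * op_id A m v w"
    proof (cases "v \<in> X \<and> w \<in> X")
      case True
      hence "(\<Sum>w\<in>X. R w w) = (\<Sum>w\<in>X. R v v)"
        by (intro sum.cong refl const) simp_all
      hence "of_nat (card X) * R v v = (\<Sum>w\<in>X. R w w)" by simp
      moreover have "card X > 0" using True finite_X by (auto simp: card_gt_0_iff)
      ultimately have "R v v = r" unfolding trace r_def by (simp add: field_simps)
      thus ?thesis using True off_diag[of v w] by (auto simp: op_id_def)
    next
      case False
      hence "R v w = 0"
        using weyl_qops add_subgroup_uminus[OF G(1)]
        by (auto simp: R_def op_mult_def qops_def intro!: sum.neutral)
      thus ?thesis using False by (auto simp: op_id_def)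
    qed
  qed
  have "of_nat (card G) * mul proj (mul F proj) v w = r * proj v w" for v w
  proof -
    have "of_nat (card G) * mul proj (mul F proj) v w = mul proj (mul R proj) v w"
      by (simp add: PRP)
    also have "\<dots> = r * proj v w"
      unfolding Rr op_mult_scale_left op_mult_scale_right op_mult_id_left[OF A(2) proj_qops] proj_idem ..
    finally show ?thesis .
  qed
  hence "of_nat (card G) * mul proj (mul F proj) v w
      = of_nat (card G) * (((\<Sum>u\<in>X. F u u) / of_nat (card X)) * proj v w)" for v w
    by (simp add: r_def mult_ac)
  thus ?thesis using card_G by (intro ext, subst (asm) mult_left_cancel) simp_all
qed

lemma orth_projector_proj: "orth_projector A m (op_apply A m proj ` qspace A m) proj"
  by (simp add: orth_projector_def proj_qops proj_idem proj_adjoint)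

end

section \<open>Orthonormal families\<close>

definition ip :: "'i set \<Rightarrow> ('i \<Rightarrow> complex) \<Rightarrow> ('i \<Rightarrow> complex) \<Rightarrow> complex" where
  "ip X u v = (\<Sum>x\<in>X. cnj (u x) * v x)"

definition orthonormal :: "'i set \<Rightarrow> ('i \<Rightarrow> complex) set \<Rightarrow> bool" where
  "orthonormal X B \<longleftrightarrow> finite B \<and> (\<forall>u\<in>B. \<forall>v\<in>B. ip X u v = (if u = v then 1 else 0))"

definition projects_onto_span :: "'i set \<Rightarrow> ('i \<Rightarrow> complex) set \<Rightarrow> ('i \<Rightarrow> complex) \<Rightarrow> ('i \<Rightarrow> complex)" where
  "projects_onto_span X B v = (\<lambda>x. \<Sum>b\<in>B. ip X b v * b x)"

lemma ip_sum_right: "ip X u (\<lambda>x. \<Sum>b\<in>B. c b * f b x) = (\<Sum>b\<in>B. c b * ip X u (f b))"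
  unfolding ip_def sum_distrib_left by (subst sum.swap) (simp add: mult_ac)

lemma ip_diff_right: "ip X u (\<lambda>x. v x - w x) = ip X u v - ip X u w"
  by (simp add: ip_def algebra_simps sum_subtractf)

lemma ip_commute: "ip X v u = cnj (ip X u v)"
  by (simp add: ip_def mult.commute)

lemma of_real_norm_square: "(complex_of_real (norm z))\<^sup>2 = z * cnj z"
  by (metis complex_norm_square of_real_power)

lemma ip_self: "ip X u u = of_real (\<Sum>x\<in>X. (norm (u x))\<^sup>2)"
  by (simp add: ip_def of_real_norm_square mult.commute)

lemma ip_proj:
  assumes "orthonormal X B" "b \<in> B"
  shows "ip X b (projects_onto_span X B v) = ip X b v"
proof -
  have "ip X b (projects_onto_span X B v) = (\<Sum>b'\<in>B. ip X b' v * ip X b b')"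
    unfolding projects_onto_span_def by (rule ip_sum_right)
  also have "\<dots> = (\<Sum>b'\<in>B. if b' = b then ip X b v else 0)"
    using assms by (intro sum.cong) (auto simp: orthonormal_def)
  also have "\<dots> = ip X b v" using assms by (simp add: orthonormal_def)
  finally show ?thesis .
qed

lemma bessel:
  assumes "orthonormal X B"
  shows "(\<Sum>b\<in>B. (norm (ip X b v))\<^sup>2) \<le> (\<Sum>x\<in>X. (norm (v x))\<^sup>2)"
proof -
  let ?p = "projects_onto_span X B v"
  let ?S = "\<Sum>b\<in>B. (norm (ip X b v))\<^sup>2"
  have "ip X v ?p = (\<Sum>b\<in>B. ip X b v * ip X v b)"
    unfolding projects_onto_span_def by (rule ip_sum_right)
  also have "\<dots> = of_real ?S"
    by (simp add: ip_commute[of X v] of_real_norm_square)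
  finally have vp: "ip X v ?p = of_real ?S" .
  have "ip X ?p ?p = (\<Sum>b\<in>B. ip X b v * ip X ?p b)"
    unfolding projects_onto_span_def[of X B v] by (subst ip_sum_right) simp
  also have "\<dots> = (\<Sum>b\<in>B. ip X b v * cnj (ip X b v))"
    using ip_commute[of X ?p] ip_proj[OF assms] by (intro sum.cong refl) metis
  also have "\<dots> = of_real ?S" by (simp add: of_real_norm_square)
  finally have pp: "ip X ?p ?p = of_real ?S" .
  have "0 \<le> Re (ip X (\<lambda>x. v x - ?p x) (\<lambda>x. v x - ?p x))"
    unfolding ip_self by (simp add: sum_nonneg)
  also have "ip X (\<lambda>x. v x - ?p x) (\<lambda>x. v x - ?p x)
      = ip X v v - ip X v ?p - cnj (ip X v ?p) + ip X ?p ?p"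
    by (simp add: ip_def algebra_simps sum_subtractf sum.distrib)
  finally show ?thesis unfolding vp pp unfolding ip_self by simp
qed

lemma ip_unit: "finite X \<Longrightarrow> x \<in> X \<Longrightarrow> ip X u (\<lambda>y. if y = x then 1 else 0) = cnj (u x)"
  by (simp add: ip_def if_distrib cong: if_cong)

text \<open>Count the squared moduli of all entries: each b contributes 1, and each x at most 1, by
  Bessel's inequality for the unit vector at x. The bound is what makes an orthonormal set of
  maximal size exist.\<close>

lemma card_orthonormal_le:
  assumes "finite X" "orthonormal X B"
  shows "card B \<le> card X"
proof -
  have "of_nat (card B) = (\<Sum>b\<in>B. ip X b b)" using assms by (simp add: orthonormal_def)
  also have "\<dots> = of_real (\<Sum>b\<in>B. \<Sum>x\<in>X. (norm (b x))\<^sup>2)" by (simp add: ip_self)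
  finally have "real (card B) = (\<Sum>b\<in>B. \<Sum>x\<in>X. (norm (b x))\<^sup>2)"
    by (metis of_real_eq_iff of_real_of_nat_eq)
  also have "\<dots> = (\<Sum>x\<in>X. \<Sum>b\<in>B. (norm (b x))\<^sup>2)" by (rule sum.swap)
  also have "\<dots> \<le> (\<Sum>x\<in>X. 1)"
  proof (rule sum_mono)
    fix x assume x: "x \<in> X"
    have "(\<Sum>b\<in>B. (norm (b x))\<^sup>2) = (\<Sum>b\<in>B. (norm (ip X b (\<lambda>y. if y = x then 1 else 0)))\<^sup>2)"
      using x assms by (simp add: ip_unit)
    also have "\<dots> \<le> (\<Sum>y\<in>X. (norm (if y = x then 1 else 0 :: complex))\<^sup>2)"
      by (rule bessel) fact
    also have "\<dots> = (\<Sum>y\<in>X. if y = x then 1 else 0)" by (intro sum.cong) auto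
    also have "\<dots> = 1" using x assms by simp
    finally show "(\<Sum>b\<in>B. (norm (b x))\<^sup>2) \<le> 1" .
  qed
  finally show ?thesis by simp
qed

text \<open>Any orthonormal subset of \<open>Q\<close> of maximal size works.\<close>

lemma orthonormal_basis_extend:
  assumes X: "finite X" and B0: "orthonormal X B0" "B0 \<subseteq> Q"
    and supp: "\<And>v x. v \<in> Q \<Longrightarrow> x \<notin> X \<Longrightarrow> v x = 0"
    and lin: "\<And>u v c. u \<in> Q \<Longrightarrow> v \<in> Q \<Longrightarrow> (\<lambda>x. u x + c * v x) \<in> Q"
  obtains B where "orthonormal X B" "B0 \<subseteq> B" "B \<subseteq> Q"
    "\<And>v. v \<in> Q \<Longrightarrow> projects_onto_span X B v = v"
proof -
  let ?P = "\<lambda>B. orthonormal X B \<and> B0 \<subseteq> B \<and> B \<subseteq> Q"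
  have "\<exists>B. ?P B \<and> (\<forall>B'. ?P B' \<longrightarrow> card B' \<le> card B)"
    by (rule ex_has_greatest_nat[of ?P B0 card "Suc (card X)"])
      (use B0 card_orthonormal_le[OF X] in \<open>auto simp: less_Suc_eq_le\<close>)
  then obtain B where B: "orthonormal X B" "B0 \<subseteq> B" "B \<subseteq> Q"
    and max: "\<And>B'. ?P B' \<Longrightarrow> card B' \<le> card B" by blast
  have fin: "finite B" using B by (simp add: orthonormal_def)
  have "projects_onto_span X B v = v" if v: "v \<in> Q" for v
  proof (rule ccontr)
    assume neq: "projects_onto_span X B v \<noteq> v"
    define w where "w = (\<lambda>x. v x - projects_onto_span X B v x)"
    have "(\<lambda>x. v x - (\<Sum>b\<in>B'. ip X b v * b x)) \<in> Q" if "B' \<subseteq> B" for B'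
      using finite_subset[OF that fin] that
    proof (induction B')
      case empty thus ?case using v by simp
    next
      case (insert b B')
      hence "(\<lambda>x. (v x - (\<Sum>b\<in>B'. ip X b v * b x)) + (- ip X b v) * b x) \<in> Q"
        using B by (intro lin) auto
      thus ?case using insert by (simp add: algebra_simps)
    qed
    hence wQ: "w \<in> Q" unfolding w_def projects_onto_span_def by blast
    have perp: "ip X b w = 0" if "b \<in> B" for b
      unfolding w_def ip_diff_right using ip_proj[OF B(1) that] by simp
    define s where "s = (\<Sum>x\<in>X. (norm (w x))\<^sup>2)"
    have "s \<noteq> 0"
    proof
      assume "s = 0"
      hence "w x = 0" if "x \<in> X" for x
        using that X unfolding s_def by (subst (asm) sum_nonneg_eq_0_iff) auto
      hence "w x = 0" for x using supp[OF wQ] by blast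
      thus False using neq by (auto simp: w_def fun_eq_iff)
    qed
    hence s: "s > 0" unfolding s_def by (metis less_eq_real_def sum_nonneg zero_le_power2)
    define d where "d = 1 / sqrt s"
    define u where "u = (\<lambda>x. of_real d * w x)"
    \<comment> \<open>The closure property \<open>lin\<close> only adds a multiple to a vector, so d
      w is written as w + (d - 1) w.\<close>
    have "(\<lambda>x. w x + (of_real d - 1) * w x) \<in> Q" by (rule lin) fact+
    hence uQ: "u \<in> Q" by (simp add: u_def algebra_simps)
    have "ip X u u = of_real (d * d) * ip X w w"
      by (simp add: ip_def u_def sum_distrib_left mult_ac)
    also have "\<dots> = of_real (d * d * s)" unfolding ip_self s_def[symmetric] by simp
    also have "d * d * s = 1" using s by (simp add: d_def)
    finally have uu: "ip X u u = 1" by simp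
    have bu: "ip X b u = 0" if "b \<in> B" for b
      using perp[OF that] by (simp add: ip_def u_def mult.left_commute flip: sum_distrib_left)
    have ub: "ip X u b = 0" if "b \<in> B" for b
      using bu[OF that] by (simp add: ip_commute[of X u])
    have "u \<notin> B" using uu bu by force
    moreover have "orthonormal X (insert u B)"
      using B(1) uu bu ub \<open>u \<notin> B\<close> unfolding orthonormal_def by auto
    hence "card (insert u B) \<le> card B" using uQ B by (intro max) auto
    ultimately show False using fin by simp
  qed
  thus ?thesis using that B by blast
qed

lemma projects_onto_span_unit:
  "finite X \<Longrightarrow> x \<in> X \<Longrightarrow>
    projects_onto_span X B (\<lambda>y. if y = x then 1 else 0) = (\<lambda>y. \<Sum>b\<in>B. b y * cnj (b x))"
  by (simp add: projects_onto_span_def ip_unit mult.commute)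

lemma sum_norm_orthonormal:
  assumes "orthonormal X B"
  shows "(\<Sum>x\<in>X. \<Sum>b\<in>B. b x * cnj (b x)) = of_nat (card B)"
proof -
  have "(\<Sum>x\<in>X. \<Sum>b\<in>B. b x * cnj (b x)) = (\<Sum>b\<in>B. ip X b b)"
    unfolding ip_def by (subst sum.swap) (simp add: mult.commute)
  also have "\<dots> = of_nat (card B)" using assms by (simp add: orthonormal_def)
  finally show ?thesis .
qed

text \<open>Expanding the unit vectors gives the completeness relation, and its trace counts the
  basis. The two relations together are the two halves of unitarity for the matrix with columns
  B.\<close>

lemma orthonormal_basis_full:
  assumes "finite X" "orthonormal X B0" "\<And>v x. v \<in> B0 \<Longrightarrow> x \<notin> X \<Longrightarrow> v x = 0"
  obtains B where "orthonormal X B" "B0 \<subseteq> B" "card B = card X"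
    "\<And>v x. v \<in> B \<Longrightarrow> x \<notin> X \<Longrightarrow> v x = 0"
    "\<And>x y. x \<in> X \<Longrightarrow> y \<in> X \<Longrightarrow> (\<Sum>b\<in>B. b y * cnj (b x)) = (if y = x then 1 else 0)"
proof -
  let ?Q = "{v. \<forall>x. x \<notin> X \<longrightarrow> v x = (0 :: complex)}"
  obtain B where B: "orthonormal X B" "B0 \<subseteq> B" "B \<subseteq> ?Q"
    and p: "\<And>v. v \<in> ?Q \<Longrightarrow> projects_onto_span X B v = v"
    by (rule orthonormal_basis_extend[OF assms(1,2), of ?Q]) (use assms(3) in auto)
  have *: "(\<Sum>b\<in>B. b y * cnj (b x)) = (if y = x then 1 else 0)" if "x \<in> X" for x y
    using p[of "\<lambda>y. if y = x then 1 else 0"] projects_onto_span_unit[OF assms(1) that, of B] that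
    by (auto simp: fun_eq_iff)
  have "of_nat (card B) = (of_nat (card X) :: complex)"
    using sum_norm_orthonormal[OF B(1)] * by simp
  hence "card B = card X" by simp
  thus ?thesis using that B * by blast
qed

section \<open>Orthogonal projectors and orthonormal bases of their ranges\<close>

lemma op_apply_unit:
  "finite A \<Longrightarrow> w \<in> nlists m A \<Longrightarrow> op_apply A m P (\<lambda>y. if y = w then 1 else 0) = (\<lambda>v. P v w)"
  by (simp add: op_apply_def finite_nlists if_distrib cong: if_cong)

lemma op_apply_op_mult:
  "op_apply A m (op_mult A m L M) v = op_apply A m L (op_apply A m M v)"
proof
  fix w
  have "op_apply A m (op_mult A m L M) v w
      = (\<Sum>u\<in>nlists m A. \<Sum>t\<in>nlists m A. L w t * M t u * v u)"
    by (simp add: op_apply_def op_mult_def sum_distrib_right)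
  also have "\<dots> = (\<Sum>t\<in>nlists m A. \<Sum>u\<in>nlists m A. L w t * M t u * v u)"
    by (rule sum.swap)
  finally show "op_apply A m (op_mult A m L M) v w = op_apply A m L (op_apply A m M v) w"
    by (simp add: op_apply_def sum_distrib_left mult.assoc)
qed

lemma ip_self_adjoint:
  assumes "op_adjoint P = P"
  shows "ip (nlists m A) b (op_apply A m P v) = ip (nlists m A) (op_apply A m P b) v"
proof -
  have adj: "cnj (P w v) = P v w" for v w
    using fun_cong[OF fun_cong[OF assms, of v], of w] by (simp add: op_adjoint_def)
  have "ip (nlists m A) b (op_apply A m P v)
      = (\<Sum>w\<in>nlists m A. \<Sum>u\<in>nlists m A. cnj (b w) * P w u * v u)"
    by (simp add: ip_def op_apply_def sum_distrib_left mult_ac)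
  also have "\<dots> = (\<Sum>u\<in>nlists m A. \<Sum>w\<in>nlists m A. cnj (b w) * P w u * v u)"
    by (rule sum.swap)
  also have "\<dots> = ip (nlists m A) (op_apply A m P b) v"
    by (simp add: ip_def op_apply_def sum_distrib_left sum_distrib_right adj mult_ac)
  finally show ?thesis .
qed

text \<open>For an orthonormal basis B of the range, P is the sum of the rank one projectors b b*,
  so that its trace is the dimension.\<close>

lemma orth_projector_basis:
  assumes A: "finite A" and P: "orth_projector A m Q P"
  obtains B where "orthonormal (nlists m A) B" "B \<subseteq> Q"
    "\<And>v. v \<in> Q \<Longrightarrow> projects_onto_span (nlists m A) B v = v"
    "(\<Sum>w\<in>nlists m A. P w w) = of_nat (card B)"
    "\<And>b. b \<in> Q \<Longrightarrow> op_apply A m P b = b"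
    "Q \<subseteq> qspace A m"
    "\<And>u v c. u \<in> Q \<Longrightarrow> v \<in> Q \<Longrightarrow> (\<lambda>x. u x + c * v x) \<in> Q"
proof -
  let ?X = "nlists m A"
  have X: "finite ?X" by (rule finite_nlists) fact
  have Pq: "P \<in> qops A m" and PP: "op_mult A m P P = P" and Padj: "op_adjoint P = P"
    and Q: "Q = op_apply A m P ` qspace A m"
    using P by (auto simp: orth_projector_def)
  have fix_Q: "op_apply A m P b = b" if "b \<in> Q" for b
  proof -
    obtain \<psi> where b: "b = op_apply A m P \<psi>" using \<open>b \<in> Q\<close> Q by blast
    thus ?thesis using op_apply_op_mult[of A m P P \<psi>] unfolding PP by simp
  qed
  have Qq: "Q \<subseteq> qspace A m" using Pq unfolding Q by (auto simp: qspace_def op_apply_def qops_def)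
  have lin: "(\<lambda>x. u x + c * v x) \<in> Q" if "u \<in> Q" "v \<in> Q" for u v c
  proof -
    have "op_apply A m P (\<lambda>x. u x + c * v x) = (\<lambda>w. op_apply A m P u w + c * op_apply A m P v w)"
      by (intro ext) (simp add: op_apply_def algebra_simps sum.distrib sum_distrib_left)
    also have "\<dots> = (\<lambda>x. u x + c * v x)" using fix_Q that by simp
    finally have "(\<lambda>x. u x + c * v x) = op_apply A m P (\<lambda>x. u x + c * v x)" ..
    moreover have "(\<lambda>x. u x + c * v x) \<in> qspace A m" using subsetD[OF Qq that(1)] subsetD[OF Qq that(2)] by (auto simp: qspace_def)
    ultimately show ?thesis unfolding Q by (rule image_eqI)
  qed
  obtain B where B: "orthonormal ?X B" "B \<subseteq> Q"
    and p: "\<And>v. v \<in> Q \<Longrightarrow> projects_onto_span ?X B v = v"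
    by (rule orthonormal_basis_extend[OF X, of "{}" Q])
      (use subsetD[OF Qq] lin in \<open>auto simp: orthonormal_def qspace_def\<close>)
  have "P u w = (\<Sum>b\<in>B. b u * cnj (b w))" if w: "w \<in> ?X" for u w
  proof -
    let ?e = "\<lambda>y. if y = w then 1 else 0 :: complex"
    have "op_apply A m P ?e \<in> Q" unfolding Q using w by (intro imageI) (auto simp: qspace_def)
    hence "op_apply A m P ?e = projects_onto_span ?X B (op_apply A m P ?e)" using p by simp
    \<comment> \<open>P is self-adjoint and fixes b, so e and P e have the same inner product with
      b.\<close>
    also have "\<dots> = projects_onto_span ?X B ?e"
      using fix_Q B(2) by (auto simp: projects_onto_span_def ip_self_adjoint[OF Padj] subset_iff intro!: ext sum.cong)
    finally show ?thesis
      unfolding op_apply_unit[OF A w] projects_onto_span_unit[OF X w] by (simp add: fun_eq_iff)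
  qed
  hence "(\<Sum>w\<in>?X. P w w) = of_nat (card B)"
    using sum_norm_orthonormal[OF B(1)] by simp
  thus ?thesis using that B p fix_Q Qq lin by blast
qed

lemma bij_betw_extend:
  assumes "finite X" and fB: "finite B" and "card X = card B" "J \<subseteq> X" "inj_on f J" "f ` J \<subseteq> B"
  obtains h where "bij_betw h X B" "\<And>j. j \<in> J \<Longrightarrow> h j = f j"
proof -
  have "card (X - J) = card (B - f ` J)"
    using assms fB by (simp add: card_Diff_subset finite_subset card_image)
  then obtain g where g: "bij_betw g (X - J) (B - f ` J)"
    using assms fB by (metis finite_Diff finite_same_card_bij)
  define h where "h x = (if x \<in> J then f x else g x)" for x
  have "bij_betw h J (f ` J)"
    using assms by (subst bij_betw_cong[of _ _ f]) (auto simp: h_def bij_betw_def)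
  moreover have "bij_betw h (X - J) (B - f ` J)"
    using g by (subst bij_betw_cong[of _ _ g]) (auto simp: h_def)
  ultimately have "bij_betw h (J \<union> (X - J)) (f ` J \<union> (B - f ` J))"
    by (rule bij_betw_combine) auto
  moreover have "J \<union> (X - J) = X" "f ` J \<union> (B - f ` J) = B" using assms by auto
  ultimately show ?thesis using that[of h] by (simp add: h_def)
qed

section \<open>The encoding unitary\<close>

text \<open>The matrix of \<open>I \<otimes> |x\<rangle>\<langle>y|\<close>, the second factor being the last qudit.\<close>

definition last_unit :: "'a set \<Rightarrow> nat \<Rightarrow> 'a \<Rightarrow> 'a \<Rightarrow> 'a qop" where
  "last_unit A n x y = (\<lambda>v w. if v \<in> nlists (Suc n) A \<and> w \<in> nlists (Suc n) A \<and>
     take n v = take n w \<and> v ! n = x \<and> w ! n = y then 1 else 0)"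

lemma nlists_Suc_snoc: "bij_betw (\<lambda>(u, x). u @ [x]) (nlists n A \<times> A) (nlists (Suc n) A)"
proof (rule bij_betw_byWitness[where f' = "\<lambda>w. (take n w, w ! n)"])
  show "\<forall>w\<in>nlists (Suc n) A. (case (take n w, w ! n) of (u, x) \<Rightarrow> u @ [x]) = w"
    by (auto simp: nlists_iff_nth take_Suc_conv_app_nth[symmetric])
qed (auto simp: nlists_iff_nth nth_append less_Suc_eq)

lemma sum_nlists_Suc:
  "(\<Sum>w\<in>nlists (Suc n) A. f w) = (\<Sum>u\<in>nlists n A. \<Sum>x\<in>A. f (u @ [x]))"
  using sum.reindex_bij_betw[OF nlists_Suc_snoc[of n A], of f]
  by (simp add: sum.cartesian_product case_prod_unfold)

lemma snoc_in_nlists: "u @ [x] \<in> nlists (Suc n) A \<longleftrightarrow> u \<in> nlists n A \<and> x \<in> A"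
  by (auto simp: nlists_def)

lemma append_in_nlists:
  "u \<in> nlists i A \<Longrightarrow> v \<in> nlists j A \<Longrightarrow> u @ v \<in> nlists (i + j) A"
  by (auto simp: nlists_def)

text \<open>The Knill-Laflamme condition, read on code vectors instead of the projector.\<close>

lemma ip_op_mult:
  assumes P: "op_adjoint P = P" "op_apply A m P b = b" "op_apply A m P b' = b'"
    and "op_mult A m P (op_mult A m F P) = (\<lambda>v w. \<mu> * P v w)"
  shows "ip (nlists m A) b (op_apply A m F b') = \<mu> * ip (nlists m A) b b'"
proof -
  let ?X = "nlists m A"
  have "ip ?X b (op_apply A m F b') = ip ?X (op_apply A m P b) (op_apply A m F (op_apply A m P b'))"
    using P by simp
  also have "\<dots> = ip ?X b (op_apply A m (op_mult A m P (op_mult A m F P)) b')"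
    by (simp only: ip_self_adjoint[OF P(1), symmetric] op_apply_op_mult)
  also have "\<dots> = ip ?X b (\<lambda>w. \<mu> * op_apply A m P b' w)"
    unfolding assms(4) by (simp add: op_apply_def sum_distrib_left mult.assoc)
  also have "\<dots> = \<mu> * ip ?X b b'"
    unfolding P(3) by (simp add: ip_def sum_distrib_left mult_ac)
  finally show ?thesis .
qed

lemma ip_last_unit:
  assumes A: "finite A" "x \<in> A" "y \<in> A"
  shows "ip (nlists (Suc n) A) b (op_apply A (Suc n) (last_unit A n x y) b')
    = (\<Sum>u\<in>nlists n A. cnj (b (u @ [x])) * b' (u @ [y]))"
proof -
  have *: "op_apply A (Suc n) (last_unit A n x y) b' (u @ [z]) = (if z = x then b' (u @ [y]) else 0)"
    if u: "u \<in> nlists n A" and z: "z \<in> A" for u z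
  proof -
    have len: "length u = n" using u by (simp add: nlists_iff_nth)
    have "op_apply A (Suc n) (last_unit A n x y) b' (u @ [z])
        = (\<Sum>v\<in>nlists (Suc n) A. if v = u @ [y] then (if z = x then b' (u @ [y]) else 0) else 0)"
      unfolding op_apply_def
    proof (rule sum.cong[OF refl])
      fix v assume v: "v \<in> nlists (Suc n) A"
      show "last_unit A n x y (u @ [z]) v * b' v
          = (if v = u @ [y] then if z = x then b' (u @ [y]) else 0 else 0)"
      proof (cases "v = u @ [y]")
        case True
        thus ?thesis using u z A len by (simp add: last_unit_def snoc_in_nlists nth_append)
      next
        case False
        have "length v = Suc n" using v by (simp add: nlists_iff_nth)
        hence "v = take n v @ [v ! n]" by (simp add: take_Suc_conv_app_nth[symmetric])
        hence "\<not> (take n (u @ [z]) = take n v \<and> (u @ [z]) ! n = x \<and> v ! n = y)"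
          using False len by auto
        thus ?thesis using False unfolding last_unit_def by auto
      qed
    qed
    also have "\<dots> = (if z = x then b' (u @ [y]) else 0)"
      using u A by (simp add: snoc_in_nlists finite_nlists)
    finally show ?thesis .
  qed
  have "(\<Sum>z\<in>A. cnj (b (u @ [z])) * op_apply A (Suc n) (last_unit A n x y) b' (u @ [z]))
      = cnj (b (u @ [x])) * b' (u @ [y])" if "u \<in> nlists n A" for u
  proof -
    have "(\<Sum>z\<in>A. cnj (b (u @ [z])) * op_apply A (Suc n) (last_unit A n x y) b' (u @ [z]))
        = (\<Sum>z\<in>A. if z = x then cnj (b (u @ [x])) * b' (u @ [y]) else 0)"
      using that by (intro sum.cong) (auto simp: *)
    thus ?thesis using A by simp
  qed
  thus ?thesis by (simp add: ip_def sum_nlists_Suc)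
qed

lemma max_ent_pairs_one:
  assumes "finite A" "x \<in> A"
  shows "max_ent_pairs A 1 [x, y] = (if x = y then of_real (1 / sqrt (card A)) else 0)"
proof -
  have "(\<Sum>z\<in>A. ket [z, z] [x, y]) = (\<Sum>z\<in>A. if z = x then if x = y then 1 else 0 else 0)"
    by (intro sum.cong) (auto simp: ket_def)
  also have "\<dots> = (if x = y then 1 else 0)" using assms by simp
  finally show ?thesis by (simp add: max_ent_pairs_def max_ent_def)
qed

text \<open>With one pair, the sender's half sits at position n - 1 and the receiver's at position
  n, so the support consists of the words u 0...0 x x.\<close>

lemma eaqecc_input_one:
  assumes A: "finite A" and w: "w \<in> nlists (Suc n) A" and kn: "k + 1 \<le> n"
  shows "eaqecc_input A n k 1 \<psi> w
    = (if \<exists>u x. w = u @ replicate (n - k - 1) 0 @ [x, x] \<and> length u = k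
       then \<psi> (take k w) * of_real (1 / sqrt (card A)) else 0)"
proof -
  define u where "u = take k w"
  define v where "v = take (n - k - 1) (drop k w)"
  define r where "r = drop (n - k - 1) (drop k w)"
  have len: "length w = Suc n" using w by (simp add: nlists_iff_nth)
  have lu: "length u = k" and lv: "length v = n - k - 1" and lr: "length r = Suc (Suc 0)"
    using len kn by (simp_all add: u_def v_def r_def)
  obtain x y where r: "r = [x, y]" using lr unfolding length_Suc_conv by auto
  have wd: "w = u @ v @ [x, y]"
    unfolding r[symmetric] by (simp only: u_def v_def r_def append_take_drop_id)
  have x: "x \<in> A" using w unfolding wd by (simp add: nlists_def)
  have "eaqecc_input A n k 1 \<psi> w
      = \<psi> u * (ket (replicate (n - k - 1) 0) v * max_ent_pairs A 1 [x, y])"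
    unfolding eaqecc_input_def tensor_vec_def r[symmetric] by (simp add: u_def v_def r_def)
  also have "\<dots> = (if v = replicate (n - k - 1) 0 \<and> x = y
      then \<psi> u * of_real (1 / sqrt (card A)) else 0)"
    unfolding max_ent_pairs_one[OF A x] by (simp add: ket_def)
  also have "v = replicate (n - k - 1) 0 \<and> x = y
      \<longleftrightarrow> (\<exists>u x. w = u @ replicate (n - k - 1) 0 @ [x, x] \<and> length u = k)"
    using lu lv by (auto simp: wd)
  finally show ?thesis by (simp only: u_def)
qed

text \<open>
  The isometry defined by an orthonormal basis of \<open>Q\<close> splits into slices along the last qudit.
  By the hypothesis on the operators \<open>I \<otimes> |x\<rangle>\<langle>y|\<close> these are, up to the factor \<open>\<surd>q\<close>, isometries
  with orthogonal ranges, and they are put together to the columns of \<open>U\<close>.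
\<close>

lemma is_eaqecc_one:
  fixes A :: "'a :: zero set"
  assumes A: "finite A" "0 \<in> A" and kn: "k + 1 \<le> n"
    and P: "orth_projector A (n + 1) Q P"
    and trace: "(\<Sum>w\<in>nlists (n + 1) A. P w w) = of_nat (card A ^ k)"
    and last: "\<And>x y. x \<in> A \<Longrightarrow> y \<in> A \<Longrightarrow>
      op_mult A (n + 1) P (op_mult A (n + 1) (last_unit A n x y) P)
        = (\<lambda>v w. ((if x = y then 1 else 0) / of_nat (card A)) * P v w)"
  shows "is_eaqecc A n k 1 Q"
proof -
  let ?X = "nlists (Suc n) A" and ?q = "card A"
  have q: "?q > 0" using A by (auto simp: card_gt_0_iff)
  obtain B where B: "orthonormal ?X B" "B \<subseteq> Q"
    and span: "\<And>v. v \<in> Q \<Longrightarrow> projects_onto_span ?X B v = v"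
    and cardB: "(\<Sum>w\<in>?X. P w w) = of_nat (card B)"
    and fixQ: "\<And>b. b \<in> Q \<Longrightarrow> op_apply A (Suc n) P b = b"
    and Qq: "Q \<subseteq> qspace A (Suc n)"
    and lin: "\<And>u v c. u \<in> Q \<Longrightarrow> v \<in> Q \<Longrightarrow> (\<lambda>x. u x + c * v x) \<in> Q"
    using orth_projector_basis[OF A(1) P] unfolding Suc_eq_plus1 by blast
  have finB: "finite B" using B by (simp add: orthonormal_def)
  have "of_nat (card B) = (of_nat (?q ^ k) :: complex)"
    using cardB trace by simp
  hence "card B = card (nlists k A)"
    using A by (simp add: card_nlists flip: of_nat_power)
  then obtain \<beta> where \<beta>: "bij_betw \<beta> (nlists k A) B"
    using finB finite_nlists[OF A(1)] finite_same_card_bij by metis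
  \<comment> \<open>Slices of a code vector along the last qudit have squared norm 1 / q. The factor
    sqrt q normalises them and later cancels the amplitude of the maximally entangled pair.\<close>
  define c where "c = complex_of_real (sqrt ?q)"
  have c: "c * c = of_nat ?q" "cnj c = c"
    by (simp_all add: c_def flip: of_real_mult)
  define V where "V b x = (\<lambda>u. c * b (u @ [x]))" for b :: "'a qvec" and x
  have ipV: "ip (nlists n A) (V b x) (V b' y) = (if b = b' \<and> x = y then 1 else 0)"
    if "b \<in> B" "b' \<in> B" "x \<in> A" "y \<in> A" for b b' x y
  proof -
    have "ip (nlists n A) (V b x) (V b' y)
        = c * c * (\<Sum>u\<in>nlists n A. cnj (b (u @ [x])) * b' (u @ [y]))"
      by (simp add: ip_def V_def sum_distrib_left mult_ac c(2))
    also have "\<dots> = of_nat ?q * ip ?X b (op_apply A (Suc n) (last_unit A n x y) b')"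
      using that by (simp add: ip_last_unit A c(1))
    also have "ip ?X b (op_apply A (Suc n) (last_unit A n x y) b')
        = ((if x = y then 1 else 0) / of_nat ?q) * ip ?X b b'"
    proof (rule ip_op_mult)
      show "op_adjoint P = P" using P by (simp add: orth_projector_def)
      show "op_mult A (Suc n) P (op_mult A (Suc n) (last_unit A n x y) P)
        = (\<lambda>v w. ((if x = y then 1 else 0) / of_nat (card A)) * P v w)"
        using last[of x y] that by simp
    qed (use that B fixQ in auto)
    also have "of_nat ?q * (((if x = y then 1 else 0) / of_nat ?q) * ip ?X b b')
        = (if b = b' \<and> x = y then 1 else 0)"
      using that B q by (auto simp: orthonormal_def)
    finally show ?thesis .
  qed
  \<comment> \<open>The words u 0...0 x are the sender's parts of the input words. The column of U
    at such a word has to be the normalised slice at x of the basis vector belonging to u.\<close>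
  define J where "J = (\<lambda>(u, x). u @ replicate (n - k - 1) 0 @ [x]) ` (nlists k A \<times> A)"
  define f where "f w = V (\<beta> (take k w)) (w ! (n - 1))" for w
  have f: "f (u @ replicate (n - k - 1) 0 @ [x]) = V (\<beta> u) x" if "u \<in> nlists k A" for u x
  proof -
    have "\<not> n - Suc 0 < k" using kn by linarith
    thus ?thesis using that kn by (simp add: f_def nlists_iff_nth nth_append)
  qed
  have \<beta>B: "\<beta> u \<in> B" if "u \<in> nlists k A" for u using \<beta> that by (auto simp: bij_betw_def)
  have \<beta>inj: "\<beta> u = \<beta> u' \<longleftrightarrow> u = u'" if "u \<in> nlists k A" "u' \<in> nlists k A" for u u'
    using \<beta> that by (auto simp: bij_betw_def inj_on_def)
  have J: "J \<subseteq> nlists n A"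
  proof
    fix w assume "w \<in> J"
    then obtain u x where w: "w = u @ replicate (n - k - 1) 0 @ [x]" "u \<in> nlists k A" "x \<in> A"
      by (auto simp: J_def)
    thus "w \<in> nlists n A" using A kn by (auto simp: nlists_def)
  qed
  have ipf: "ip (nlists n A) (f w) (f w') = (if w = w' then 1 else 0)" if ww: "w \<in> J" "w' \<in> J" for w w'
  proof -
    obtain u x u' x' where w: "w = u @ replicate (n - k - 1) 0 @ [x]" "u \<in> nlists k A" "x \<in> A"
      "w' = u' @ replicate (n - k - 1) 0 @ [x']" "u' \<in> nlists k A" "x' \<in> A"
      using ww by (auto simp: J_def)
    have "length u = length u'" using w by (simp add: nlists_iff_nth)
    hence "w = w' \<longleftrightarrow> u = u' \<and> x = x'" using w by simp
    moreover have "f w = V (\<beta> u) x" "f w' = V (\<beta> u') x'"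
      unfolding w(1,4) by (rule f, fact)+
    ultimately show ?thesis using w(2,3,5,6) by (simp add: ipV \<beta>B \<beta>inj)
  qed
  have injf: "inj_on f J"
    by (rule inj_onI) (metis ipf zero_neq_one)
  have ortho: "orthonormal (nlists n A) (f ` J)"
    unfolding orthonormal_def
  proof (intro conjI ballI)
    show "finite (f ` J)" using J A finite_nlists finite_subset by blast
    fix u v assume "u \<in> f ` J" "v \<in> f ` J"
    then obtain w w' where "w \<in> J" "w' \<in> J" "u = f w" "v = f w'" by blast
    thus "ip (nlists n A) u v = (if u = v then 1 else 0)"
      using ipf injf by (simp add: inj_on_eq_iff)
  qed
  have supp: "v w = 0" if vJ: "v \<in> f ` J" and w: "w \<notin> nlists n A" for v w
  proof -
    obtain u x where v: "v = V (\<beta> u) x" and u: "u \<in> nlists k A"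
      using vJ f by (force simp: J_def)
    have "\<beta> u \<in> qspace A (Suc n)" using \<beta>B[OF u] B Qq by blast
    thus ?thesis using w by (simp add: v V_def qspace_def snoc_in_nlists)
  qed
  \<comment> \<open>Columns outside J meet no input word, so any orthonormal completion will
    do.\<close>
  obtain B' where B': "orthonormal (nlists n A) B'" "f ` J \<subseteq> B'" "card B' = card (nlists n A)"
    and compl: "\<And>x y. x \<in> nlists n A \<Longrightarrow> y \<in> nlists n A \<Longrightarrow>
      (\<Sum>b\<in>B'. b y * cnj (b x)) = (if y = x then 1 else 0)"
    by (rule orthonormal_basis_full[OF finite_nlists[OF A(1), of n] ortho])
      (rule supp, assumption+, blast)
  have finB': "finite B'" using B' by (simp add: orthonormal_def)
  obtain h where h: "bij_betw h (nlists n A) B'" "\<And>w. w \<in> J \<Longrightarrow> h w = f w"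
    using bij_betw_extend[OF finite_nlists[OF A(1), of n] finB' B'(3)[symmetric] J injf B'(2)] by blast
  have hB: "h w \<in> B'" if "w \<in> nlists n A" for w using h that by (auto simp: bij_betw_def)
  define U where "U = (\<lambda>v w. if v \<in> nlists n A \<and> w \<in> nlists n A then h w v else 0)"
  have unitary: "unitary_op A n U"
    unfolding unitary_op_def
  proof (intro conjI ext)
    show "U \<in> qops A n" by (auto simp: U_def qops_def)
    fix v w
    show "op_mult A n (op_adjoint U) U v w = op_id A n v w"
    proof (cases "v \<in> nlists n A \<and> w \<in> nlists n A")
      case True
      hence "op_mult A n (op_adjoint U) U v w = ip (nlists n A) (h v) (h w)"
        by (simp add: op_mult_def op_adjoint_def U_def ip_def)
      also have "\<dots> = (if h v = h w then 1 else 0)"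
        using B'(1) hB True by (simp add: orthonormal_def)
      also have "h v = h w \<longleftrightarrow> v = w"
        using h(1) True by (auto simp: bij_betw_def inj_on_def)
      finally show ?thesis using True by (simp add: op_id_def)
    next
      case False
      thus ?thesis by (auto simp: op_mult_def op_adjoint_def U_def op_id_def)
    qed
    show "op_mult A n U (op_adjoint U) v w = op_id A n v w"
    proof (cases "v \<in> nlists n A \<and> w \<in> nlists n A")
      case True
      hence "op_mult A n U (op_adjoint U) v w = (\<Sum>u\<in>nlists n A. h u v * cnj (h u w))"
        by (simp add: op_mult_def op_adjoint_def U_def)
      also have "\<dots> = (\<Sum>b\<in>B'. b v * cnj (b w))"
        by (rule sum.reindex_bij_betw[OF h(1)])
      finally show ?thesis using True compl by (simp add: op_id_def)
    next
      case False
      thus ?thesis by (auto simp: op_mult_def op_adjoint_def U_def op_id_def)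
    qed
  qed
  have enc: "op_apply A (n + 1) (tensor_op n U (op_id A 1)) (eaqecc_input A n k 1 \<psi>)
      = (\<lambda>w. \<Sum>u\<in>nlists k A. \<psi> u * \<beta> u w)" for \<psi>
  proof
    fix w
    let ?T = "tensor_op n U (op_id A 1)" and ?in = "eaqecc_input A n k 1 \<psi>"
    show "op_apply A (n + 1) ?T ?in w = (\<Sum>u\<in>nlists k A. \<psi> u * \<beta> u w)"
    proof (cases "w \<in> ?X")
      case False
      have "?T w v = 0" for v
      proof (rule ccontr)
        assume "?T w v \<noteq> 0"
        hence "take n w \<in> nlists n A" "drop n w \<in> nlists 1 A"
          by (auto simp: tensor_op_def U_def op_id_def split: if_splits)
        hence "take n w @ drop n w \<in> nlists (n + 1) A" by (rule append_in_nlists)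
        thus False using False by simp
      qed
      moreover have "\<beta> u w = 0" if "u \<in> nlists k A" for u
        using \<beta>B[OF that] B(2) Qq False by (auto simp: qspace_def)
      ultimately show ?thesis by (simp add: op_apply_def)
    next
      case True
      define x where "x = w ! n"
      define w' where "w' = take n w"
      have len: "length w = Suc n" using True by (simp add: nlists_iff_nth)
      have w: "w = w' @ [x]" using len by (simp add: w'_def x_def take_Suc_conv_app_nth[symmetric])
      have w': "w' \<in> nlists n A" and x: "x \<in> A" using True unfolding w snoc_in_nlists by auto
      \<comment> \<open>U leaves the receiver's symbol x of w alone, and the pair repeats it on the
        sender's side: only these input words reach w.\<close>
      define g where "g u = u @ replicate (n - k - 1) 0 @ [x, x]" for u
      have g_in: "g u \<in> ?X" if "u \<in> nlists k A" for u
        using that A x kn by (auto simp: g_def nlists_def)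
      have "op_apply A (n + 1) ?T ?in w = (\<Sum>v\<in>g ` nlists k A. ?T w v * ?in v)"
        unfolding op_apply_def
      proof (rule sum.mono_neutral_right)
        show "finite (nlists (n + 1) A)" by (rule finite_nlists) fact
        show "g ` nlists k A \<subseteq> nlists (n + 1) A" using g_in by auto
        show "\<forall>v\<in>nlists (n + 1) A - g ` nlists k A. ?T w v * ?in v = 0"
        proof (intro ballI, rule ccontr)
          fix v assume v: "v \<in> nlists (n + 1) A - g ` nlists k A" and nz: "?T w v * ?in v \<noteq> 0"
          have v_in: "v \<in> nlists (Suc n) A" using v by simp
          have "op_id A 1 (drop n w) (drop n v) \<noteq> 0" using nz by (auto simp: tensor_op_def)
          hence drop: "drop n v = drop n w" by (auto simp: op_id_def split: if_splits)
          have "?in v \<noteq> 0" using nz by simp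
          then obtain u y where u: "v = u @ replicate (n - k - 1) 0 @ [y, y]" "length u = k"
            using eaqecc_input_one[OF A(1) v_in kn] by (metis (no_types, lifting))
          have "drop n v = [y]" using u kn by simp
          hence "y = x" using drop w w' by (simp add: nlists_iff_nth)
          moreover have "u \<in> nlists k A" using v_in u by (auto simp: nlists_def)
          ultimately show False using v u by (auto simp: g_def)
        qed
      qed
      also have "\<dots> = (\<Sum>u\<in>nlists k A. ?T w (g u) * ?in (g u))"
        by (subst sum.reindex) (auto simp: inj_on_def g_def)
      also have "\<dots> = (\<Sum>u\<in>nlists k A. \<psi> u * \<beta> u w)"
      proof (rule sum.cong[OF refl])
        fix u assume u: "u \<in> nlists k A"
        have lu: "length u = k" using u by (simp add: nlists_iff_nth)
        have inp: "?in (g u) = \<psi> u * of_real (1 / sqrt ?q)"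
          using lu unfolding eaqecc_input_one[OF A(1) g_in[OF u] kn] by (auto simp: g_def)
        let ?j = "u @ replicate (n - k - 1) 0 @ [x]"
        have j: "?j \<in> J" using u x by (auto simp: J_def)
        have "take n (g u) = ?j" "drop n (g u) = [x]" using lu kn by (simp_all add: g_def)
        moreover have "take n w = w'" "drop n w = [x]" using w w' by (simp_all add: nlists_iff_nth)
        ultimately have "?T w (g u) = U w' ?j"
          using x len by (simp add: tensor_op_def op_id_def nlists_def)
        also have "\<dots> = V (\<beta> u) x w'"
          using w' j J h(2)[OF j] f[OF u] by (auto simp: U_def)
        also have "\<dots> = c * \<beta> u w" by (simp add: V_def w)
        finally show "?T w (g u) * ?in (g u) = \<psi> u * \<beta> u w"
          unfolding inp using q by (simp add: c_def)
      qed
      finally show ?thesis .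
    qed
  qed
  have Q: "Q = {\<lambda>w. \<Sum>u\<in>nlists k A. \<psi> u * \<beta> u w | \<psi>. \<psi> \<in> qspace A k}"
  proof (intro equalityI subsetI)
    fix v assume v: "v \<in> Q"
    define \<psi> where "\<psi> u = (if u \<in> nlists k A then ip ?X (\<beta> u) v else 0)" for u
    have "v = (\<lambda>w. \<Sum>b\<in>B. ip ?X b v * b w)"
      using span[OF v] by (simp add: projects_onto_span_def)
    also have "\<dots> = (\<lambda>w. \<Sum>u\<in>nlists k A. \<psi> u * \<beta> u w)"
      by (simp add: sum.reindex_bij_betw[OF \<beta>, symmetric] \<psi>_def)
    finally have "v = (\<lambda>w. \<Sum>u\<in>nlists k A. \<psi> u * \<beta> u w)" .
    moreover have "\<psi> \<in> qspace A k" by (simp add: \<psi>_def qspace_def)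
    ultimately show "v \<in> {\<lambda>w. \<Sum>u\<in>nlists k A. \<psi> u * \<beta> u w | \<psi>. \<psi> \<in> qspace A k}" by blast
  next
    fix v assume "v \<in> {\<lambda>w. \<Sum>u\<in>nlists k A. \<psi> u * \<beta> u w | \<psi>. \<psi> \<in> qspace A k}"
    then obtain \<psi> where v: "v = (\<lambda>w. \<Sum>u\<in>nlists k A. \<psi> u * \<beta> u w)" by blast
    obtain u0 where "u0 \<in> nlists k A" using nlists_not_empty[of A k] A by blast
    hence b0: "\<beta> u0 \<in> Q" using \<beta>B B by blast
    have zero: "(\<lambda>_. 0) \<in> Q" using lin[OF b0 b0, of "-1"] by simp
    have "(\<lambda>w. \<Sum>u\<in>Z. \<psi> u * \<beta> u w) \<in> Q" if "Z \<subseteq> nlists k A" "finite Z" for Z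
      using that(2,1)
    proof (induction Z)
      case empty thus ?case using zero by simp
    next
      case (insert u Z)
      thus ?case using lin[of "\<lambda>w. \<Sum>u\<in>Z. \<psi> u * \<beta> u w" "\<beta> u" "\<psi> u"] \<beta>B[of u] B(2)
        by (auto simp: add.commute)
    qed
    thus "v \<in> Q" unfolding v using finite_nlists[OF A(1)] by blast
  qed
  show ?thesis
    unfolding is_eaqecc_def
  proof (intro conjI exI[of _ U])
    show "Q = {op_apply A (n + 1) (tensor_op n U (op_id A 1)) (eaqecc_input A n k 1 \<psi>)
        | \<psi>. \<psi> \<in> qspace A k}"
      unfolding enc by (rule Q)
  qed (use kn unitary in auto)
qed

section \<open>Parameters of a stabilizer code\<close>

lemma nths_conv_map: "nths xs I = map ((!) xs) (filter (\<lambda>i. i \<in> I) [0..<length xs])"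
proof -
  have "zip xs [0..<length xs] = map (\<lambda>i. (xs ! i, i)) [0..<length xs]"
    by (rule nth_equalityI) auto
  thus ?thesis by (simp add: nths_def filter_map o_def)
qed

lemma nths_cong:
  assumes "length xs = length ys" "\<And>i. i < length xs \<Longrightarrow> i \<in> I \<Longrightarrow> xs ! i = ys ! i"
  shows "nths xs I = nths ys I"
  using assms by (auto simp: nths_conv_map)

lemma take_wadd: "n \<le> length w \<Longrightarrow> take n (wadd c w) = wadd c (take n w)"
  by (rule nth_equalityI) auto

lemma wadd_inject:
  assumes "length v = length w"
  shows "wadd c v = wadd c w \<longleftrightarrow> v = w"
proof
  assume "wadd c v = wadd c w"
  hence "wadd (\<lambda>i. - c i) (wadd c v) = wadd (\<lambda>i. - c i) (wadd c w)" by simp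
  thus "v = w" by (simp add: wadd_wadd wadd_zero)
qed simp

lemma drop_snoc_nlists: "w \<in> nlists (Suc n) A \<Longrightarrow> drop n w = [w ! n]"
  by (metis Cons_nth_drop_Suc drop_all lessI nlists_iff_nth order_refl)

context stabilizer
begin

text \<open>This is the local averaging result for T = {n}. It says that the receiver's qudit is
  maximally mixed and uncorrelated with the encoded state.\<close>

lemma proj_last_unit_proj:
  assumes m: "m = Suc n" and xy: "x \<in> A" "y \<in> A"
    and surj: "\<And>x y. x \<in> A \<Longrightarrow> y \<in> A \<Longrightarrow> \<exists>g\<in>G. a g n = x \<and> b g n = y"
  shows "mul proj (mul (last_unit A n x y) proj)
    = (\<lambda>v w. ((if x = y then 1 else 0) / of_nat (card A)) * proj v w)"
proof -
  have cA: "card A > 0" using A add_subgroup_0[OF A(1)] by (auto simp: card_gt_0_iff)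
  have "mul proj (mul (last_unit A n x y) proj)
      = (\<lambda>v w. ((\<Sum>u\<in>X. last_unit A n x y u u) / of_nat (card X)) * proj v w)"
  proof (rule proj_local_proj[where T = "{n}"])
    fix v w i assume vw: "v \<in> X" "w \<in> X" "last_unit A n x y v w \<noteq> 0" and i: "i < m" "i \<notin> {n}"
    have "take n v = take n w" using vw by (auto simp: last_unit_def split: if_splits)
    hence "take n v ! i = take n w ! i" by simp
    thus "v ! i = w ! i" using i m by simp
  next
    fix v w c assume vw: "v \<in> X" "w \<in> X"
      and c: "\<And>i. i < m \<Longrightarrow> c i \<in> A" "\<And>i. i \<in> {n} \<Longrightarrow> c i = 0"
    have "length v = Suc n" "length w = Suc n" using vw m by (auto simp: nlists_iff_nth)
    thus "last_unit A n x y (wadd c v) (wadd c w) = last_unit A n x y v w"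
      using wadd_in_nlists[OF A(1) vw(1) c(1)] wadd_in_nlists[OF A(1) vw(2) c(1)] vw c(2) m
      by (simp add: last_unit_def take_wadd wadd_inject)
  next
    show "{n} \<subseteq> {..<m}" using m by simp
    show "\<exists>g\<in>G. \<forall>i\<in>{n}. a g i = x i \<and> b g i = y i"
      if "\<And>i. i \<in> {n} \<Longrightarrow> x i \<in> A \<and> y i \<in> A" for x y
      using surj[of "x n" "y n"] that by auto
  qed
  \<comment> \<open>The scalar is the normalised trace: q^n words on the diagonal if x = y, out of
    q^(n + 1).\<close>
  also have "(\<Sum>u\<in>X. last_unit A n x y u u) = (\<Sum>u\<in>nlists n A. if x = y then 1 else 0)"
    unfolding m sum_nlists_Suc
  proof (rule sum.cong[OF refl])
    fix u assume u: "u \<in> nlists n A"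
    hence "(\<Sum>z\<in>A. last_unit A n x y (u @ [z]) (u @ [z]))
        = (\<Sum>z\<in>A. if z = x then if x = y then 1 else 0 else 0)"
      by (intro sum.cong) (auto simp: last_unit_def snoc_in_nlists nth_append nlists_iff_nth)
    thus "(\<Sum>z\<in>A. last_unit A n x y (u @ [z]) (u @ [z])) = (if x = y then 1 else 0)"
      using xy A by simp
  qed
  also have "\<dots> / of_nat (card X) = (if x = y then 1 else 0) / of_nat (card A)"
    using cA by (simp add: m card_nlists A)
  finally show ?thesis .
qed

text \<open>The identity on the receiver's qudit makes the operator diagonal at position n as well,
  so on all m qudits it is still local on S.\<close>

lemma proj_sender_proj:
  assumes m: "m = Suc n" and E: "acts_only_on A n S E" and S: "S \<subseteq> {..<n}"
    and surj: "\<And>x y. (\<And>i. i \<in> S \<Longrightarrow> x i \<in> A \<and> y i \<in> A)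
           \<Longrightarrow> \<exists>g\<in>G. \<forall>i\<in>S. a g i = x i \<and> b g i = y i"
  shows "\<exists>\<mu>. mul proj (mul (tensor_op n E (op_id A 1)) proj) = (\<lambda>v w. \<mu> * proj v w)"
proof -
  define F where "F = tensor_op n E (op_id A 1)"
  obtain e where e: "\<And>v w. v \<in> nlists n A \<Longrightarrow> w \<in> nlists n A \<Longrightarrow>
      E v w = (if \<forall>i<n. i \<notin> S \<longrightarrow> v ! i = w ! i then e (nths v S) (nths w S) else 0)"
    using E by (auto simp: acts_only_on_def)
  have F_eq: "F v w = (if (\<forall>i<m. i \<notin> S \<longrightarrow> v ! i = w ! i)
      then e (nths (take n v) S) (nths (take n w) S) else 0)" if vw: "v \<in> X" "w \<in> X" for v w
  proof -
    have len: "length v = Suc n" "length w = Suc n" using vw m by (auto simp: nlists_iff_nth)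
    have t: "take n v \<in> nlists n A" "take n w \<in> nlists n A"
      using vw m by (auto simp: nlists_iff_nth)
    have "op_id A 1 (drop n v) (drop n w) = (if v ! n = w ! n then 1 else 0)"
      using vw by (simp add: m drop_snoc_nlists op_id_def) (simp add: nlists_iff_nth)
    moreover have "n \<notin> S" using S by auto
    ultimately show ?thesis
      using e[OF t] len m by (auto simp: F_def tensor_op_def less_Suc_eq)
  qed
  have "mul proj (mul F proj) = (\<lambda>v w. ((\<Sum>u\<in>X. F u u) / of_nat (card X)) * proj v w)"
  proof (rule proj_local_proj[where T = S])
    fix v w i assume "v \<in> X" "w \<in> X" "F v w \<noteq> 0" "i < m" "i \<notin> S"
    thus "v ! i = w ! i" by (simp add: F_eq split: if_splits)
  next
    fix v w c assume vw: "v \<in> X" "w \<in> X"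
      and c: "\<And>i. i < m \<Longrightarrow> c i \<in> A" "\<And>i. i \<in> S \<Longrightarrow> c i = 0"
    have len: "length v = m" "length w = m" using vw by (auto simp: nlists_iff_nth)
    have "nths (take n (wadd c v)) S = nths (take n v) S"
      "nths (take n (wadd c w)) S = nths (take n w) S"
      using len m c(2) by (auto intro!: nths_cong)
    moreover have "wadd c v \<in> X" "wadd c w \<in> X"
      by (rule wadd_in_nlists[OF A(1)]; fact)+
    ultimately show "F (wadd c v) (wadd c w) = F v w"
      using vw len by (auto simp: F_eq)
  next
    show "S \<subseteq> {..<m}" using S m by auto
  qed (rule surj)
  thus ?thesis unfolding F_def by blast
qed

text \<open>The surjectivity hypothesis serves twice: small S among the sender's positions give the
  distance, S = {n} gives the encoding. The cardinality condition says that the projector has rank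
  card A ^ k.\<close>

lemma eaqecc_params_one:
  assumes m: "m = Suc n" and k: "k + 1 \<le> n" "card A ^ m = card G * card A ^ k"
    and surj: "\<And>S x y. (S \<subseteq> {..<n} \<and> card S < \<delta>) \<or> S = {n} \<Longrightarrow>
      (\<And>i. i \<in> S \<Longrightarrow> x i \<in> A \<and> y i \<in> A) \<Longrightarrow> \<exists>g\<in>G. \<forall>i\<in>S. a g i = x i \<and> b g i = y i"
  shows "eaqecc_params A n k \<delta> 1"
proof -
  define Q where "Q = op_apply A m proj ` qspace A m"
  have P: "orth_projector A (n + 1) Q proj"
    using orth_projector_proj by (simp add: Q_def m)
  have "is_eaqecc A n k 1 Q"
  proof (rule is_eaqecc_one[OF A(2) add_subgroup_0[OF A(1)] k(1) P])
    have "of_nat (card X) = (of_nat (card G * card A ^ k) :: complex)"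
      using k(2) by (simp add: card_nlists A)
    thus "(\<Sum>w\<in>nlists (n + 1) A. proj w w) = of_nat (card A ^ k)"
      using trace_proj card_G by (simp add: m)
    fix x y assume xy: "x \<in> A" "y \<in> A"
    show "op_mult A (n + 1) proj (op_mult A (n + 1) (last_unit A n x y) proj)
        = (\<lambda>v w. (if x = y then 1 else 0) / of_nat (card A) * proj v w)"
      using proj_last_unit_proj[OF m xy] surj[of "{n}" "\<lambda>_. x" "\<lambda>_. y" for x y] m by simp
  qed
  moreover have "min_dist_ge A n 1 \<delta> Q"
    unfolding min_dist_ge_def
  proof (intro exI[of _ proj] conjI allI impI)
    show "orth_projector A (n + 1) Q proj" by (rule P)
    fix E S assume "S \<subseteq> {..<n} \<and> card S < \<delta> \<and> acts_only_on A n S E"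
    thus "\<exists>\<mu>. op_mult A (n + 1) proj (op_mult A (n + 1) (tensor_op n E (op_id A 1)) proj)
        = (\<lambda>v w. \<mu> * proj v w)"
      using proj_sender_proj[OF m, of S E] surj[of S] m by simp
  qed
  ultimately show ?thesis unfolding eaqecc_params_def by blast
qed

end

section \<open>Cyclotomic sets\<close>

lemma zn_mult_less: "N > 1 \<Longrightarrow> s < N \<Longrightarrow> zn_mult N k s < N"
  by (auto simp: zn_mult_def intro: less_le_trans[OF mod_less_divisor])

lemma zn_mult_eq_0_iff: "N > 1 \<Longrightarrow> zn_mult N k s = 0 \<longleftrightarrow> s = 0"
  by (auto simp: zn_mult_def)

lemma zn_mult_mod: "zn_mult N k s mod (N - 1) = k * s mod (N - 1)"
  by (auto simp: zn_mult_def)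

text \<open>Modulo N - 1 the only collision in {0, ..., N - 1} is between 0 and N - 1, which the
  zero test resolves.\<close>

lemma zn_eqI:
  assumes "u < N" "v < N" "u = 0 \<longleftrightarrow> v = 0" "u mod (N - 1) = v mod (N - 1)"
  shows "u = (v :: nat)"
proof -
  have "w = (if w = 0 then 0 else if w mod (N - 1) = 0 then N - 1 else w mod (N - 1))"
    if "w < N" for w
    using that by (cases "w = N - 1") auto
  thus ?thesis using assms by metis
qed

lemma zn_mult_zn_mult:
  assumes "N > 1" "s < N"
  shows "zn_mult N k (zn_mult N k' s) = zn_mult N (k * k') s"
proof (rule zn_eqI[where N = N])
  show "zn_mult N k (zn_mult N k' s) mod (N - 1) = zn_mult N (k * k') s mod (N - 1)"
    unfolding zn_mult_mod by (metis mod_mult_right_eq mult.assoc zn_mult_mod)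
qed (use assms in \<open>auto simp: zn_mult_less zn_mult_eq_0_iff\<close>)

lemma zn_mult_cong_1:
  assumes "N > 1" "s < N" "k mod (N - 1) = 1 mod (N - 1)"
  shows "zn_mult N k s = s"
proof (rule zn_eqI[where N = N])
  show "zn_mult N k s mod (N - 1) = s mod (N - 1)"
    unfolding zn_mult_mod using assms(3) by (metis mod_mult_left_eq mult_1)
qed (use assms in \<open>auto simp: zn_mult_less zn_mult_eq_0_iff\<close>)

text \<open>Exponents 0 and N - 1 agree on the nonzero points but differ at y = 0; this is why the
  action keeps them apart.\<close>

lemma power_zn_mult:
  fixes y :: "'f :: finite_field"
  assumes "y \<in> Y N" "N > 1" "s < N" "k > 0"
  shows "y ^ zn_mult N k s = y ^ (k * s)"
proof (cases "y = 0")
  case True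
  thus ?thesis using assms by (simp add: power_0_left zn_mult_eq_0_iff)
next
  case False
  have "y ^ (N - 1) * y = 1 * y"
    using assms by (simp add: Y_def flip: power_Suc2)
  hence y1: "y ^ (N - 1) = 1" using False by simp
  have "y ^ i = y ^ (i mod (N - 1))" for i
  proof -
    have "y ^ i = y ^ ((N - 1) * (i div (N - 1)) + i mod (N - 1))" by simp
    also have "\<dots> = y ^ (i mod (N - 1))" unfolding power_add power_mult y1 by simp
    finally show ?thesis .
  qed
  thus ?thesis by (metis zn_mult_mod)
qed

section \<open>Orbits of multiplication by q^2; the l-th iterate is the identity\<close>

locale cyclotomic =
  fixes q l N :: nat
  assumes q: "q > 1" and l: "l > 0" and N: "N > 1" and N_dvd: "(N - 1) dvd (q ^ (2 * l) - 1)"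
begin

definition sh :: "nat \<Rightarrow> nat \<Rightarrow> nat" where
  "sh j s = zn_mult N (q ^ (2 * j)) s"

lemma sh_less: "s < N \<Longrightarrow> sh j s < N"
  unfolding sh_def by (rule zn_mult_less[OF N])

lemma sh_add: "s < N \<Longrightarrow> sh (i + j) s = sh i (sh j s)"
  unfolding sh_def by (subst zn_mult_zn_mult[OF N]) (simp_all add: distrib_left power_add)

lemma sh_0: "s < N \<Longrightarrow> sh 0 s = s"
  unfolding sh_def by (rule zn_mult_cong_1[OF N]) auto

lemma sh_l: "s < N \<Longrightarrow> sh l s = s"
  unfolding sh_def
proof (rule zn_mult_cong_1[OF N])
  have "1 \<le> q ^ (2 * l)" using q by simp
  thus "q ^ (2 * l) mod (N - 1) = 1 mod (N - 1)"
    using N_dvd by (metis mod_eq_dvd_iff_nat)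
qed

lemma sh_mult: "s < N \<Longrightarrow> sh d s = s \<Longrightarrow> sh (d * k) s = s"
  by (induction k) (simp_all add: sh_0 sh_add)

lemma sh_mod: "s < N \<Longrightarrow> sh d s = s \<Longrightarrow> sh (j mod d) s = sh j s"
  using sh_add[of s "j mod d" "d * (j div d)"] sh_mult[of s d "j div d"] by simp

lemma sh_inverse: "s < N \<Longrightarrow> j \<le> l \<Longrightarrow> sh (l - j) (sh j s) = s"
  using sh_add[of s "l - j" j] by (simp add: sh_l)

lemma sh_inverse': "s < N \<Longrightarrow> j \<le> l \<Longrightarrow> sh j (sh (l - j) s) = s"
  using sh_add[of s j "l - j"] by (simp add: sh_l)

lemma sh_inject: "s < N \<Longrightarrow> t < N \<Longrightarrow> sh j s = sh j t \<Longrightarrow> s = t"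
  using sh_mod[OF _ sh_l, of s j] sh_mod[OF _ sh_l, of t j] l
    sh_inverse[of s "j mod l"] sh_inverse[of t "j mod l"] by (metis mod_less_divisor less_imp_le)

lemma cyc_set_eq: "cyc_set q N s = range (\<lambda>j. sh j s)"
  by (auto simp: cyc_set_def sh_def)

lemma self_in_cyc_set: "s < N \<Longrightarrow> s \<in> cyc_set q N s"
  unfolding cyc_set_eq using sh_0[of s] by (metis rangeI)

lemma cyc_set_less: "s < N \<Longrightarrow> t \<in> cyc_set q N s \<Longrightarrow> t < N"
  by (auto simp: cyc_set_eq sh_less)

lemma finite_cyc_set: "s < N \<Longrightarrow> finite (cyc_set q N s)"
  by (rule finite_subset[of _ "{..<N}"]) (auto dest: cyc_set_less)

lemma sh_in_cyc_set: "s < N \<Longrightarrow> t \<in> cyc_set q N s \<Longrightarrow> sh j t \<in> cyc_set q N s"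
  by (auto simp: cyc_set_eq simp flip: sh_add)

lemma cyc_set_sym:
  assumes "s < N" "t \<in> cyc_set q N s"
  shows "cyc_set q N t = cyc_set q N s"
proof
  show "cyc_set q N t \<subseteq> cyc_set q N s"
    using sh_in_cyc_set[OF assms] by (auto simp: cyc_set_eq[of t])
  obtain j where t: "t = sh (j mod l) s" 
    using assms sh_mod[OF assms(1) sh_l[OF assms(1)]] by (auto simp: cyc_set_eq)
  have "s = sh (l - j mod l) t"
    unfolding t using sh_inverse[OF assms(1), of "j mod l"] l by (simp add: less_imp_le)
  hence "s \<in> cyc_set q N t" by (auto simp: cyc_set_eq)
  thus "cyc_set q N s \<subseteq> cyc_set q N t"
    using sh_in_cyc_set[of t] cyc_set_less[OF assms] by (auto simp: cyc_set_eq[of s])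
qed

text \<open>The orbit size is the least period of s under \<open>sh 1\<close>, hence divides the
  period l.\<close>

lemma cyc_set_period:
  assumes s: "s < N"
  defines "n \<equiv> card (cyc_set q N s)"
  shows "n > 0" "n dvd l" "sh n s = s" "inj_on (\<lambda>j. sh j s) {..<n}"
    "cyc_set q N s = (\<lambda>j. sh j s) ` {..<n}"
proof -
  define d where "d = (LEAST d. d > 0 \<and> sh d s = s)"
  have d: "d > 0 \<and> sh d s = s"
    unfolding d_def by (rule LeastI[of _ l]) (use l sh_l[OF s] in auto)
  have least: "d \<le> k" if "k > 0" "sh k s = s" for k
    unfolding d_def by (rule Least_le) (use that in auto)
  have inj: "inj_on (\<lambda>j. sh j s) {..<d}"
  proof (rule linorder_inj_onI')
    fix i j assume ij: "i \<in> {..<d}" "j \<in> {..<d}" "i < j"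
    show "sh i s \<noteq> sh j s"
    proof
      assume "sh i s = sh j s"
      hence "sh i s = sh i (sh (j - i) s)" using ij sh_add[OF s, of i "j - i"] by simp
      hence "sh (j - i) s = s" using sh_inject s sh_less by metis
      thus False using least[of "j - i"] ij by simp
    qed
  qed
  have img: "cyc_set q N s = (\<lambda>j. sh j s) ` {..<d}"
  proof
    have "sh j s \<in> (\<lambda>j. sh j s) ` {..<d}" for j
      using sh_mod[OF s, of d j] d by (intro image_eqI[of _ _ "j mod d"]) auto
    thus "cyc_set q N s \<subseteq> (\<lambda>j. sh j s) ` {..<d}" by (auto simp: cyc_set_eq)
  qed (auto simp: cyc_set_eq)
  have n: "n = d" unfolding n_def img using card_image[OF inj] by simp
  have "sh (l mod d) s = s" using sh_mod[OF s, of d l] d sh_l[OF s] by simp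
  hence "l mod d = 0" using least[of "l mod d"] d by (metis mod_less_divisor not_less gr0I)
  thus "n > 0" "n dvd l" "sh n s = s" "inj_on (\<lambda>j. sh j s) {..<n}"
    "cyc_set q N s = (\<lambda>j. sh j s) ` {..<n}"
    unfolding n using d inj img by auto
qed

lemma min_rep:
  assumes "r \<in> min_reps q N"
  shows "r < N" "r = Min (cyc_set q N r)"
proof -
  obtain s where s: "s < N" "r = Min (cyc_set q N s)"
    using assms by (auto simp: min_reps_def)
  hence r: "r \<in> cyc_set q N s"
    using finite_cyc_set self_in_cyc_set by (metis Min_in empty_iff)
  show "r < N" using s r cyc_set_less by blast
  show "r = Min (cyc_set q N r)" using s cyc_set_sym[OF s(1) r] by simp
qed

lemma min_rep_exists:
  assumes s: "s < N"
  obtains r where "r \<in> min_reps q N" "r \<le> s" "s \<in> cyc_set q N r"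
proof
  let ?r = "Min (cyc_set q N s)"
  have f: "finite (cyc_set q N s)" and ne: "s \<in> cyc_set q N s"
    using s by (simp_all add: finite_cyc_set self_in_cyc_set)
  show "?r \<in> min_reps q N" using s by (auto simp: min_reps_def)
  show "?r \<le> s" using f ne by simp
  have "?r \<in> cyc_set q N s" using f ne by (metis Min_in empty_iff)
  thus "s \<in> cyc_set q N ?r" using cyc_set_sym[OF s] ne by blast
qed

lemma bij_betw_sh:
  assumes "Z \<subseteq> {..<N}" "\<And>s j. s \<in> Z \<Longrightarrow> sh j s \<in> Z" "j \<le> l"
  shows "bij_betw (sh j) Z Z"
  by (rule bij_betw_byWitness[where f' = "sh (l - j)"])
    (use assms in \<open>auto simp: sh_inverse sh_inverse' subset_iff\<close>)

end

section \<open>Finite fields\<close>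

text \<open>
  For a field of \<open>Q\<close> elements, the power map with exponent \<open>d = (Q - 1) / M\<close> sends the nonzero
  elements into these roots, with fibres of size at most \<open>d\<close>.
\<close>

lemma card_roots_of_unity:
  assumes M: "M > 0" "M dvd (card (UNIV :: 'f :: finite_field set) - 1)"
  shows "card {x :: 'f. x ^ M = 1} = M"
proof -
  let ?Q = "card (UNIV :: 'f set)"
  have bound: "card {x :: 'f. x ^ n = c} \<le> n" if "n > 0" for n c
  proof -
    define p where "p = monom 1 n - [:c:]"
    have "coeff p n = 1" using that by (simp add: p_def coeff_pCons split: nat.splits)
    hence "p \<noteq> 0" by auto
    have "card {x. poly p x = 0} \<le> degree p" by (rule card_poly_roots_bound) fact
    also have "degree p \<le> n"
      unfolding p_def by (rule degree_diff_le) (auto simp: degree_monom_le)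
    finally show ?thesis by (simp add: p_def poly_monom)
  qed
  have "card {0, 1 :: 'f} \<le> ?Q" by (rule card_mono) auto
  hence Q: "?Q > 1" by simp
  obtain d where d: "?Q - 1 = M * d" using M(2) by blast
  have d0: "d > 0" using d Q by (intro gr0I) auto
  let ?F = "- {0} :: 'f set"
  have "x ^ d \<in> {x. x ^ M = 1}" if "x \<in> ?F" for x
  proof -
    have "x ^ (?Q - 1) * x = 1 * x"
      using finite_field_power_card_eq_same[of x] Q by (simp flip: power_Suc2)
    thus ?thesis using that d by (simp add: mult.commute flip: power_mult)
  qed
  hence sub: "?F \<subseteq> (\<Union>c\<in>{x. x ^ M = 1}. {x. x ^ d = c})" by blast
  have "M * d = card ?F" using d by (simp add: Compl_eq_Diff_UNIV)
  also have "\<dots> \<le> card (\<Union>c\<in>{x :: 'f. x ^ M = 1}. {x. x ^ d = c})"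
    by (rule card_mono[OF _ sub]) auto
  also have "\<dots> \<le> (\<Sum>c\<in>{x :: 'f. x ^ M = 1}. card {x :: 'f. x ^ d = c})"
    by (rule card_UN_le) auto
  also have "\<dots> \<le> (\<Sum>c\<in>{x :: 'f. x ^ M = 1}. d)"
    by (rule sum_mono) (use bound[OF d0] in auto)
  finally have "M \<le> card {x :: 'f. x ^ M = 1}" using d0 by simp
  thus ?thesis using bound[OF M(1), of 1] by simp
qed

text \<open>Used for r = q^d, the sizes of subfields, and for r = N, the number of evaluation
  points.\<close>

lemma card_power_fixed:
  assumes r: "r > 1" "(r - 1) dvd (card (UNIV :: 'f :: finite_field set) - 1)"
  shows "card {x :: 'f. x ^ r = x} = r"
proof -
  have "x ^ r = x \<longleftrightarrow> x = 0 \<or> x ^ (r - 1) = 1" for x :: 'f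
  proof -
    have "x ^ r = x ^ (r - 1) * x" using r by (simp flip: power_Suc2)
    thus ?thesis by auto
  qed
  hence "{x :: 'f. x ^ r = x} = insert 0 {x. x ^ (r - 1) = 1}" by auto
  moreover have "(0 :: 'f) ^ (r - 1) \<noteq> 1" using r by (simp add: power_0_left)
  ultimately show ?thesis
    using card_roots_of_unity[of "r - 1", where 'f = 'f] r by simp
qed

lemma power_minus_one_dvd: "(q ^ m - 1) dvd (q ^ (m * k) - 1 :: nat)"
proof (cases "q = 0")
  case False
  have "int (q ^ m) - 1 dvd int (q ^ m) ^ k - 1"
    using power_diff_1_eq[of "int (q ^ m)" k] by simp
  moreover have "int (q ^ m) - 1 = int (q ^ m - 1)" "int (q ^ m) ^ k - 1 = int (q ^ (m * k) - 1)"
    using False by (auto simp: of_nat_diff power_mult)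
  ultimately show ?thesis by (metis int_dvd_int_iff)
qed (cases "m * k = 0"; auto simp: power_0_left)

text \<open>The degree bound is put in terms of coefficients so that for empty Z it forces P =
  0.\<close>

lemma interpolation_exists:
  fixes v :: "'f :: field \<Rightarrow> 'f"
  assumes "finite Z"
  shows "\<exists>P. (\<forall>i\<ge>card Z. coeff P i = 0) \<and> (\<forall>z\<in>Z. poly P z = v z)"
  using assms
proof (induction Z)
  case empty
  show ?case by (intro exI[of _ 0]) auto
next
  case (insert z Z)
  then obtain P where P: "\<And>i. i \<ge> card Z \<Longrightarrow> coeff P i = 0" "\<And>z. z \<in> Z \<Longrightarrow> poly P z = v z" by blast
  define R where "R = (\<Prod>x\<in>Z. [:- x, 1:])"
  have R: "poly R x = (\<Prod>y\<in>Z. x - y)" for x by (simp add: R_def poly_prod)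
  have degR: "degree R \<le> card Z"
    using degree_prod_sum_le[OF insert.hyps(1), of "\<lambda>x. [:- x, 1:]"] by (simp add: R_def o_def)
  have Rz: "poly R z \<noteq> 0" using insert by (auto simp: R)
  define P' where "P' = P + smult ((v z - poly P z) / poly R z) R"
  have "coeff P' i = 0" if "i \<ge> card (insert z Z)" for i
    using that insert degR P(1)[of i] by (simp add: P'_def coeff_eq_0)
  moreover have "poly P' x = v x" if "x \<in> insert z Z" for x
    using that Rz insert by (auto simp: P'_def P R)
  ultimately show ?case by blast
qed

section \<open>Trace codes of cyclotomic sets\<close>

locale cyclotomic_field = cyclotomic q l N for q l N :: nat +
  fixes p e :: nat and field_type :: "'f :: finite_field itself"
  assumes p: "prime p" and q_def: "q = p ^ e"
    and card_UNIV: "card (UNIV :: 'f set) = q ^ (2 * l)"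
begin

lemma char_eq: "CHAR('f) = p"
proof -
  \<comment> \<open>Translation by 1 permutes the field, so the field size is 0 in the
    field.\<close>
  have "(\<Sum>x\<in>UNIV. x + 1 :: 'f) = (\<Sum>x\<in>UNIV. x)"
    by (rule sum.reindex_bij_witness[of _ "\<lambda>x. x - 1" "\<lambda>x. x + 1"]) auto
  hence "of_nat (p ^ (e * (2 * l))) = (0 :: 'f)"
    using card_UNIV by (simp add: sum.distrib q_def power_mult)
  hence "of_nat p = (0 :: 'f)" by simp
  hence "CHAR('f) dvd p" by (simp add: of_nat_eq_0_iff_char_dvd)
  thus ?thesis using p CHAR_prime[where 'a = 'f] primes_dvd_imp_eq by blast
qed

lemma frob_sum: "(\<Sum>x\<in>Z. f x :: 'f) ^ (q ^ j) = (\<Sum>x\<in>Z. f x ^ (q ^ j))"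
  by (rule freshmans_dream_sum'[of _ "e * j"]) (simp_all add: char_eq p q_def power_mult)

lemma frob_add: "(x + y :: 'f) ^ (q ^ j) = x ^ (q ^ j) + y ^ (q ^ j)"
  by (rule freshmans_dream'[of _ "e * j"]) (simp_all add: char_eq p q_def power_mult)

lemma frob_diff: "(x - y :: 'f) ^ (q ^ j) = x ^ (q ^ j) - y ^ (q ^ j)"
  using frob_add[of "x - y" y j] by (simp add: algebra_simps)

lemma frob_uminus: "(- y :: 'f) ^ (q ^ j) = - (y ^ (q ^ j))"
  using frob_diff[of 0 y j] q by (simp add: power_0_left)

lemma frob_l: "(x :: 'f) ^ (q ^ (2 * l)) = x"
  using finite_field_power_card_eq_same[of x] card_UNIV by simp

lemma frob_fixed: "(x :: 'f) ^ (q ^ d) = x \<Longrightarrow> x ^ (q ^ (d * k)) = x"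
  by (induction k) (simp_all add: power_add power_mult)

lemma frob_fixed_mod:
  assumes "(x :: 'f) ^ (q ^ d) = x"
  shows "x ^ (q ^ (j mod d)) = x ^ (q ^ j)"
proof -
  have "x ^ (q ^ j) = x ^ (q ^ (d * (j div d) + j mod d))" by simp
  also have "\<dots> = (x ^ (q ^ (d * (j div d)))) ^ (q ^ (j mod d))"
    by (simp only: power_add power_mult)
  finally show ?thesis using frob_fixed[OF assms] by simp
qed

lemma card_GF: "d > 0 \<Longrightarrow> d dvd 2 * l \<Longrightarrow> card (GF (q ^ d) :: 'f set) = q ^ d"
  unfolding GF_def
proof (rule card_power_fixed)
  assume d: "d > 0" "d dvd 2 * l"
  show "1 < q ^ d" using q d by (intro one_less_power)
  show "q ^ d - 1 dvd card (UNIV :: 'f set) - 1"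
    using power_minus_one_dvd[of q d] d(2) card_UNIV by (metis dvdE)
qed

lemma card_Y: "card (Y N :: 'f set) = N"
  unfolding Y_def by (rule card_power_fixed) (use N N_dvd card_UNIV in auto)

definition tr :: "'f \<Rightarrow> 'f" where
  "tr x = (\<Sum>j<l. x ^ (q ^ (2 * j)))"

lemma tr_scale:
  assumes "c ^ (q ^ 2) = (c :: 'f)"
  shows "tr (c * x) = c * tr x"
  unfolding tr_def sum_distrib_left
  using frob_fixed[of c 2] assms by (simp add: power_mult_distrib)

lemma tr_rational: "tr x ^ (q ^ 2) = tr x"
proof -
  have "tr x ^ (q ^ 2) = (\<Sum>j<l. x ^ (q ^ (2 * Suc j)))"
    unfolding tr_def frob_sum by (simp add: mult.commute flip: power_mult power_add)
  also have "\<dots> = (\<Sum>j<l. x ^ (q ^ (2 * j)))"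
    using sum.lessThan_Suc_shift[of "\<lambda>j. x ^ (q ^ (2 * j))" l] frob_l[of x] by simp
  finally show ?thesis unfolding tr_def .
qed

text \<open>As a polynomial the trace has degree at most q^(2 (l - 1)), less than the field size, so
  it is not identically zero; rescaling by an element of the small field gives the value 1.\<close>

lemma tr_one_exists:
  obtains \<alpha> :: 'f where "tr \<alpha> = 1"
proof -
  define P :: "'f poly" where "P = (\<Sum>j<l. monom 1 (q ^ (2 * j)))"
  have "coeff P 1 = (\<Sum>j<l. if j = 0 then 1 else 0)"
    unfolding P_def coeff_sum using q by (intro sum.cong) auto
  hence "coeff P 1 = 1" using l by simp
  hence "P \<noteq> 0" by auto
  have "degree P \<le> q ^ (2 * (l - 1))"
    unfolding P_def using q l
    by (intro degree_sum_le) (auto simp: degree_monom_eq intro!: power_increasing)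
  also have "\<dots> < q ^ (2 * l)" using q l by (intro power_strict_increasing) auto
  finally have "card {x. poly P x = 0} < card (UNIV :: 'f set)"
    using card_poly_roots_bound[OF \<open>P \<noteq> 0\<close>] card_UNIV by simp
  then obtain x where "poly P x \<noteq> 0" by (metis (mono_tags, lifting) UNIV_eq_I less_irrefl mem_Collect_eq)
  hence x: "tr x \<noteq> 0" by (simp add: P_def tr_def poly_sum poly_monom)
  have "(1 / tr x) ^ (q ^ 2) = 1 / tr x" by (simp add: power_divide tr_rational)
  from tr_scale[OF this, of x] have "tr (1 / tr x * x) = 1" using x by simp
  thus ?thesis by (rule that)
qed

text \<open>Coefficient functions allow the same f to be summed over fewer exponents: the value at
  infinity is \<open>ev W f 1\<close> with W the orbit of \<open>a t\<close>.\<close>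

definition ev :: "nat set \<Rightarrow> (nat \<Rightarrow> 'f) \<Rightarrow> 'f \<Rightarrow> 'f" where
  "ev Z f y = (\<Sum>s\<in>Z. f s * y ^ s)"

lemma ev_eq_0:
  assumes Z: "Z \<subseteq> {..<N}" and f: "\<And>y. y \<in> Y N \<Longrightarrow> ev Z f y = 0" and s: "s \<in> Z"
  shows "f s = 0"
proof -
  have fin: "finite Z" using Z finite_subset by blast
  define P where "P = (\<Sum>s\<in>Z. monom (f s) s)"
  have P: "poly P y = ev Z f y" for y by (simp add: P_def ev_def poly_sum poly_monom)
  have "P = 0"
  proof (rule ccontr)
    assume "P \<noteq> 0"
    have "card (Y N :: 'f set) \<le> card {y. poly P y = 0}"
      by (rule card_mono) (use f P in auto)
    also have "\<dots> \<le> degree P" by (rule card_poly_roots_bound) fact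
    also have "degree P \<le> N - 1"
      unfolding P_def
    proof (rule degree_sum_le[OF fin])
      fix t assume "t \<in> Z"
      hence "t < N" using Z by auto
      thus "degree (monom (f t) t) \<le> N - 1" using degree_monom_le[of "f t" t] by linarith
    qed
    finally show False using card_Y N by simp
  qed
  hence "0 = coeff P s" by simp
  also have "\<dots> = (\<Sum>t\<in>Z. if t = s then f s else 0)"
    unfolding P_def coeff_sum by (intro sum.cong) auto
  finally show ?thesis using s fin by simp
qed

lemma power_sh: "y \<in> Y N \<Longrightarrow> s < N \<Longrightarrow> (y ^ s) ^ (q ^ (2 * j)) = (y :: 'f) ^ sh j s"
  using power_zn_mult[of y N s "q ^ (2 * j)"] N q by (simp add: sh_def mult.commute flip: power_mult)

definition cyc_closed :: "nat set \<Rightarrow> bool" where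
  "cyc_closed Z \<longleftrightarrow> Z \<subseteq> {..<N} \<and> (\<forall>s\<in>Z. \<forall>j. sh j s \<in> Z)"

lemma cyc_closed_less: "cyc_closed Z \<Longrightarrow> s \<in> Z \<Longrightarrow> s < N"
  and cyc_closed_sh: "cyc_closed Z \<Longrightarrow> s \<in> Z \<Longrightarrow> sh j s \<in> Z"
  by (auto simp: cyc_closed_def)

lemma bij_betw_sh_cyc_closed: "cyc_closed Z \<Longrightarrow> j \<le> l \<Longrightarrow> bij_betw (sh j) Z Z"
  by (rule bij_betw_sh) (auto simp: cyc_closed_def)

text \<open>The coefficient functions of the polynomials with values in the field with \<open>q\<^sup>2\<close> elements.\<close>

definition rational :: "nat set \<Rightarrow> (nat \<Rightarrow> 'f) set" where
  "rational Z = {f. (\<forall>s. s \<notin> Z \<longrightarrow> f s = 0) \<and> (\<forall>s\<in>Z. f (sh 1 s) = f s ^ (q ^ 2))}"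

lemma rational_sh:
  assumes "f \<in> rational Z" "cyc_closed Z" "s \<in> Z"
  shows "f (sh j s) = f s ^ (q ^ (2 * j))"
proof (induction j)
  case 0 show ?case using cyc_closed_less[OF assms(2,3)] by (simp add: sh_0)
next
  case (Suc j)
  have "sh (Suc j) s = sh 1 (sh j s)" using sh_add[of s 1 j] cyc_closed_less[OF assms(2,3)] by simp
  hence "f (sh (Suc j) s) = f (sh j s) ^ (q ^ 2)"
    using assms cyc_closed_sh[OF assms(2,3)] by (simp add: rational_def)
  thus ?case unfolding Suc by (simp add: mult.commute flip: power_mult power_add)
qed

lemma add_subgroup_rational: "add_subgroup (rational Z)"
  using q by (auto simp: add_subgroup_def rational_def frob_diff power_0_left)

text \<open>The q^2-power map permutes the terms of the sum along \<open>sh 1\<close>. The case W =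
  Z is for affine points, W an orbit for infinity.\<close>

lemma ev_rational:
  assumes f: "f \<in> rational Z" and Z: "cyc_closed Z" and W: "cyc_closed W" "W \<subseteq> Z" and y: "y \<in> Y N"
  shows "ev W f y ^ (q ^ 2) = ev W f y"
proof -
  have "ev W f y ^ (q ^ 2) = (\<Sum>s\<in>W. f (sh 1 s) * y ^ sh 1 s)"
    unfolding ev_def frob_sum
  proof (rule sum.cong[OF refl])
    fix s assume s: "s \<in> W"
    show "(f s * y ^ s) ^ (q ^ 2) = f (sh 1 s) * y ^ sh 1 s"
      using rational_sh[OF f Z, of s 1] power_sh[OF y, of s 1] cyc_closed_less[OF W(1) s] s W(2)
      by (simp add: power_mult_distrib subset_iff)
  qed
  also have "\<dots> = ev W f y"
    unfolding ev_def using l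
    by (intro sum.reindex_bij_betw[OF bij_betw_sh_cyc_closed[OF W(1)], of 1 "\<lambda>s. f s * y ^ s"]) auto
  finally show ?thesis .
qed

text \<open>f is the coefficient function of the trace of h after reducing exponents on the points
  of \<open>Y N\<close>; as \<open>sh (l - j)\<close> inverts \<open>sh j\<close>, the j-th
  conjugate contributes h (sh (l - j) s) ^ (q ^ (2 * j)) at s. One f serves all closed W, so affine
  values and the value at infinity are controlled together.\<close>

lemma rational_trace:
  assumes Z: "cyc_closed Z"
  obtains f where "f \<in> rational Z"
    "\<And>W y. cyc_closed W \<Longrightarrow> W \<subseteq> Z \<Longrightarrow> y \<in> Y N \<Longrightarrow> ev W f y = tr (ev W h y)"
proof
  define f where "f s = (if s \<in> Z then \<Sum>j<l. h (sh (l - j) s) ^ (q ^ (2 * j)) else 0)" for s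
  show "f \<in> rational Z"
    unfolding rational_def mem_Collect_eq
  proof (intro conjI allI impI ballI)
    show "f s = 0" if "s \<notin> Z" for s using that by (simp add: f_def)
    fix s assume s: "s \<in> Z"
    have sN: "s < N" using cyc_closed_less[OF Z s] .
    define T where "T j = h (sh (l - j) (sh 1 s)) ^ (q ^ (2 * j))" for j
    have "f s ^ (q ^ 2) = (\<Sum>j<l. h (sh (l - j) s) ^ (q ^ (2 * j))) ^ (q ^ 2)"
      using s by (simp add: f_def)
    also have "\<dots> = (\<Sum>j<l. T (Suc j))"
      unfolding frob_sum
    proof (rule sum.cong[OF refl])
      fix j assume j: "j \<in> {..<l}"
      have "sh (l - Suc j) (sh 1 s) = sh (l - j) s"
        using sh_add[OF sN, of "l - Suc j" 1] j by (simp add: Suc_diff_Suc)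
      thus "(h (sh (l - j) s) ^ q ^ (2 * j)) ^ q\<^sup>2 = T (Suc j)"
        by (simp add: T_def mult.commute flip: power_mult power_add)
    qed
    also have "\<dots> = (\<Sum>j<l. T j)"
    proof -
      have "T l = T 0"
        using sh_l[of "sh 1 s"] sh_0[of "sh 1 s"] sh_less[OF sN] by (simp add: T_def frob_l)
      thus ?thesis using sum.lessThan_Suc_shift[of T l] by simp
    qed
    also have "\<dots> = f (sh 1 s)" using cyc_closed_sh[OF Z s] by (simp add: f_def T_def)
    finally show "f (sh 1 s) = f s ^ (q ^ 2)" ..
  qed
  fix W and y :: 'f assume W: "cyc_closed W" "W \<subseteq> Z" and y: "y \<in> Y N"
  have "ev W f y = (\<Sum>s\<in>W. \<Sum>j<l. h (sh (l - j) s) ^ (q ^ (2 * j)) * y ^ s)"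
    using W(2) by (simp add: ev_def f_def sum_distrib_right subset_iff)
  also have "\<dots> = (\<Sum>j<l. \<Sum>s\<in>W. h (sh (l - j) s) ^ (q ^ (2 * j)) * y ^ s)"
    by (rule sum.swap)
  also have "\<dots> = (\<Sum>j<l. \<Sum>s\<in>W. (h s * y ^ s) ^ (q ^ (2 * j)))"
  proof (rule sum.cong[OF refl])
    fix j assume "j \<in> {..<l}"
    hence j: "j \<le> l" by simp
    have "(\<Sum>s\<in>W. h (sh (l - j) s) ^ (q ^ (2 * j)) * y ^ s)
        = (\<Sum>s\<in>W. h (sh (l - j) (sh j s)) ^ (q ^ (2 * j)) * y ^ sh j s)"
      by (rule sum.reindex_bij_betw[OF bij_betw_sh_cyc_closed[OF W(1) j], symmetric])
    also have "\<dots> = (\<Sum>s\<in>W. (h s * y ^ s) ^ (q ^ (2 * j)))"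
      using cyc_closed_less[OF W(1)] j
      by (intro sum.cong) (auto simp: sh_inverse power_mult_distrib power_sh[OF y])
    finally show "(\<Sum>s\<in>W. h (sh (l - j) s) ^ (q ^ (2 * j)) * y ^ s)
        = (\<Sum>s\<in>W. (h s * y ^ s) ^ (q ^ (2 * j)))" .
  qed
  also have "\<dots> = tr (ev W h y)" by (simp add: tr_def ev_def frob_sum)
  finally show "ev W f y = tr (ev W h y)" .
qed

text \<open>On each orbit f is determined by its value at a i. Going once round the orbit, this
  value must be fixed by the q^(2 n_i)-power map, and there is no other constraint.\<close>

lemma card_rational:
  assumes I: "finite I" and a: "\<And>i. i \<in> I \<Longrightarrow> a i < N"
    and disj: "\<And>i j. i \<in> I \<Longrightarrow> j \<in> I \<Longrightarrow> i \<noteq> j \<Longrightarrow> cyc_set q N (a i) \<inter> cyc_set q N (a j) = {}"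
  shows "card (rational (\<Union>i\<in>I. cyc_set q N (a i))) = q ^ (2 * (\<Sum>i\<in>I. card (cyc_set q N (a i))))"
proof -
  let ?Z = "\<Union>i\<in>I. cyc_set q N (a i)"
  define n where "n i = card (cyc_set q N (a i))" for i
  note per = cyc_set_period[OF a, folded n_def]
  have Z: "cyc_closed ?Z"
    using a by (auto simp: cyc_closed_def intro: cyc_set_less sh_in_cyc_set)
  have a_in: "a i \<in> ?Z" if "i \<in> I" for i using self_in_cyc_set[OF a[OF that]] that by blast
  define K where "K i = (GF (q ^ (2 * n i)) :: 'f set)" for i
  have K: "x \<in> K i \<longleftrightarrow> x ^ (q ^ (2 * n i)) = x" for x i by (simp add: K_def GF_def)
  define r where "r f = (\<lambda>i\<in>I. f (a i))" for f :: "nat \<Rightarrow> 'f"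
  have "bij_betw r (rational ?Z) (\<Pi>\<^sub>E i\<in>I. K i)"
    unfolding bij_betw_def
  proof (intro conjI inj_onI equalityI subsetI)
    fix f g assume fg: "f \<in> rational ?Z" "g \<in> rational ?Z" "r f = r g"
    show "f = g"
    proof
      fix s
      show "f s = g s"
      proof (cases "s \<in> ?Z")
        case True
        then obtain i j where i: "i \<in> I" "s = sh j (a i)" by (auto simp: cyc_set_eq)
        have "f (a i) = g (a i)" using fun_cong[OF fg(3), of i] i by (simp add: r_def)
        thus ?thesis
          unfolding i(2) rational_sh[OF fg(1) Z a_in[OF i(1)]] rational_sh[OF fg(2) Z a_in[OF i(1)]]
          by simp
      qed (use fg in \<open>simp add: rational_def\<close>)
    qed
  next
    fix g assume "g \<in> r ` rational ?Z"
    then obtain f where f: "f \<in> rational ?Z" "g = r f" by blast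
    show "g \<in> (\<Pi>\<^sub>E i\<in>I. K i)"
    proof (rule PiE_I)
      fix i assume i: "i \<in> I"
      have "f (a i) ^ (q ^ (2 * n i)) = f (sh (n i) (a i))"
        using rational_sh[OF f(1) Z a_in[OF i]] by simp
      thus "g i \<in> K i" using per(3)[OF i] i by (simp add: K f(2) r_def)
    qed (simp add: f(2) r_def)
  next
    fix g assume g: "g \<in> (\<Pi>\<^sub>E i\<in>I. K i)"
    \<comment> \<open>The choice of (i, j) does not matter: orbits are disjoint, and j is determined
      modulo the orbit size, which the values of g respect.\<close>
    define f where "f s = (if s \<in> ?Z then
        (let (i, j) = (SOME (i, j). i \<in> I \<and> s = sh j (a i)) in g i ^ (q ^ (2 * j))) else 0)" for s
    have f: "f (sh j (a i)) = g i ^ (q ^ (2 * j))" if i: "i \<in> I" for i j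
    proof -
      let ?s = "sh j (a i)"
      define x where "x = (SOME (i', j'). i' \<in> I \<and> ?s = sh j' (a i'))"
      obtain i' j' where x: "x = (i', j')" by force
      have "case x of (i', j') \<Rightarrow> i' \<in> I \<and> ?s = sh j' (a i')"
        unfolding x_def by (rule someI[of _ "(i, j)"]) (use i in simp)
      hence i': "i' \<in> I" "?s = sh j' (a i')" by (simp_all add: x)
      hence "?s \<in> cyc_set q N (a i')" by (simp add: cyc_set_eq)
      moreover have "?s \<in> cyc_set q N (a i)" by (simp add: cyc_set_eq)
      ultimately have ii: "i' = i" using disj i i' by blast
      have "sh (j mod n i) (a i) = sh (j' mod n i) (a i)"
        using i' ii sh_mod[OF a[OF i] per(3)[OF i]] by simp
      hence jj: "j mod n i = j' mod n i"
        using per(4)[OF i] per(1)[OF i] by (auto simp: inj_on_def)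
      have gi: "g i ^ (q ^ (2 * n i)) = g i" using g i K by blast
      have "g i ^ (q ^ (2 * j)) = g i ^ (q ^ (2 * j'))"
        using frob_fixed_mod[OF gi, of "2 * j"] frob_fixed_mod[OF gi, of "2 * j'"] jj
        by (simp add: mult_mod_right[symmetric])
      moreover have "f ?s = g i' ^ (q ^ (2 * j'))"
        using i unfolding f_def x_def[symmetric] x by (auto simp: cyc_set_eq)
      ultimately show ?thesis using ii by simp
    qed
    have "f \<in> rational ?Z"
      unfolding rational_def mem_Collect_eq
    proof (intro conjI allI impI ballI)
      show "f s = 0" if "s \<notin> ?Z" for s using that by (simp add: f_def)
      fix s assume "s \<in> ?Z"
      then obtain i j where i: "i \<in> I" "s = sh j (a i)" by (auto simp: cyc_set_eq)
      have "f (sh 1 s) = f (sh (Suc j) (a i))" using sh_add[OF a[OF i(1)], of 1 j] i by simp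
      also have "\<dots> = f s ^ (q ^ 2)"
        unfolding i(2) f[OF i(1)] by (simp add: mult.commute flip: power_mult power_add)
      finally show "f (sh 1 s) = f s ^ (q ^ 2)" .
    qed
    moreover have "g = r f"
    proof
      fix i
      show "g i = r f i"
        using f[of i 0] sh_0[OF a, of i] g by (cases "i \<in> I") (auto simp: r_def PiE_def extensional_def)
    qed
    ultimately show "g \<in> r ` rational ?Z" by blast
  qed
  hence "card (rational ?Z) = card (\<Pi>\<^sub>E i\<in>I. K i)" by (rule bij_betw_same_card)
  also have "\<dots> = (\<Prod>i\<in>I. card (K i))" by (rule card_PiE) fact
  also have "\<dots> = (\<Prod>i\<in>I. q ^ (2 * n i))"
    unfolding K_def using per(1,2) by (intro prod.cong refl card_GF) auto
  also have "\<dots> = q ^ (2 * (\<Sum>i\<in>I. n i))" by (simp add: power_sum sum_distrib_left)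
  finally show ?thesis by (simp add: n_def)
qed

end

text \<open>The rank card A ^ m / card G is a positive integer. In the application this yields 2 K
  \<le> N + 2, so that the natural number N + 2 - 2 K is not truncated.\<close>

lemma (in stabilizer) card_G_le: "card G \<le> card A ^ m"
proof -
  obtain B :: "'f qvec set" where "(\<Sum>w\<in>X. proj w w) = of_nat (card B)"
    by (rule orth_projector_basis[OF A(2) orth_projector_proj])
  hence "of_nat (card X) = (of_nat (card B * card G) :: complex)"
    using trace_proj card_G by (simp add: field_simps)
  hence *: "card X = card B * card G" by (simp only: of_nat_eq_iff)
  have "X \<noteq> {}" using nlists_not_empty[of A m] add_subgroup_0[OF A(1)] by blast
  hence "card X \<noteq> 0" using finite_X by simp
  hence "card B \<ge> 1" using * by (cases "card B") auto
  thus ?thesis using * A(2) by (simp add: card_nlists)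
qed

lemma sum_fun_apply: "(\<Sum>s\<in>Z. f s) y = (\<Sum>s\<in>Z. f s y)"
  by (induction Z rule: infinite_finite_induct) simp_all

context cyclotomic_field
begin

lemma finite_rational: "finite Z \<Longrightarrow> finite (rational Z)"
  by (rule finite_subset[OF _ finite_set_of_finite_funs[of Z UNIV 0]]) (auto simp: rational_def)

lemma word_in_subfield_RS:
  assumes f: "f \<in> rational Z" and Z: "cyc_closed Z"
  shows "(\<lambda>y. if y \<in> Y N then ev Z f y else 0) \<in> subfield_RS q N Z"
proof -
  let ?w = "\<lambda>y. if y \<in> Y N then ev Z f y else 0"
  interpret vs: vector_space "\<lambda>(c :: 'f) (v :: 'f \<Rightarrow> 'f) y. c * v y"
    by (rule vector_space_fun)
  have "?w = (\<Sum>s\<in>Z. (\<lambda>y. f s * eval_vec N s y))"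
    by (rule ext) (simp add: sum_fun_apply ev_def eval_vec_def)
  also have "\<dots> \<in> RS N Z"
    unfolding RS_def by (intro vs.span_sum vs.span_scale vs.span_base imageI)
  finally have "?w \<in> RS N Z" .
  moreover have "?w \<in> vectors_over (Y N) (GF (q ^ 2))"
    using ev_rational[OF f Z Z] by (auto simp: vectors_over_def GF_def)
  ultimately show ?thesis by (simp add: subfield_RS_def)
qed

text \<open>
  The trace of the interpolation polynomial realises prescribed values at up to \<open>d + 1\<close> places;
  the place \<open>\<infinity>\<close> (the index \<open>N\<close>) reads off the coefficient of \<open>X\<^sup>d\<close>.
\<close>

lemma rational_interpolation:
  assumes Z: "cyc_closed Z" "{..d} \<subseteq> Z" and W: "cyc_closed W" "W \<subseteq> Z" "d \<in> W" "\<And>s. s \<in> W \<Longrightarrow> d \<le> s"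
    and y: "inj_on y {..<N}" "y ` {..<N} \<subseteq> Y N"
    and S: "S \<subseteq> {..N}" "card S \<le> d + 1" and v: "\<And>i. i \<in> S \<Longrightarrow> v i ^ (q ^ 2) = (v i :: 'f)"
  obtains f where "f \<in> rational Z" "\<And>i. i \<in> S \<Longrightarrow> i < N \<Longrightarrow> ev Z f (y i) = v i"
    "N \<in> S \<Longrightarrow> ev W f 1 = v N"
proof -
  \<comment> \<open>Since tr (v * \<alpha>) = v for v in the small field, it suffices to interpolate
    the values v * \<alpha> over the big field.\<close>
  obtain \<alpha> :: 'f where \<alpha>: "tr \<alpha> = 1" by (rule tr_one_exists)
  define c where "c = (if N \<in> S then v N * \<alpha> else 0)"
  \<comment> \<open>If infinity is among the places, the coefficient c of X^d is already prescribed
    and d free coefficients remain; otherwise c = 0 and there are d + 1.\<close>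
  define d' where "d' = (if N \<in> S then d else d + 1)"
  let ?S = "S - {N}"
  have finS: "finite S" using S finite_subset by blast
  have S': "?S \<subseteq> {..<N}" using S by auto
  have cardS: "card (y ` ?S) \<le> d'"
    using card_image_le[of ?S y] finS S(2) by (auto simp: d'_def)
  define val where "val z = v (the_inv_into {..<N} y z) * \<alpha> - c * z ^ d" for z
  obtain P where P: "\<And>i. i \<ge> card (y ` ?S) \<Longrightarrow> coeff P i = 0" "\<And>z. z \<in> y ` ?S \<Longrightarrow> poly P z = val z"
    using interpolation_exists[of "y ` ?S" val] finS by blast
  define R where "R = P + monom c d"
  have Rd: "coeff R i = 0" if "i > d" for i
    using that P(1)[of i] cardS by (auto simp: R_def d'_def split: if_splits)
  have Rc: "coeff R d = c" if "N \<in> S"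
    using that P(1)[of d] cardS by (simp add: R_def d'_def)
  have Ry: "poly R (y i) = v i * \<alpha>" if "i \<in> S" "i < N" for i
  proof -
    have "the_inv_into {..<N} y (y i) = i" using the_inv_into_f_f[OF y(1)] that by simp
    moreover have "y i \<in> y ` ?S" using that by auto
    ultimately show ?thesis using P(2)[of "y i"] by (simp add: R_def val_def poly_monom)
  qed
  have finZ: "finite Z" using Z(1) finite_subset by (auto simp: cyc_closed_def)
  have evZ: "ev Z (coeff R) x = poly R x" for x
  proof -
    have "ev Z (coeff R) x = (\<Sum>i\<le>d. coeff R i * x ^ i)"
      unfolding ev_def using Rd Z(2) finZ by (intro sum.mono_neutral_right) auto
    also have "\<dots> = (\<Sum>i\<le>degree R. coeff R i * x ^ i)"
      by (intro sum.mono_neutral_right) (use Rd in \<open>auto simp: coeff_eq_0 intro!: degree_le\<close>)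
    finally show ?thesis by (simp add: poly_altdef)
  qed
  \<comment> \<open>R has degree at most d and the exponents in W are at least d, so only X^d
    contributes.\<close>
  have evW: "ev W (coeff R) 1 = coeff R d"
  proof -
    have "ev W (coeff R) 1 = (\<Sum>s\<in>W. if s = d then coeff R d else 0)"
      unfolding ev_def using Rd W(4) by (intro sum.cong) (auto simp: le_less)
    thus ?thesis using W(3) finite_subset[OF W(2) finZ] by simp
  qed
  obtain f where f: "f \<in> rational Z"
    "\<And>W y. cyc_closed W \<Longrightarrow> W \<subseteq> Z \<Longrightarrow> y \<in> Y N \<Longrightarrow> ev W f y = tr (ev W (coeff R) y)"
    using rational_trace[OF Z(1)] by blast
  have tr_v: "tr (v i * \<alpha>) = v i" if "i \<in> S" for i
    using tr_scale[OF v[OF that]] \<alpha> by simp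
  show ?thesis
  proof (rule that[OF f(1)])
    fix i assume i: "i \<in> S" "i < N"
    hence "y i \<in> Y N" using y(2) by auto
    thus "ev Z f (y i) = v i" using f(2)[OF Z(1) order_refl] tr_v i by (simp add: evZ Ry)
  next
    assume "N \<in> S"
    moreover have "(1 :: 'f) \<in> Y N" by (simp add: Y_def)
    ultimately show "ev W f 1 = v N" using f(2)[OF W(1,2)] tr_v Rc by (simp add: evW c_def)
  qed
qed

lemma ev_add: "ev Z (f + g) y = ev Z f y + ev Z g y"
  by (simp add: ev_def distrib_right sum.distrib)

text \<open>
  The coordinates \<open>0, \<dots>, N - 1\<close> of the stabilizer are the points of \<open>Y\<^sub>N\<close>, coordinate \<open>N\<close> is the
  point at infinity. The receiver's coordinate \<open>N + 1\<close> repeats the latter with the sign of the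
  second component changed; this cancels its contribution to the symplectic form.
\<close>

lemma eaqecc_exists:
  fixes a :: "nat \<Rightarrow> nat" and t :: nat
  defines "Z \<equiv> \<Union>i\<in>{..t}. cyc_set q N (a i)" and "K \<equiv> \<Sum>i\<le>t. card (cyc_set q N (a i))"
  assumes a: "\<And>i. i \<le> t \<Longrightarrow> a i < N"
    and disj: "\<And>i j. i \<le> t \<Longrightarrow> j \<le> t \<Longrightarrow> i \<noteq> j \<Longrightarrow> cyc_set q N (a i) \<inter> cyc_set q N (a j) = {}"
    and init: "{..a t} \<subseteq> Z" and least: "\<And>s. s \<in> cyc_set q N (a t) \<Longrightarrow> a t \<le> s"
    and self_orth: "(subfield_RS q N Z :: ('f \<Rightarrow> 'f) set) \<subseteq> herm_dual q (Y N) (subfield_RS q N Z)"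
  shows "2 * K \<le> N + 2 \<and> eaqecc_params (GF q :: 'f set) (N + 1) (N + 2 - 2 * K) (a t + 2) 1"
proof -
  let ?W = "cyc_set q N (a t)" and ?A = "GF q :: 'f set" and ?B = "GF (q ^ 2) :: 'f set"
  let ?G = "rational Z :: (nat \<Rightarrow> 'f) set"
  have Z: "cyc_closed Z"
    unfolding cyc_closed_def Z_def using a by (auto intro: cyc_set_less sh_in_cyc_set)
  have W: "cyc_closed ?W" "?W \<subseteq> Z" "a t \<in> ?W"
    unfolding cyc_closed_def Z_def using a[of t]
    by (auto intro: cyc_set_less sh_in_cyc_set self_in_cyc_set)
  have finZ: "finite Z" using Z finite_subset by (auto simp: cyc_closed_def)
  have cardA: "card ?A = q" using card_GF[of 1] by simp
  have A: "x \<in> ?A \<longleftrightarrow> x ^ q = x" and B: "x \<in> ?B \<longleftrightarrow> x ^ (q ^ 2) = x" for x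
    by (simp_all add: GF_def)
  note frob1 = frob_add[of _ _ 1, simplified] frob_diff[of _ _ 1, simplified]
    frob_uminus[of _ 1, simplified]
  have frob2: "(x ^ q) ^ q = x ^ (q ^ 2)" for x :: 'f
    by (simp add: power2_eq_square power_mult)
  have "card ?A < card ?B" using cardA card_GF[of 2] q by (simp add: power2_eq_square)
  hence "\<not> ?B \<subseteq> ?A" using card_mono[of ?A ?B] by auto
  then obtain \<omega> where \<omega>: "\<omega> \<in> ?B" "\<omega> \<notin> ?A" by blast
  \<comment> \<open>\<open>re\<close> and \<open>im\<close> are coordinates in the basis 1, \<omega>
    of the field with q^2 elements over that with q. Dividing by \<omega> - \<omega>^q instead of 2
    keeps characteristic 2 included.\<close>
  define c where "c = \<omega> - \<omega> ^ q"
  have c: "c \<noteq> 0" "c ^ q = - c"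
    using \<omega> by (auto simp: A B c_def frob1 frob2)
  define im where "im v = (v - v ^ q) / c" for v
  define re where "re v = v - \<omega> * im v" for v
  have im_add: "im (v + w) = im v + im w" and re_add: "re (v + w) = re v + re w" for v w
    by (simp_all add: re_def im_def frob1 add_divide_distrib diff_divide_distrib algebra_simps)
  have im_in: "im v \<in> ?A" if "v \<in> ?B" for v
  proof -
    have "(v - v ^ q) ^ q = - (v - v ^ q)" using that by (simp add: B frob1 frob2)
    hence "im v ^ q = - (v - v ^ q) / - c" by (simp only: im_def power_divide c(2))
    thus ?thesis unfolding A im_def by (simp only: minus_divide_divide)
  qed
  have re_in: "re v \<in> ?A" if "v \<in> ?B" for v
  proof -
    have "re v - re v ^ q = (v - v ^ q) - c * im v"
      using im_in[OF that] by (simp add: re_def frob1 power_mult_distrib A c_def algebra_simps)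
    thus ?thesis using c by (simp add: A im_def)
  qed
  have decomp: "re (x + \<omega> * y) = x" "im (x + \<omega> * y) = y" if "x \<in> ?A" "y \<in> ?A" for x y
  proof -
    have "(x + \<omega> * y) - (x + \<omega> * y) ^ q = c * y"
      using that by (simp add: frob1 power_mult_distrib A c_def algebra_simps)
    thus "im (x + \<omega> * y) = y" using c by (simp add: im_def)
    thus "re (x + \<omega> * y) = x" by (simp add: re_def)
  qed
  have in_B: "x + \<omega> * y \<in> ?B" if "x \<in> ?A" "y \<in> ?A" for x y
    using that \<omega>(1) frob_fixed[of x 1 2] frob_fixed[of y 1 2]
    by (simp add: A B frob_add power_mult_distrib)
  \<comment> \<open>The antisymmetrised Hermitian product is c times the symplectic form, so
    Hermitian orthogonality in both orders gives symplectic orthogonality.\<close>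
  have form: "v * w ^ q - w * v ^ q = c * (im v * re w - im w * re v)" if "v \<in> ?B" "w \<in> ?B" for v w
  proof -
    have *: "v = re v + \<omega> * im v" for v by (simp add: re_def)
    have **: "v ^ q = re v + \<omega> ^ q * im v" if "v \<in> ?B" for v
      using re_in[OF that] im_in[OF that] by (subst *) (simp add: frob1 power_mult_distrib A)
    show ?thesis
      unfolding **[OF that(1)] **[OF that(2)]
      by (subst (1) *[of v], subst (2) *[of w]) (simp add: c_def algebra_simps)
  qed
  obtain y where y: "bij_betw y {..<N} (Y N :: 'f set)"
    using card_Y finite_same_card_bij[of "{..<N}" "Y N :: 'f set"] by auto
  have yY: "y i \<in> Y N" if "i < N" for i using y that by (auto simp: bij_betw_def)
  \<comment> \<open>Every index from N on reads the value at infinity, in particular the receiver's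
    index N + 1.\<close>
  define u where "u f i = (if i < N then ev Z f (y i) else ev ?W f 1)" for f i
  have u_add: "u (f + g) i = u f i + u g i" for f g i by (simp add: u_def ev_add)
  have u_in: "u f i \<in> ?B" if "f \<in> ?G" for f i
    using ev_rational[OF that Z Z order_refl yY] ev_rational[OF that Z W(1,2), of 1]
    by (simp add: u_def B Y_def)
  define aa where "aa f i = re (u f i)" for f i
  define bb where "bb f i = (if i = N + 1 then - im (u f i) else im (u f i))" for f i
  have aa_add: "aa (f + g) i = aa f i + aa g i" and bb_add: "bb (f + g) i = bb f i + bb g i" for f g i
    by (simp_all add: aa_def bb_def u_add re_add im_add)
  have A_sub: "add_subgroup ?A"
    unfolding add_subgroup_def using q by (simp add: A frob1 power_0_left)
  obtain \<chi> :: "'f \<Rightarrow> complex" where \<chi>: "\<And>x y. \<chi> (x + y) = \<chi> x * \<chi> y" "\<And>x. norm (\<chi> x) = 1" "\<chi> 1 \<noteq> 1"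
    using additive_character_exists by blast
  define \<beta> where "\<beta> f g = \<chi> (\<Sum>i<N+2. bb f i * aa g i)" for f g
  have bichar: "bichar \<beta>"
    by standard (simp_all add: \<beta>_def aa_add bb_add distrib_left distrib_right sum.distrib \<chi> norm_mult)
  have sym: "\<beta> f g = \<beta> g f" if f: "f \<in> ?G" and g: "g \<in> ?G" for f g
  proof -
    have herm: "(\<Sum>i<N. u f i * u g i ^ q) = 0" if "f \<in> ?G" "g \<in> ?G" for f g
    proof -
      let ?w = "\<lambda>f y. if y \<in> Y N then ev Z f y else 0"
      have "?w f \<in> subfield_RS q N Z" "?w g \<in> subfield_RS q N Z"
        using word_in_subfield_RS[OF _ Z] that by blast+
      hence "herm_prod q (Y N) (?w f) (?w g) = 0"
        using self_orth by (auto simp: herm_dual_def)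
      moreover have "herm_prod q (Y N) (?w f) (?w g) = (\<Sum>y\<in>Y N. ev Z f y * ev Z g y ^ q)"
        unfolding herm_prod_def by (rule sum.cong) auto
      moreover have "\<dots> = (\<Sum>i<N. ev Z f (y i) * ev Z g (y i) ^ q)"
        by (rule sum.reindex_bij_betw[OF y, symmetric])
      ultimately show ?thesis by (simp add: u_def)
    qed
    have "c * (\<Sum>i<N. im (u f i) * re (u g i) - im (u g i) * re (u f i))
        = (\<Sum>i<N. u f i * u g i ^ q - u g i * u f i ^ q)"
      unfolding sum_distrib_left form[OF u_in[OF f] u_in[OF g]] ..
    also have "\<dots> = 0" using herm[OF f g] herm[OF g f] by (simp add: sum_subtractf)
    finally have "c * (\<Sum>i<N. im (u f i) * re (u g i) - im (u g i) * re (u f i)) = 0" .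
    hence "(\<Sum>i<N. im (u f i) * re (u g i)) = (\<Sum>i<N. im (u g i) * re (u f i))"
      using c(1) by (simp add: sum_subtractf)
    \<comment> \<open>The terms at N and N + 1 cancel.\<close>
    moreover have "(\<Sum>i<N+2. bb f i * aa g i) = (\<Sum>i<N. im (u f i) * re (u g i))" for f g
      by (simp add: aa_def bb_def u_def)
    ultimately show ?thesis by (simp add: \<beta>_def)
  qed
  have "of_nat p = (0 :: nat \<Rightarrow> 'f)"
    using of_nat_CHAR[where 'a = 'f] by (simp add: char_eq of_nat_fun fun_eq_iff)
  then obtain \<theta> where \<theta>: "splits_on \<beta> ?G \<theta>"
    using splitting_exists[OF bichar p _ add_subgroup_rational _ sym] finite_rational[OF finZ] by blast
  have surj_aux: "\<exists>f\<in>?G. \<forall>i\<in>S. u f i = x i + \<omega> * x' i"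
    if S: "S \<subseteq> {..N}" "card S \<le> a t + 1" and x: "\<And>i. i \<in> S \<Longrightarrow> x i \<in> ?A \<and> x' i \<in> ?A" for S x x'
  proof -
    obtain f where f: "f \<in> ?G" "\<And>i. i \<in> S \<Longrightarrow> i < N \<Longrightarrow> ev Z f (y i) = x i + \<omega> * x' i"
      "N \<in> S \<Longrightarrow> ev ?W f 1 = x N + \<omega> * x' N"
    proof (rule rational_interpolation[OF Z init W least _ _ S, of y "\<lambda>i. x i + \<omega> * x' i"])
      show "inj_on y {..<N}" "y ` {..<N} \<subseteq> Y N" using y by (auto simp: bij_betw_def)
      show "(x i + \<omega> * x' i) ^ q\<^sup>2 = x i + \<omega> * x' i" if "i \<in> S" for i
        using in_B x[OF that] by (simp add: B)
    qed (assumption, rule that, blast+)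
    have "u f i = x i + \<omega> * x' i" if "i \<in> S" for i
    proof (cases "i < N")
      case False
      hence "i = N" using that S by auto
      thus ?thesis using f(3) that by (simp add: u_def)
    qed (use f(2) that in \<open>simp add: u_def\<close>)
    thus ?thesis using f(1) by blast
  qed
  interpret stab: stabilizer ?A \<chi> "N + 2" ?G aa bb \<theta>
  proof
    show "\<exists>y\<in>?A. \<chi> (y * x) \<noteq> 1" if "x \<in> ?A" "x \<noteq> 0" for x
      by (rule bexI[of _ "inverse x"]) (use that \<chi>(3) in \<open>auto simp: A power_inverse\<close>)
    show "f = 0" if f: "f \<in> ?G" and 0: "\<And>i. i < N + 2 \<Longrightarrow> aa f i = 0" "\<And>i. i < N + 2 \<Longrightarrow> bb f i = 0" for f
    proof
      fix s
      have "ev Z f x = 0" if "x \<in> Y N" for x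
      proof -
        obtain i where i: "i < N" "x = y i" using y \<open>x \<in> Y N\<close> by (auto simp: bij_betw_def)
        have "im (u f i) = 0" "re (u f i) = 0"
          using 0[of i] i by (simp_all add: aa_def bb_def)
        hence "u f i = 0" by (simp add: re_def)
        thus ?thesis using i by (simp add: u_def)
      qed
      \<comment> \<open>The affine values alone determine f, as its exponents are below N.\<close>
      hence "f s = 0" if "s \<in> Z" using ev_eq_0[OF _ _ that] Z by (simp add: cyc_closed_def)
      moreover have "f s = 0" if "s \<notin> Z" using f that by (simp add: rational_def)
      ultimately show "f s = 0 s" by auto
    qed
    show "splits_on (\<lambda>g h. \<chi> (\<Sum>i<N+2. bb g i * aa h i)) ?G \<theta>"
      using \<theta> unfolding \<beta>_def .
    show "bb f i \<in> ?A" if "f \<in> ?G" for f i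
      using im_in[OF u_in[OF that]] add_subgroup_uminus[OF A_sub] by (simp add: bb_def)
    show "aa f i \<in> ?A" if "f \<in> ?G" for f i
      using re_in[OF u_in[OF that]] by (simp add: aa_def)
  qed (use A_sub \<chi> finite_rational[OF finZ] add_subgroup_rational in \<open>auto simp: aa_add bb_add\<close>)
  have cardG: "card ?G = q ^ (2 * K)"
    unfolding Z_def K_def using a disj by (intro card_rational) auto
  have "q ^ (2 * K) \<le> q ^ (N + 2)"
    using stab.card_G_le by (simp only: cardG cardA)
  hence K: "2 * K \<le> N + 2" using q by (meson power_le_imp_le_exp)
  have "card (cyc_set q N (a t)) > 0" using cyc_set_period(1)[OF a[of t]] by simp
  hence K1: "K \<ge> 1"
    unfolding K_def using member_le_sum[of t "{..t}" "\<lambda>i. card (cyc_set q N (a i))"] by simp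
  have "eaqecc_params ?A (N + 1) (N + 2 - 2 * K) (a t + 2) 1"
  proof (rule stab.eaqecc_params_one)
    show "N + 2 = Suc (N + 1)" by simp
    show "N + 2 - 2 * K + 1 \<le> N + 1" using K1 by simp
    show "card ?A ^ (N + 2) = card ?G * card ?A ^ (N + 2 - 2 * K)"
      unfolding cardG cardA using K by (simp flip: power_add)
    fix S and x x' :: "nat \<Rightarrow> 'f"
    assume S: "S \<subseteq> {..<N + 1} \<and> card S < a t + 2 \<or> S = {N + 1}"
      and x: "\<And>i. i \<in> S \<Longrightarrow> x i \<in> ?A \<and> x' i \<in> ?A"
    show "\<exists>g\<in>?G. \<forall>i\<in>S. aa g i = x i \<and> bb g i = x' i"
    proof (cases "S = {N + 1}")
      case True
      \<comment> \<open>Coordinate N + 1 is reached through infinity, with the sign of the second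
        component undone.\<close>
      have "- x' (N + 1) \<in> ?A" using x[of "N + 1"] True add_subgroup_uminus[OF A_sub] by simp
      moreover obtain f where f: "f \<in> ?G" "u f N = x (N + 1) + \<omega> * (- x' (N + 1))"
        using surj_aux[of "{N}" "\<lambda>_. x (N + 1)" "\<lambda>_. - x' (N + 1)"] x[of "N + 1"] True calculation by auto
      moreover have "u f (N + 1) = u f N" by (simp add: u_def)
      ultimately show ?thesis
        using decomp[of "x (N + 1)" "- x' (N + 1)"] x[of "N + 1"] True
        by (intro bexI[of _ f]) (auto simp: aa_def bb_def)
    next
      case False
      hence "S \<subseteq> {..N}" "card S \<le> a t + 1" "N + 1 \<notin> S" using S by auto
      then obtain f where "f \<in> ?G" "\<And>i. i \<in> S \<Longrightarrow> u f i = x i + \<omega> * x' i"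
        using surj_aux[of S x x'] x by blast
      thus ?thesis
        using decomp x \<open>N + 1 \<notin> S\<close> by (intro bexI[of _ f]) (auto simp: aa_def bb_def)
    qed
  qed
  thus ?thesis using K by blast
qed

end

theorem theorem5p15:
  fixes p e q l N z t :: nat
    and a :: "nat \<Rightarrow> nat"
    and \<Delta>'' :: "nat set"
  assumes "prime p" and "e \<ge> 1" and "q = p ^ e"
    and "l \<ge> 1"
    and "card (UNIV :: 'f :: finite_field set) = q ^ (2 * l)"
    and "N > 1" and "(N - 1) dvd (q ^ (2 * l) - 1)" and "p dvd N"
    and "strict_mono_on {0..z} a" and "a ` {0..z} = min_reps q N"
    and "t \<le> z"
    and "\<Delta>'' = (\<Union>i\<in>{0..t}. cyc_set q N (a i))"
    and "(subfield_RS q N \<Delta>'' :: ('f \<Rightarrow> 'f) set)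
           \<subseteq> herm_dual q (Y N) (subfield_RS q N \<Delta>'')"
  shows "\<exists>\<kappa> c. c \<le> 1 \<and>
           int \<kappa> = int N + 1 - 2 * (\<Sum>i=0..t. int (card (cyc_set q N (a i)))) + int c \<and>
           eaqecc_params (GF q :: 'f set) (N + 1) \<kappa> (a t + 2) c"
proof -
  have q: "q > 1" using assms(1-3) prime_gt_1_nat[of p] one_less_power[of p e] by simp
  interpret cyclotomic_field q l N p e "TYPE('f)"
    by unfold_locales (use assms q in auto)
  define K where "K = (\<Sum>i\<le>t. card (cyc_set q N (a i)))"
  have rep: "a i \<in> min_reps q N" if "i \<le> z" for i
    using assms(10) that by (metis atLeast0AtMost atMost_iff imageI)
  have a_less: "a i < N" if "i \<le> t" for i
    using min_rep(1) rep that assms(11) by simp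
  have a_mono: "a i < a j" if "i < j" "j \<le> z" for i j
    using strict_mono_onD[OF assms(9), of i j] that by simp
  have "2 * K \<le> N + 2 \<and> eaqecc_params (GF q :: 'f set) (N + 1) (N + 2 - 2 * K) (a t + 2) 1"
    unfolding K_def
  proof (rule eaqecc_exists)
    show "a i < N" if "i \<le> t" for i by (rule a_less) fact
    show "cyc_set q N (a i) \<inter> cyc_set q N (a j) = {}" if ij: "i \<le> t" "j \<le> t" "i \<noteq> j" for i j
    proof (rule ccontr)
      assume "cyc_set q N (a i) \<inter> cyc_set q N (a j) \<noteq> {}"
      then obtain s where "s \<in> cyc_set q N (a i)" "s \<in> cyc_set q N (a j)" by blast
      hence "cyc_set q N (a i) = cyc_set q N (a j)"
        using cyc_set_sym a_less ij by metis
      hence "a i = a j" using min_rep(2) rep ij assms(11) by (metis order_trans)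
      thus False using a_mono ij assms(11) by (metis less_irrefl linorder_neqE_nat order_trans)
    qed
    show "{..a t} \<subseteq> (\<Union>i\<in>{..t}. cyc_set q N (a i))"
    proof
      fix s assume s: "s \<in> {..a t}"
      hence "s < N" using a_less[of t] by simp
      then obtain r where r: "r \<in> min_reps q N" "r \<le> s" "s \<in> cyc_set q N r"
        by (rule min_rep_exists)
      then obtain i where i: "i \<le> z" "r = a i"
        using r(1) unfolding assms(10)[symmetric] by auto
      \<comment> \<open>The representatives are numbered increasingly: i > t would give r > a t
        \<ge> s.\<close>
      have "i \<le> t" using a_mono[of t i] i r s by (metis atMost_iff leD le_trans not_less)
      thus "s \<in> (\<Union>i\<in>{..t}. cyc_set q N (a i))" using i r by blast
    qed
    show "a t \<le> s" if "s \<in> cyc_set q N (a t)" for s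
      using min_rep(2)[OF rep[OF assms(11)]] finite_cyc_set[OF a_less[OF order_refl]] that
      by (metis Min_le)
    show "(subfield_RS q N (\<Union>i\<in>{..t}. cyc_set q N (a i)) :: ('f \<Rightarrow> 'f) set)
      \<subseteq> herm_dual q (Y N) (subfield_RS q N (\<Union>i\<in>{..t}. cyc_set q N (a i)))"
      using assms(12,13) by (simp add: atLeast0AtMost)
  qed
  moreover have "(\<Sum>i=0..t. int (card (cyc_set q N (a i)))) = int K"
    by (simp add: K_def atLeast0AtMost)
  ultimately show ?thesis
    by (intro exI[of _ "N + 2 - 2 * K"] exI[of _ 1]) (auto simp: of_nat_diff)
qed

end
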